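(* Let $X$ be a $\mathrm{CAT}(0)$ space, and let $G$ be a group acting on $X$ geometrically. Let $G_X$ be the coarse kernel of the action and $X_D$ the curtain model of $X$. Then: (i) $G_X$ is virtually $\mathbb{Z}^n$ for some $n\in\mathbb{Z}_{\ge 0}$. (ii) If moreover $X_D$ is unbounded, then $G_X$ is virtually cyclic. (iii) If furthermore $X_D$ is not a quasi-line (so $X_D$ is unbounded and not a quasi-line), then $G_X$ is the largest finite normal subgroup of $G$.
   Context: All actions are by isometries. An action of $G$ on a $\mathrm{CAT}(0)$ space $(X,d)$ is geometric if it is properly discontinuous (for every $x\in X$, $r>0$ only finitely many $g\in G$ satisfy $d(g\cdot x,x)\le r$) and co-compact. A quasi-line is a metric space quasi-isometric to $\mathbb{R}$. A group is virtually $\mathbb{Z}^n$ (resp. virtually cyclic) if it has a finite index subgroup isomorphic to $\mathbb{Z}^n$ (resp. a cyclic, possibly trivial, one). Coarse kernel: for $G$ acting on $(X,d)$, $G_X := \{g\in G \mid \exists C>0 \text{ with } d(g\cdot x,x)\le C\ \forall x\in X\}$. Curtain model. Let $X$ be a $\mathrm{CAT}(0)$ space. For a geodesic $\alpha:I\to X$ ($I\subseteq\mathbb{R}$ a closed interval) with closest-point projection $\pi_\alpha$ onto $\alpha$, and $r$ with $[r-1/2,r+1/2]$ in the interior of $I$, the curtain dual to $\alpha$ at $r$ is $h=h_{\alpha,r}=\pi_\alpha^{-1}(\alpha[r-1/2,r+1/2])$. Its halfspaces are $h^-=\pi_\alpha^{-1}\alpha(I\cap(-\infty,r-1/2))$ and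 $h^+=\pi_\alpha^{-1}\alpha(I\cap(r+1/2,\infty))$. The curtain $h$ separates subsets $A,B\subseteq X$ if one lies in $h^-$ and the other in $h^+$. A set $\{h_i\}$ of curtains (indexed by consecutive integers) is a chain if $h_i$ separates $h_{i-1}$ from $h_{i+1}$ for all $i$; a chain separates $A$ from $B$ if each $h_i$ does. For $L\in\mathbb{N}$, $L\geq 1$, disjoint curtains $h,h'$ are $L$-separated if every chain all of whose members meet both $h$ and $h'$ has cardinality at most $L$. An $L$-chain is a chain of curtains in which each pair is $L$-separated. Set $d_L(x,x)=0$ and, for $x\ne y$, $d_L(x,y)=1+\max\{|c| : c \text{ is an } L\text{-chain separating } x \text{ from } y\}$. Fix a sequence $\lambda_L\in(0,1)$ with $\sum_{L\ge1}\lambda_L<\sum_{L\ge1}L\lambda_L<\sum_{L\ge1}L^2\lambda_L=\Lambda<\infty$. The curtain model is $X_D:=(X,D)$ with $D(x,y)=\sum_{L=1}^\infty\lambda_L d_L(x,y)$. *)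

theory Defs
  imports
    "HOL-Analysis.Analysis"
    "HOL-Algebra.Group_Action"
    "HOL-Algebra.Elementary_Groups"
    "HOL-Algebra.Product_Groups"
begin

section \<open>CAT(0) spaces\<close>

text \<open>The metric space is a type of class \<^class>\<open>metric_space\<close>; in particular it is nonempty.
  A geodesic is an isometric embedding of a closed interval (possibly unbounded); its values
  outside the interval are irrelevant.\<close>

definition geodesic :: "real set \<Rightarrow> (real \<Rightarrow> 'a::metric_space) \<Rightarrow> bool" where
  "geodesic I \<alpha> \<longleftrightarrow> I \<noteq> {} \<and> is_interval I \<and> closed I \<and>
     (\<forall>s\<in>I. \<forall>t\<in>I. dist (\<alpha> s) (\<alpha> t) = \<bar>s - t\<bar>)"

definition geodesic_from_to :: "'a::metric_space \<Rightarrow> 'a \<Rightarrow> (real \<Rightarrow> 'a) \<Rightarrow> bool" where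
  "geodesic_from_to x y \<alpha> \<longleftrightarrow>
     geodesic {0..dist x y} \<alpha> \<and> \<alpha> 0 = x \<and> \<alpha> (dist x y) = y"

text \<open>Pairs of a point on the side \<open>\<alpha>\<close> from \<open>x\<close> to \<open>y\<close> and its comparison point on the
  Euclidean side from \<open>x'\<close> to \<open>y'\<close>.\<close>

definition comparison_pairs ::
    "'a::metric_space \<Rightarrow> 'a \<Rightarrow> (real \<Rightarrow> 'a) \<Rightarrow> real^2 \<Rightarrow> real^2 \<Rightarrow> ('a \<times> (real^2)) set" where
  "comparison_pairs x y \<alpha> x' y' =
     {(\<alpha> s, p') | s p'. s \<in> {0..dist x y} \<and> p' \<in> closed_segment x' y' \<and> dist x' p' = s}"

definition CAT0_space :: "'a::metric_space itself \<Rightarrow> bool" where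
  "CAT0_space _ \<longleftrightarrow>
     (\<forall>x y :: 'a. \<exists>\<alpha>. geodesic_from_to x y \<alpha>) \<and>
     (\<forall>(x::'a) y z \<alpha> \<beta> \<gamma> x' y' z'.
        geodesic_from_to x y \<alpha> \<and> geodesic_from_to y z \<beta> \<and> geodesic_from_to z x \<gamma> \<and>
        dist x' y' = dist x y \<and> dist y' z' = dist y z \<and> dist z' x' = dist z x \<longrightarrow>
        (let P = comparison_pairs x y \<alpha> x' y' \<union> comparison_pairs y z \<beta> y' z' \<union>
                 comparison_pairs z x \<gamma> z' x'
         in \<forall>(p, p')\<in>P. \<forall>(q, q')\<in>P. dist p q \<le> dist p' q'))"

section \<open>Geometric actions\<close>

definition isometric_action :: "'g monoid \<Rightarrow> ('g \<Rightarrow> 'a::metric_space \<Rightarrow> 'a) \<Rightarrow> bool" where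
  "isometric_action G \<phi> \<longleftrightarrow> group_action G UNIV \<phi> \<and>
     (\<forall>g\<in>carrier G. \<forall>x y. dist (\<phi> g x) (\<phi> g y) = dist x y)"

definition properly_discontinuous_action ::
    "'g monoid \<Rightarrow> ('g \<Rightarrow> 'a::metric_space \<Rightarrow> 'a) \<Rightarrow> bool" where
  "properly_discontinuous_action G \<phi> \<longleftrightarrow>
     (\<forall>x. \<forall>r>0. finite {g \<in> carrier G. dist (\<phi> g x) x \<le> r})"

definition cocompact_action :: "'g monoid \<Rightarrow> ('g \<Rightarrow> 'a::metric_space \<Rightarrow> 'a) \<Rightarrow> bool" where
  "cocompact_action G \<phi> \<longleftrightarrow> (\<exists>K. compact K \<and> (\<Union>g\<in>carrier G. \<phi> g ` K) = UNIV)"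

definition geometric_action :: "'g monoid \<Rightarrow> ('g \<Rightarrow> 'a::metric_space \<Rightarrow> 'a) \<Rightarrow> bool" where
  "geometric_action G \<phi> \<longleftrightarrow>
     isometric_action G \<phi> \<and> properly_discontinuous_action G \<phi> \<and> cocompact_action G \<phi>"

definition coarse_kernel :: "'g monoid \<Rightarrow> ('g \<Rightarrow> 'a::metric_space \<Rightarrow> 'a) \<Rightarrow> 'g set" where
  "coarse_kernel G \<phi> = {g \<in> carrier G. \<exists>C>0. \<forall>x. dist (\<phi> g x) x \<le> C}"

section \<open>Virtual properties of groups\<close>

definition finite_index_subgroup :: "'g set \<Rightarrow> 'g monoid \<Rightarrow> bool" where
  "finite_index_subgroup H G \<longleftrightarrow> group G \<and> subgroup H G \<and> finite (rcosets\<^bsub>G\<^esub> H)"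

definition free_abelian_of_rank :: "nat \<Rightarrow> (nat \<Rightarrow> int) monoid" where
  "free_abelian_of_rank n = product_group {..<n} (\<lambda>_. integer_group)"

definition virtually_Zn :: "nat \<Rightarrow> 'g monoid \<Rightarrow> bool" where
  "virtually_Zn n G \<longleftrightarrow>
     (\<exists>H. finite_index_subgroup H G \<and> G\<lparr>carrier := H\<rparr> \<cong> free_abelian_of_rank n)"

definition virtually_cyclic :: "'g monoid \<Rightarrow> bool" where
  "virtually_cyclic G \<longleftrightarrow> (\<exists>H. finite_index_subgroup H G \<and> cyclic_group (G\<lparr>carrier := H\<rparr>))"

definition largest_finite_normal_subgroup :: "'g set \<Rightarrow> 'g monoid \<Rightarrow> bool" where
  "largest_finite_normal_subgroup N G \<longleftrightarrow>
     N \<lhd> G \<and> finite N \<and> (\<forall>M. M \<lhd> G \<and> finite M \<longrightarrow> M \<subseteq> N)"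

section \<open>Curtains\<close>

text \<open>\<^const>\<open>closest_point\<close> is only available in Euclidean spaces. In a CAT(0) space the image
  of a geodesic is convex and complete, so that the nearest point exists and is unique.\<close>

definition geodesic_proj :: "real set \<Rightarrow> (real \<Rightarrow> 'a::metric_space) \<Rightarrow> 'a \<Rightarrow> 'a" where
  "geodesic_proj I \<alpha> x = (THE p. p \<in> \<alpha> ` I \<and> (\<forall>q\<in>\<alpha> ` I. dist x p \<le> dist x q))"

definition curtain_datum :: "real set \<Rightarrow> (real \<Rightarrow> 'a::metric_space) \<Rightarrow> real \<Rightarrow> bool" where
  "curtain_datum I \<alpha> r \<longleftrightarrow> geodesic I \<alpha> \<and> {r - 1/2..r + 1/2} \<subseteq> interior I"

definition dual_curtain :: "real set \<Rightarrow> (real \<Rightarrow> 'a::metric_space) \<Rightarrow> real \<Rightarrow> 'a set" where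
  "dual_curtain I \<alpha> r = geodesic_proj I \<alpha> -` (\<alpha> ` {r - 1/2..r + 1/2})"

definition neg_halfspace :: "real set \<Rightarrow> (real \<Rightarrow> 'a::metric_space) \<Rightarrow> real \<Rightarrow> 'a set" where
  "neg_halfspace I \<alpha> r = geodesic_proj I \<alpha> -` (\<alpha> ` (I \<inter> {..<r - 1/2}))"

definition pos_halfspace :: "real set \<Rightarrow> (real \<Rightarrow> 'a::metric_space) \<Rightarrow> real \<Rightarrow> 'a set" where
  "pos_halfspace I \<alpha> r = geodesic_proj I \<alpha> -` (\<alpha> ` (I \<inter> {r + 1/2<..}))"

definition curtain :: "'a::metric_space set \<Rightarrow> bool" where
  "curtain h \<longleftrightarrow> (\<exists>I \<alpha> r. curtain_datum I \<alpha> r \<and> h = dual_curtain I \<alpha> r)"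

text \<open>A curtain is treated as a subset of the space. The existential choice of a dual geodesic
  is harmless: in a CAT(0) space the two halfspaces are the two connected components of the
  complement of \<open>h\<close>, so up to exchanging them they depend only on the set \<open>h\<close>.\<close>

definition separates :: "'a::metric_space set \<Rightarrow> 'a set \<Rightarrow> 'a set \<Rightarrow> bool" where
  "separates h A B \<longleftrightarrow>
     (\<exists>I \<alpha> r. curtain_datum I \<alpha> r \<and> h = dual_curtain I \<alpha> r \<and>
        (A \<subseteq> neg_halfspace I \<alpha> r \<and> B \<subseteq> pos_halfspace I \<alpha> r \<or>
         B \<subseteq> neg_halfspace I \<alpha> r \<and> A \<subseteq> pos_halfspace I \<alpha> r))"

text \<open>\<open>J\<close> is a set of consecutive integers; chains may be empty or infinite. The separation
  condition concerns only those indices which have both neighbours in \<open>J\<close>.\<close>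

definition curtain_chain :: "'a::metric_space set set \<Rightarrow> bool" where
  "curtain_chain c \<longleftrightarrow>
     (\<exists>(J :: int set) h. (\<forall>i\<in>J. \<forall>j\<in>J. {i..j} \<subseteq> J) \<and> bij_betw h J c \<and>
        (\<forall>i\<in>J. curtain (h i)) \<and>
        (\<forall>i. i - 1 \<in> J \<and> i \<in> J \<and> i + 1 \<in> J \<longrightarrow> separates (h i) (h (i - 1)) (h (i + 1))))"

definition L_separated :: "nat \<Rightarrow> 'a::metric_space set \<Rightarrow> 'a set \<Rightarrow> bool" where
  "L_separated L h h' \<longleftrightarrow> curtain h \<and> curtain h' \<and> h \<inter> h' = {} \<and>
     (\<forall>c. curtain_chain c \<and> (\<forall>k\<in>c. k \<inter> h \<noteq> {} \<and> k \<inter> h' \<noteq> {}) \<longrightarrow> finite c \<and> card c \<le> L)"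

definition L_chain :: "nat \<Rightarrow> 'a::metric_space set set \<Rightarrow> bool" where
  "L_chain L c \<longleftrightarrow> curtain_chain c \<and> (\<forall>h\<in>c. \<forall>h'\<in>c. h \<noteq> h' \<longrightarrow> L_separated L h h')"

section \<open>The curtain model\<close>

text \<open>An \<open>L\<close>-chain separating \<open>x\<close> from \<open>y\<close> consists of pairwise disjoint curtains, each of which
  contains a subsegment of length at least 1 of a geodesic from \<open>x\<close> to \<open>y\<close>; hence it is finite
  and the maximum below, which includes the empty chain, is over a finite nonempty set.\<close>

definition curtain_dist :: "nat \<Rightarrow> 'a::metric_space \<Rightarrow> 'a \<Rightarrow> nat" where
  "curtain_dist L x y =
     (if x = y then 0
      else 1 + Max {card c | c. L_chain L c \<and> (\<forall>h\<in>c. separates h {x} {y})})"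

text \<open>Only the values \<open>lam L\<close> with \<open>L \<ge> 1\<close> matter. Convergence of the first two series follows
  from that of the third.\<close>

definition curtain_weights :: "(nat \<Rightarrow> real) \<Rightarrow> bool" where
  "curtain_weights lam \<longleftrightarrow>
     (\<forall>L\<ge>1. 0 < lam L \<and> lam L < 1) \<and>
     summable (\<lambda>L. real (Suc L) ^ 2 * lam (Suc L)) \<and>
     (\<Sum>L. lam (Suc L)) < (\<Sum>L. real (Suc L) * lam (Suc L)) \<and>
     (\<Sum>L. real (Suc L) * lam (Suc L)) < (\<Sum>L. real (Suc L) ^ 2 * lam (Suc L))"

definition curtain_model_dist :: "(nat \<Rightarrow> real) \<Rightarrow> 'a::metric_space \<Rightarrow> 'a \<Rightarrow> real" where
  "curtain_model_dist lam x y = (\<Sum>L. lam (Suc L) * real (curtain_dist (Suc L) x y))"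

section \<open>Coarse properties of a distance function\<close>

definition unbounded_metric :: "('a \<Rightarrow> 'a \<Rightarrow> real) \<Rightarrow> bool" where
  "unbounded_metric d \<longleftrightarrow> \<not> (\<exists>B. \<forall>x y. d x y \<le> B)"

definition quasi_isometry ::
    "('a \<Rightarrow> 'a \<Rightarrow> real) \<Rightarrow> ('b \<Rightarrow> 'b \<Rightarrow> real) \<Rightarrow> ('a \<Rightarrow> 'b) \<Rightarrow> bool" where
  "quasi_isometry d e f \<longleftrightarrow>
     (\<exists>K\<ge>1. \<exists>C\<ge>0.
        (\<forall>x y. d x y / K - C \<le> e (f x) (f y) \<and> e (f x) (f y) \<le> K * d x y + C) \<and>
        (\<forall>z. \<exists>x. e z (f x) \<le> C))"

definition quasi_line :: "('a \<Rightarrow> 'a \<Rightarrow> real) \<Rightarrow> bool" where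
  "quasi_line d \<longleftrightarrow> (\<exists>f :: 'a \<Rightarrow> real. quasi_isometry d dist f)"

end

theory Submission
  imports Defs
begin

text \<open>
  All of the geometry is extracted from the CN inequality. An element of the coarse kernel has a
  finite conjugacy class, so centralizers of finite subsets of the kernel act cocompactly, and
  finitely many commuting elements of the kernel have a common point of minimal displacement. Hence
  translation length is homogeneous and satisfies the parallelogram inequality on commuting pairs,
  and only finitely many elements of the kernel have bounded translation length. Choose successively
  commuting elements \<open>a\<^sub>0, a\<^sub>1, \<dots>\<close> of minimal translation length, none having a power in the subgroup
  generated by its predecessors. Minimality forces angles of at least 60 degrees between their axes,
  so a packing argument stops the process; then the \<open>a\<^sub>i\<close> generate a free abelian subgroup of finite
  index.

  Let \<open>a\<close> be an element of infinite order in the kernel. If the space lies in a neighbourhood of an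
  axis of \<open>a\<close>, the curtains dual to the axis are bounded and show that the curtain model is a
  quasi-line. Otherwise every axis has parallel axes at any prescribed distance. Given an \<open>L\<close>-chain
  separating \<open>x\<close> from \<open>y\<close>, compare \<open>x\<close>, \<open>y\<close> with their translates by large powers of \<open>a\<close> and
  \<open>a\<^sup>-\<^sup>1\<close>: if too many curtains fall into one combinatorial type, two of them are crossed by more than \<open>L\<close>
  curtains dual to an axis or to a segment joining parallel axes. So \<open>L\<close>-chains have length linear in
  \<open>L\<close>, and the curtain model is bounded.
\<close>

subsection \<open>Comparison triangles\<close>

text \<open>No Euclidean factor of the space is split off: translation length takes over the role of
  a norm. The obstacle is that several infima must be attained at one point. Commuting elements
  preserve each other's minimal sets; halving displacements at midpoints shows that restriction to
  such a set does not raise an infimum; a cocompact centralizer turns the infimum into a minimum.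
  The 60 degrees come from replacing \<open>a j\<close> by \<open>inv (a i) \<otimes> a j\<close>:
  it is still admissible, hence no shorter, and the parallelogram inequality then bounds
  \<open>a i \<otimes> a j\<close> from above. For curtains one mechanism recurs: two curtains that
  both run over a range of length \<open>2 * L + 4\<close> along a segment are both crossed by
  \<open>L + 1\<close> curtains dual to that segment. Growth linear in \<open>L\<close> gives
  boundedness because the sum of \<open>L * lam L\<close> converges. In the opposite case the
  curtains dual to an axis have uniformly bounded diameter, so they are \<open>L\<close>-separated
  for one fixed \<open>L\<close>, and that single summand of the model already grows linearly along
  the axis.\<close>

lemma Euclidean_triangle_exists:
  fixes a b c :: real
  assumes "a \<ge> 0" "c \<ge> 0" "a \<le> b + c" "b \<le> a + c" "c \<le> a + b"
  shows "\<exists>x y z :: real^2. dist x y = a \<and> dist y z = b \<and> dist z x = c"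
proof (cases "a = 0")
  case True
  then have "dist (0::real^2) 0 = a \<and> dist 0 (vector [c,0] :: real^2) = b \<and> dist (vector [c,0] :: real^2) 0 = c"
    using assms by (simp add: dist_norm norm_eq_sqrt_inner inner_vec_def sum_2)
  then show ?thesis by blast
next
  case False
  then have a: "a > 0" using assms by simp
  \<comment> \<open>With \<open>x\<close> at the origin and \<open>y\<close> on the first axis, the
    law of cosines forces this first coordinate of \<open>z\<close>; the triangle inequalities bound
    its modulus by \<open>c\<close>, which makes \<open>v\<close> real.\<close>
  define u where "u = (c\<^sup>2 + a\<^sup>2 - b\<^sup>2) / (2*a)"
  define v where "v = sqrt (c\<^sup>2 - u\<^sup>2)"
  have "2*a*u = c\<^sup>2 + a\<^sup>2 - b\<^sup>2" using a by (simp add: u_def)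
  have "\<bar>a - c\<bar> \<le> b" using assms by auto
  then have "(a - c)\<^sup>2 \<le> b\<^sup>2" using abs_le_square_iff[of "a-c" b] assms by auto
  then have "u \<le> c" using a unfolding u_def by (simp add: field_simps power2_eq_square)
  moreover have "b\<^sup>2 \<le> (a + c)\<^sup>2" using assms by (intro power_mono) auto
  then have "- c \<le> u" using a unfolding u_def by (simp add: field_simps power2_eq_square)
  ultimately have "u\<^sup>2 \<le> c\<^sup>2" using abs_le_square_iff[of u c] assms by auto
  then have v: "v\<^sup>2 = c\<^sup>2 - u\<^sup>2" by (simp add: v_def)
  let ?x = "0 :: real^2" and ?y = "vector [a,0] :: real^2" and ?z = "vector [u,v] :: real^2"
  have "dist ?x ?y = a" using a by (simp add: dist_norm norm_eq_sqrt_inner inner_vec_def sum_2)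
  moreover have "(a - u)\<^sup>2 + v\<^sup>2 = b\<^sup>2"
    using v \<open>2*a*u = _\<close> by (simp add: power2_eq_square algebra_simps)
  then have "dist ?y ?z = b"
    using assms by (simp add: dist_norm norm_eq_sqrt_inner inner_vec_def sum_2 flip: power2_eq_square)
  moreover have "u\<^sup>2 + v\<^sup>2 = c\<^sup>2" using v by simp
  then have "dist ?z ?x = c"
    using assms by (simp add: dist_norm norm_eq_sqrt_inner inner_vec_def sum_2 flip: power2_eq_square)
  ultimately show ?thesis by blast
qed

lemma Stewart:
  fixes p q z :: "'b::real_inner"
  shows "(dist z ((1-t) *\<^sub>R p + t *\<^sub>R q))\<^sup>2 = (1-t) * (dist z p)\<^sup>2 + t * (dist z q)\<^sup>2 - t * (1-t) * (dist p q)\<^sup>2"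
proof -
  define u w where "u = z - p" and "w = z - q"
  have "z - ((1-t) *\<^sub>R p + t *\<^sub>R q) = (1-t) *\<^sub>R u + t *\<^sub>R w" "p - q = w - u"
    by (auto simp: u_def w_def algebra_simps)
  then have "(dist z ((1-t) *\<^sub>R p + t *\<^sub>R q))\<^sup>2 = ((1-t) *\<^sub>R u + t *\<^sub>R w) \<bullet> ((1-t) *\<^sub>R u + t *\<^sub>R w)"
    "(dist z p)\<^sup>2 = u \<bullet> u" "(dist z q)\<^sup>2 = w \<bullet> w" "(dist p q)\<^sup>2 = (w - u) \<bullet> (w - u)"
    by (simp_all add: dist_norm power2_norm_eq_inner u_def w_def)
  then show ?thesis
    by (simp add: inner_add_left inner_add_right inner_diff_left inner_diff_right inner_commute)
      (simp add: algebra_simps)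
qed

lemma geodesic_Icc:
  "a \<le> b \<Longrightarrow> geodesic {a..b} \<alpha> \<longleftrightarrow> (\<forall>s\<in>{a..b}. \<forall>t\<in>{a..b}. dist (\<alpha> s) (\<alpha> t) = \<bar>s - t\<bar>)"
  unfolding geodesic_def by (auto simp: is_interval_cc)

locale CAT0 =
  fixes X :: "'a::metric_space itself"
  assumes CAT0: "CAT0_space X"
begin

lemma geodesic_exists: "\<exists>\<alpha>. geodesic_from_to (x::'a) y \<alpha>"
  using CAT0 unfolding CAT0_space_def by blast

text \<open>The comparison condition is used for one vertex and one point of the opposite side; in
  the Euclidean triangle \<open>Stewart\<close> gives the same distance exactly.\<close>

lemma CN_geodesic:
  assumes g: "geodesic_from_to (p::'a) q \<gamma>" and t: "0 \<le> t" "t \<le> 1"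
  shows "(dist z (\<gamma> (t * dist p q)))\<^sup>2 \<le> (1-t) * (dist z p)\<^sup>2 + t * (dist z q)\<^sup>2 - t * (1-t) * (dist p q)\<^sup>2"
proof -
  obtain \<beta> \<delta> where b: "geodesic_from_to q z \<beta>" and d: "geodesic_from_to z p \<delta>"
    using geodesic_exists by blast
  have "\<exists>p' q' z' :: real^2. dist p' q' = dist p q \<and> dist q' z' = dist q z \<and> dist z' p' = dist z p"
    by (rule Euclidean_triangle_exists) (use dist_triangle[of p q z] dist_triangle[of q z p] dist_triangle[of p z q] in
        \<open>auto simp: dist_commute\<close>)
  then obtain p' q' z' :: "real^2" where e: "dist p' q' = dist p q" "dist q' z' = dist q z" "dist z' p' = dist z p"
    by blast
  define m' where "m' = (1-t) *\<^sub>R p' + t *\<^sub>R q'"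
  have m: "m' \<in> closed_segment p' q'" unfolding m'_def closed_segment_def using t by auto
  have "p' - m' = t *\<^sub>R (p' - q')" by (simp add: m'_def algebra_simps)
  then have dm: "dist p' m' = t * dist p q" using t e by (simp add: dist_norm)
  have M: "(\<gamma> (t * dist p q), m') \<in> comparison_pairs p q \<gamma> p' q'"
    unfolding comparison_pairs_def using m dm t by (auto simp: mult_left_le_one_le)
  \<comment> \<open>The vertex \<open>z\<close> enters the comparison as the far end of the side
    that leaves \<open>q\<close>.\<close>
  have "(\<beta> (dist q z), z') \<in> comparison_pairs q z \<beta> q' z'"
    unfolding comparison_pairs_def using e by auto
  then have Z: "(z, z') \<in> comparison_pairs q z \<beta> q' z'"
    using b by (simp add: geodesic_from_to_def)
  have *: "let P = comparison_pairs p q \<gamma> p' q' \<union> comparison_pairs q z \<beta> q' z' \<union> comparison_pairs z p \<delta> z' p'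
         in \<forall>(p, p')\<in>P. \<forall>(q, q')\<in>P. dist p q \<le> dist p' q'"
    using CAT0[unfolded CAT0_space_def, THEN conjunct2, rule_format] g b d e by blast
  have "dist z (\<gamma> (t * dist p q)) \<le> dist z' m'"
    using * M Z unfolding Let_def by fastforce
  then have "(dist z (\<gamma> (t * dist p q)))\<^sup>2 \<le> (dist z' m')\<^sup>2" by (intro power_mono) auto
  also have "\<dots> = (1-t) * (dist z p)\<^sup>2 + t * (dist z q)\<^sup>2 - t * (1-t) * (dist p q)\<^sup>2"
    unfolding m'_def Stewart using e by (simp add: dist_commute)
  finally show ?thesis .
qed

text \<open>The parameter is a proportion of the length. The geodesic is an arbitrary choice; by
  \<open>gpt_unique\<close> the point does not depend on it.\<close>

definition gpt :: "'a \<Rightarrow> 'a \<Rightarrow> real \<Rightarrow> 'a" where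
  "gpt p q t = (SOME \<gamma>. geodesic_from_to p q \<gamma>) (t * dist p q)"

lemma some_geodesic: "geodesic_from_to (p::'a) q (SOME \<gamma>. geodesic_from_to p q \<gamma>)"
  using someI_ex[OF geodesic_exists] .

lemma CN:
  assumes "0 \<le> t" "t \<le> 1"
  shows "(dist z (gpt p q t))\<^sup>2 \<le> (1-t) * (dist z p)\<^sup>2 + t * (dist z q)\<^sup>2 - t * (1-t) * (dist p q)\<^sup>2"
  unfolding gpt_def by (rule CN_geodesic[OF some_geodesic assms])

lemma dist_gpt_gpt:
  assumes "0 \<le> s" "s \<le> 1" "0 \<le> t" "t \<le> 1"
  shows "dist (gpt p q s) (gpt p q t) = \<bar>s - t\<bar> * dist p q"
proof -
  have "s * dist p q \<in> {0..dist p q}" "t * dist p q \<in> {0..dist p q}"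
    using assms by (auto simp: mult_left_le_one_le)
  then have "dist (gpt p q s) (gpt p q t) = \<bar>s * dist p q - t * dist p q\<bar>"
    using some_geodesic[of p q] unfolding gpt_def geodesic_from_to_def geodesic_def by blast
  also have "\<dots> = \<bar>s - t\<bar> * dist p q" by (simp add: abs_mult flip: left_diff_distrib)
  finally show ?thesis .
qed

lemma gpt_0 [simp]: "gpt p q 0 = p" and gpt_1 [simp]: "gpt p q 1 = q"
  using some_geodesic[of p q] by (auto simp: gpt_def geodesic_from_to_def)

lemma dist_gpt_left: "0 \<le> t \<Longrightarrow> t \<le> 1 \<Longrightarrow> dist p (gpt p q t) = t * dist p q"
  using dist_gpt_gpt[of 0 t p q] by simp

lemma dist_gpt_right: "0 \<le> t \<Longrightarrow> t \<le> 1 \<Longrightarrow> dist (gpt p q t) q = (1 - t) * dist p q"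
  using dist_gpt_gpt[of t 1 p q] by simp

text \<open>For a point at these two distances the right side of \<open>CN\<close> is zero.
  Uniqueness of geodesics and compatibility with isometries follow from this.\<close>

lemma gpt_unique:
  assumes "0 \<le> t" "t \<le> 1" "dist p w = t * dist p q" "dist w q = (1-t) * dist p q"
  shows "w = gpt p q t"
proof -
  have "(dist w (gpt p q t))\<^sup>2 \<le> (1-t) * (t * dist p q)\<^sup>2 + t * ((1-t) * dist p q)\<^sup>2 - t * (1-t) * (dist p q)\<^sup>2"
    using CN[OF assms(1,2), of w p q] assms(3,4) by (simp add: dist_commute)
  also have "\<dots> = 0" by (simp add: power2_eq_square algebra_simps)
  finally show ?thesis by simp
qed

lemma gpt_commute: "0 \<le> t \<Longrightarrow> t \<le> 1 \<Longrightarrow> gpt q p (1 - t) = gpt p q t"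
  using dist_gpt_left[of "1-t" q p] dist_gpt_right[of "1-t" q p]
  by (intro gpt_unique) (auto simp: dist_commute)

lemma gpt_on_geodesic:
  assumes "geodesic I \<alpha>" "s \<in> I" "u \<in> I" "0 \<le> t" "t \<le> 1"
  shows "\<alpha> ((1-t) * s + t * u) = gpt (\<alpha> s :: 'a) (\<alpha> u) t"
proof -
  have "(1-t) * s + t * u \<in> I"
    using assms convexD[of I s u "1-t" t] by (auto simp: geodesic_def is_interval_convex)
  then have d: "dist (\<alpha> s) (\<alpha> ((1-t) * s + t * u)) = \<bar>s - ((1-t) * s + t * u)\<bar>"
     "dist (\<alpha> ((1-t) * s + t * u)) (\<alpha> u) = \<bar>((1-t) * s + t * u) - u\<bar>" "dist (\<alpha> s) (\<alpha> u) = \<bar>s - u\<bar>"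
    using assms unfolding geodesic_def by blast+
  have "s - ((1-t) * s + t * u) = t * (s - u)" "((1-t) * s + t * u) - u = (1-t) * (s-u)"
    by (simp_all add: algebra_simps)
  then show ?thesis using assms d by (intro gpt_unique) (simp_all add: abs_mult)
qed

text \<open>\<open>CN\<close> along both sides that leave \<open>x\<close>; the resulting bound
  collapses to a perfect square.\<close>

lemma dist_gpt_gpt_le:
  assumes t: "0 \<le> t" "t \<le> 1"
  shows "dist (gpt x y t) (gpt x z t) \<le> t * dist y z"
proof -
  have 1: "(dist z (gpt x y t))\<^sup>2 \<le> (1-t) * (dist x z)\<^sup>2 + t * (dist y z)\<^sup>2 - t * (1-t) * (dist x y)\<^sup>2"
    using CN[OF t, of z x y] by (simp add: dist_commute)
  have "(dist (gpt x y t) (gpt x z t))\<^sup>2 \<le> (1-t) * (dist (gpt x y t) x)\<^sup>2 + t * (dist (gpt x y t) z)\<^sup>2 - t * (1-t) * (dist x z)\<^sup>2"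
    by (rule CN[OF t])
  also have "\<dots> \<le> (1-t) * (t * dist x y)\<^sup>2 + t * ((1-t) * (dist x z)\<^sup>2 + t * (dist y z)\<^sup>2 - t * (1-t) * (dist x y)\<^sup>2) - t * (1-t) * (dist x z)\<^sup>2"
    using mult_left_mono[OF 1 t(1)] dist_gpt_left[OF t, of x y] by (simp add: dist_commute)
  also have "\<dots> = (t * dist y z)\<^sup>2" by (simp add: power2_eq_square algebra_simps)
  finally show ?thesis using t by (simp add: power2_le_iff_abs_le)
qed

lemma dist_gpt_convex:
  assumes t: "0 \<le> t" "t \<le> 1"
  shows "dist (gpt x y t) (gpt x' y' t) \<le> (1-t) * dist x x' + t * dist y y'"
proof -
  have "dist (gpt x y t) (gpt x y' t) \<le> t * dist y y'" by (rule dist_gpt_gpt_le[OF t])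
  moreover have "dist (gpt y' x (1-t)) (gpt y' x' (1-t)) \<le> (1-t) * dist x x'"
    by (rule dist_gpt_gpt_le) (use t in auto)
  then have "dist (gpt x y' t) (gpt x' y' t) \<le> (1-t) * dist x x'"
    using t by (simp add: gpt_commute)
  ultimately show ?thesis using dist_triangle[of "gpt x y t" "gpt x' y' t" "gpt x y' t"] by linarith
qed

text \<open>Two opposite vertices are compared with the midpoint of the other diagonal. Projections,
  translation lengths and parallel axes are all controlled through this four-point
  inequality.\<close>

lemma quadrilateral:
  "(dist p r)\<^sup>2 + (dist q s)\<^sup>2 \<le> (dist p q)\<^sup>2 + (dist q r)\<^sup>2 + (dist r s)\<^sup>2 + (dist s (p::'a))\<^sup>2"
proof -
  define m where "m = gpt p r (1/2)"
  have 1: "(dist q m)\<^sup>2 \<le> (1/2) * (dist p q)\<^sup>2 + (1/2) * (dist q r)\<^sup>2 - (1/4) * (dist p r)\<^sup>2"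
    using CN[of "1/2" q p r] by (simp add: m_def dist_commute)
  have 2: "(dist s m)\<^sup>2 \<le> (1/2) * (dist s p)\<^sup>2 + (1/2) * (dist r s)\<^sup>2 - (1/4) * (dist p r)\<^sup>2"
    using CN[of "1/2" s p r] by (simp add: m_def dist_commute)
  have "(dist q s)\<^sup>2 \<le> (dist q m + dist s m)\<^sup>2"
    using dist_triangle2[of q s m] by (intro power_mono) auto
  also have "\<dots> \<le> 2 * (dist q m)\<^sup>2 + 2 * (dist s m)\<^sup>2"
    using sum_squares_bound[of "dist q m" "dist s m"] by (simp add: power2_sum)
  finally show ?thesis using 1 2 by linarith
qed

lemma gpt_isometry:
  assumes "\<And>x y. dist (f x) (f y) = dist x y" "0 \<le> t" "t \<le> 1"
  shows "f (gpt p q t) = gpt (f p) (f q) t"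
  by (rule gpt_unique) (use assms in \<open>auto simp: dist_gpt_left dist_gpt_right\<close>)

text \<open>Arc length instead of proportion, since curtains have unit width. For
  \<open>p = q\<close> the quotient is 0 and the value is \<open>p\<close>.\<close>

definition gseg :: "'a \<Rightarrow> 'a \<Rightarrow> real \<Rightarrow> 'a" where
  "gseg p q s = gpt p q (s / dist p q)"

lemma gseg_0 [simp]: "gseg p q 0 = p"
  by (simp add: gseg_def)

lemma gseg_end [simp]: "gseg p q (dist p q) = q"
  by (cases "p = q") (use gpt_0[of q q] in \<open>auto simp: gseg_def simp del: gpt_0\<close>)

lemma dist_gseg:
  assumes "s \<in> {0..dist p q}" "t \<in> {0..dist p q}"
  shows "dist (gseg p q s) (gseg p q t) = \<bar>s - t\<bar>"
proof (cases "p = q")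
  case False
  then have "dist (gseg p q s) (gseg p q t) = \<bar>s / dist p q - t / dist p q\<bar> * dist p q"
    unfolding gseg_def using assms by (intro dist_gpt_gpt) auto
  also have "\<dots> = \<bar>(s / dist p q - t / dist p q) * dist p q\<bar>" by (simp add: abs_mult)
  also have "(s / dist p q - t / dist p q) * dist p q = s - t"
    using False by (simp add: diff_divide_distrib[symmetric])
  finally show ?thesis .
qed (use assms in auto)

lemma geodesic_gseg: "geodesic {0..dist p q} (gseg p q)"
  by (simp add: geodesic_Icc dist_gseg)

lemma gseg_unique:
  assumes "dist p w + dist w q = dist p q"
  shows "gseg p q (dist p w) = w"
proof (cases "p = q")
  case False
  have "dist p w \<le> dist p q" using assms by (metis zero_le_dist le_add_same_cancel1)
  then show ?thesis using assms False
    unfolding gseg_def by (intro gpt_unique[symmetric]) (auto simp: field_simps simp flip: distrib_left)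
next
  case True
  then have "dist p w = 0" using assms by (smt (verit) dist_self zero_le_dist)
  then show ?thesis by simp
qed

lemma continuous_gseg: "continuous_on {0..dist p q} (gseg p q)"
  by (rule continuous_onI) (auto simp: dist_gseg dist_real_def intro!: exI)

end

text \<open>Taking the last point of the closed sublevel set, rather than any crossing, keeps
  \<open>f\<close> above the level from there on.\<close>

lemma last_crossing:
  fixes f :: "real \<Rightarrow> real"
  assumes f: "continuous_on {a..b} f" and ab: "a \<le> b" and c: "f a \<le> c" "c \<le> f b"
  obtains s where "s \<in> {a..b}" "f s = c" "\<And>u. u \<in> {s..b} \<Longrightarrow> c \<le> f u"
proof -
  let ?S = "{u\<in>{a..b}. f u \<le> c}"
  have "closed ?S" using continuous_on_closed_Collect_le[OF f continuous_on_const] by simp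
  moreover have "bounded ?S" by (rule bounded_subset[of "{a..b}"]) auto
  ultimately have "compact ?S" by (simp add: compact_eq_bounded_closed)
  moreover have "?S \<noteq> {}" using ab c by auto
  ultimately obtain s where s: "s \<in> ?S" "\<And>u. u \<in> ?S \<Longrightarrow> u \<le> s"
    using compact_attains_sup by meson
  have after: "c \<le> f u" if "u \<in> {s..b}" "u \<noteq> s" for u
    using s(2)[of u] that s(1) by force
  have "continuous_on {s..b} f" using f s(1) by (auto intro: continuous_on_subset)
  then obtain u where "u \<in> {s..b}" "f u = c"
    using IVT'[of f s c b] s(1) c by auto
  then have "u = s" using s(2)[of u] s(1) by auto
  then have "f s = c" using \<open>f u = c\<close> by simp
  with after have "c \<le> f v" if "v \<in> {s..b}" for v using that by (cases "v = s") auto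
  with that[of s] s(1) \<open>f s = c\<close> show thesis by blast
qed

context CAT0
begin

subsection \<open>Projection onto a geodesic\<close>

text \<open>Recording the parameter of the nearest point instead of the point itself turns curtains
  and halfspaces into conditions on one real function, which is 1-Lipschitz.\<close>

definition gcoord :: "real set \<Rightarrow> (real \<Rightarrow> 'a) \<Rightarrow> 'a \<Rightarrow> real" where
  "gcoord I \<alpha> x = (SOME t. t \<in> I \<and> (\<forall>s\<in>I. dist x (\<alpha> t) \<le> dist x (\<alpha> s)))"

lemma continuous_geodesic:
  assumes "geodesic I (\<alpha> :: real \<Rightarrow> 'a)" shows "continuous_on I \<alpha>"
  by (rule continuous_onI) (use assms in \<open>auto simp: geodesic_def dist_real_def\<close>)

lemma nearest_parameter_exists:
  assumes g: "geodesic I \<alpha>"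
  shows "\<exists>t. t \<in> I \<and> (\<forall>s\<in>I. dist (x::'a) (\<alpha> t) \<le> dist x (\<alpha> s))"
proof -
  obtain t0 where t0: "t0 \<in> I" using g by (auto simp: geodesic_def)
  \<comment> \<open>A parameter outside this ball cannot beat \<open>t0\<close>, so a possibly
    unbounded \<open>I\<close> is reduced to a compact set.\<close>
  define K where "K = I \<inter> cball t0 (2 * dist x (\<alpha> t0))"
  have "compact K" unfolding K_def using g
    by (intro closed_Int_compact) (auto simp: geodesic_def)
  moreover have "t0 \<in> K" by (auto simp: K_def t0)
  moreover have "continuous_on K (\<lambda>t. dist x (\<alpha> t))"
    unfolding K_def by (intro continuous_intros continuous_on_subset[OF continuous_geodesic[OF g]]) auto
  ultimately obtain t where t: "t \<in> K" "\<forall>s\<in>K. dist x (\<alpha> t) \<le> dist x (\<alpha> s)"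
    using continuous_attains_inf[of K] by (metis empty_iff)
  have "dist x (\<alpha> t) \<le> dist x (\<alpha> s)" if s: "s \<in> I" for s
  proof (cases "s \<in> K")
    case False
    then have "2 * dist x (\<alpha> t0) < \<bar>t0 - s\<bar>" using s by (auto simp: K_def dist_real_def)
    also have "\<dots> = dist (\<alpha> t0) (\<alpha> s)" using g s t0 by (simp add: geodesic_def)
    also have "\<dots> \<le> dist x (\<alpha> t0) + dist x (\<alpha> s)" by (rule dist_triangle3)
    finally have "dist x (\<alpha> t0) \<le> dist x (\<alpha> s)" by simp
    with t \<open>t0 \<in> K\<close> show ?thesis by force
  qed (use t in auto)
  then show ?thesis using t by (auto simp: K_def)
qed

lemma gcoord:
  assumes "geodesic I \<alpha>"
  shows gcoord_mem: "gcoord I \<alpha> x \<in> I"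
    and gcoord_le: "s \<in> I \<Longrightarrow> dist x (\<alpha> (gcoord I \<alpha> x)) \<le> dist x (\<alpha> s)"
  using someI_ex[OF nearest_parameter_exists[OF assms, of x]] by (auto simp: gcoord_def)

text \<open>The angle at the foot is at least a right angle. Minimality of the foot is tested
  against a point slightly towards \<open>\<alpha> s\<close>; \<open>CN\<close> divided by
  \<open>1 - z\<close> gives the claim as \<open>z\<close> tends to 1.\<close>

lemma gcoord_obtuse:
  assumes g: "geodesic I \<alpha>" and s: "s \<in> I"
  shows "(dist x (\<alpha> (gcoord I \<alpha> x)))\<^sup>2 + (s - gcoord I \<alpha> x)\<^sup>2 \<le> (dist x (\<alpha> s))\<^sup>2"
proof -
  let ?c = "gcoord I \<alpha> x"
  have c: "?c \<in> I" by (rule gcoord_mem[OF g])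
  have "z * (s - ?c)\<^sup>2 \<le> (dist x (\<alpha> s))\<^sup>2 - (dist x (\<alpha> ?c))\<^sup>2" if z: "0 < z" "z < 1" for z
  proof -
    let ?m = "(1-(1-z)) * ?c + (1-z) * s"
    have "?m \<in> I" using g c s z convexD[of I ?c s z "1-z"] by (auto simp: geodesic_def is_interval_convex)
    then have "(dist x (\<alpha> ?c))\<^sup>2 \<le> (dist x (\<alpha> ?m))\<^sup>2"
      using gcoord_le[OF g] by (intro power_mono) auto
    also have "\<alpha> ?m = gpt (\<alpha> ?c) (\<alpha> s) (1-z)"
      by (rule gpt_on_geodesic[OF g c s]) (use z in auto)
    also have "(dist x (gpt (\<alpha> ?c) (\<alpha> s) (1-z)))\<^sup>2 \<le>
        (1-(1-z)) * (dist x (\<alpha> ?c))\<^sup>2 + (1-z) * (dist x (\<alpha> s))\<^sup>2 - (1-z) * (1-(1-z)) * (dist (\<alpha> ?c) (\<alpha> s))\<^sup>2"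
      by (rule CN) (use z in auto)
    also have "dist (\<alpha> ?c) (\<alpha> s) = \<bar>?c - s\<bar>" using g c s by (simp add: geodesic_def)
    finally have "(1-z) * (dist x (\<alpha> ?c))\<^sup>2 \<le> (1-z) * ((dist x (\<alpha> s))\<^sup>2 - z * (s - ?c)\<^sup>2)"
      by (simp add: power2_commute algebra_simps)
    then show ?thesis using z by simp
  qed
  then have "(s - ?c)\<^sup>2 \<le> (dist x (\<alpha> s))\<^sup>2 - (dist x (\<alpha> ?c))\<^sup>2"
    by (rule field_le_mult_one_interval)
  then show ?thesis by simp
qed

lemma gcoord_unique:
  assumes g: "geodesic I \<alpha>" and t: "t \<in> I" "\<And>s. s \<in> I \<Longrightarrow> dist x (\<alpha> t) \<le> dist x (\<alpha> s)"
  shows "gcoord I \<alpha> x = t"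
proof -
  have "(dist x (\<alpha> t))\<^sup>2 \<le> (dist x (\<alpha> (gcoord I \<alpha> x)))\<^sup>2"
    using t gcoord_mem[OF g] by (intro power_mono) auto
  then have "(t - gcoord I \<alpha> x)\<^sup>2 \<le> 0" using gcoord_obtuse[OF g t(1), of x] by linarith
  then show ?thesis by simp
qed

lemma inj_on_geodesic: "geodesic I (\<alpha> :: real \<Rightarrow> 'a) \<Longrightarrow> inj_on \<alpha> I"
  by (rule inj_onI) (force simp: geodesic_def)

lemma gcoord_geodesic [simp]:
  assumes "geodesic I \<alpha>" "t \<in> I" shows "gcoord I \<alpha> (\<alpha> t) = t"
  using assms by (intro gcoord_unique) auto

lemma geodesic_proj_eq:
  assumes g: "geodesic I \<alpha>"
  shows "geodesic_proj I \<alpha> x = \<alpha> (gcoord I \<alpha> x)"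
  unfolding geodesic_proj_def
proof (rule the_equality)
  show "\<alpha> (gcoord I \<alpha> x) \<in> \<alpha> ` I \<and> (\<forall>q\<in>\<alpha> ` I. dist x (\<alpha> (gcoord I \<alpha> x)) \<le> dist x q)"
    using gcoord[OF g] by auto
  fix p assume "p \<in> \<alpha> ` I \<and> (\<forall>q\<in>\<alpha> ` I. dist x p \<le> dist x q)"
  then obtain t where "p = \<alpha> t" "t \<in> I" "\<And>s. s \<in> I \<Longrightarrow> dist x (\<alpha> t) \<le> dist x (\<alpha> s)" by auto
  then show "p = \<alpha> (gcoord I \<alpha> x)" using gcoord_unique[OF g] by metis
qed

text \<open>In the quadrilateral of two points and their feet, the obtuse angles bound both
  diagonals from below, while \<open>quadrilateral\<close> bounds them from above.\<close>

lemma gcoord_Lipschitz: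
  assumes g: "geodesic I \<alpha>"
  shows "\<bar>gcoord I \<alpha> x - gcoord I \<alpha> y\<bar> \<le> dist x y"
proof -
  let ?s = "gcoord I \<alpha> x" and ?u = "gcoord I \<alpha> y"
  note m = gcoord_mem[OF g, of x] gcoord_mem[OF g, of y]
  have "dist (\<alpha> ?s) (\<alpha> ?u) = \<bar>?s - ?u\<bar>" using g m by (simp add: geodesic_def)
  then have "(?s - ?u)\<^sup>2 \<le> (dist x y)\<^sup>2"
    using quadrilateral[of x "\<alpha> ?u" "\<alpha> ?s" y] gcoord_obtuse[OF g m(2), of x] gcoord_obtuse[OF g m(1), of y]
    by (simp add: power2_commute dist_commute)
  then show ?thesis using abs_le_square_iff[of "?s - ?u" "dist x y"] by simp
qed

lemma continuous_gcoord:
  assumes g: "geodesic I \<alpha>"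
  shows "continuous_on S (gcoord I \<alpha>)"
  by (rule lipschitz_on_continuous_on[of 1], rule lipschitz_onI)
    (use gcoord_Lipschitz[OF g] in \<open>auto simp: dist_real_def\<close>)

lemma gcoord_fibre:
  assumes g: "geodesic I \<alpha>" and t: "0 \<le> t" "t \<le> 1"
  shows "gcoord I \<alpha> (gpt x (\<alpha> (gcoord I \<alpha> x)) t) = gcoord I \<alpha> x"
proof (rule gcoord_unique[OF g gcoord_mem[OF g]])
  fix s assume s: "s \<in> I"
  let ?p = "\<alpha> (gcoord I \<alpha> x)"
  let ?w = "gpt x ?p t"
  have "dist x ?w + dist ?w ?p = dist x ?p" using t by (simp add: dist_gpt_left dist_gpt_right algebra_simps)
  also have "\<dots> \<le> dist x (\<alpha> s)" by (rule gcoord_le[OF g s])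
  also have "\<dots> \<le> dist x ?w + dist ?w (\<alpha> s)" by (rule dist_triangle)
  finally show "dist ?w ?p \<le> dist ?w (\<alpha> s)" by simp
qed

lemma continuous_gpt: "continuous_on {0..1} (gpt p q)"
  by (rule lipschitz_on_continuous_on[of "dist p q"], rule lipschitz_onI)
    (auto simp: dist_gpt_gpt dist_real_def mult.commute)
text \<open>Each point is joined to its foot inside its own fibre, and the feet lie on the connected
  arc over \<open>S\<close>.\<close>

lemma connected_gcoord_vimage:
  assumes g: "geodesic I \<alpha>" and S: "S \<subseteq> I" "is_interval S"
  shows "connected {x. gcoord I \<alpha> x \<in> S}"
proof -
  let ?F = "{x. gcoord I \<alpha> x \<in> S}"
  have base: "\<alpha> ` S \<subseteq> ?F" using S g by auto
  have cb: "connected (\<alpha> ` S)"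
    using S continuous_on_subset[OF continuous_geodesic[OF g]]
    by (intro connected_continuous_image) (auto simp: is_interval_connected)
  define leg where "leg x = gpt x (\<alpha> (gcoord I \<alpha> x)) ` {0..1}" for x
  have leg: "connected (leg x)" "x \<in> leg x" "\<alpha> (gcoord I \<alpha> x) \<in> leg x" for x
  proof -
    have "gpt x (\<alpha> (gcoord I \<alpha> x)) 0 \<in> leg x" "gpt x (\<alpha> (gcoord I \<alpha> x)) 1 \<in> leg x"
      unfolding leg_def by (auto intro!: imageI simp del: gpt_0 gpt_1)
    then show "x \<in> leg x" "\<alpha> (gcoord I \<alpha> x) \<in> leg x" by auto
    show "connected (leg x)" unfolding leg_def
      by (intro connected_continuous_image continuous_gpt) auto
  qed
  have sub: "leg x \<subseteq> ?F" if "x \<in> ?F" for x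
    using that gcoord_fibre[OF g, of _ x] by (auto simp: leg_def)
  show ?thesis
  proof (subst connected_iff_connected_component, unfold connected_component_def, intro ballI)
    fix x y assume x: "x \<in> ?F" and y: "y \<in> ?F"
    have "leg z \<inter> \<alpha> ` S \<noteq> {}" if "z \<in> ?F" for z
      using leg(3)[of z] that by blast
    then have "leg x \<inter> \<alpha> ` S \<noteq> {}" "(leg x \<union> \<alpha> ` S) \<inter> leg y \<noteq> {}" using x y by blast+
    then have "connected ((leg x \<union> \<alpha> ` S) \<union> leg y)"
      by (intro connected_Un leg(1) cb)
    moreover have "(leg x \<union> \<alpha> ` S) \<union> leg y \<subseteq> ?F" using sub[OF x] sub[OF y] base by blast
    moreover have "x \<in> (leg x \<union> \<alpha> ` S) \<union> leg y" "y \<in> (leg x \<union> \<alpha> ` S) \<union> leg y" using leg(2) by blast+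
    ultimately show "\<exists>T. connected T \<and> T \<subseteq> ?F \<and> x \<in> T \<and> y \<in> T" by blast
  qed
qed

subsection \<open>Curtains\<close>

lemma curtain_datum_mem:
  assumes "curtain_datum I \<alpha> r" "\<bar>s - r\<bar> \<le> 1/2" shows "s \<in> I"
proof -
  have "s \<in> {r - 1/2..r + 1/2}" using abs_le_D1[OF assms(2)] abs_le_D2[OF assms(2)] by simp
  then show ?thesis using assms(1) interior_subset[of I] unfolding curtain_datum_def by blast
qed

lemma gcoord_proj_mem:
  assumes g: "geodesic I \<alpha>" and "S \<subseteq> I"
  shows "geodesic_proj I \<alpha> x \<in> \<alpha> ` S \<longleftrightarrow> gcoord I \<alpha> x \<in> S"
  using inj_on_image_mem_iff[OF inj_on_geodesic[OF g] gcoord_mem[OF g] assms(2)]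
  by (simp add: geodesic_proj_eq[OF g])

lemma
  assumes d: "curtain_datum I (\<alpha> :: real \<Rightarrow> 'a) r"
  shows dual_curtain_eq: "dual_curtain I \<alpha> r = {x. gcoord I \<alpha> x \<in> {r - 1/2..r + 1/2}}"
    and neg_halfspace_eq: "neg_halfspace I \<alpha> r = {x. gcoord I \<alpha> x < r - 1/2}"
    and pos_halfspace_eq: "pos_halfspace I \<alpha> r = {x. gcoord I \<alpha> x > r + 1/2}"
proof -
  have g: "geodesic I \<alpha>" and s: "{r - 1/2..r + 1/2} \<subseteq> I"
    using d interior_subset[of I] by (auto simp: curtain_datum_def)
  show "dual_curtain I \<alpha> r = {x. gcoord I \<alpha> x \<in> {r - 1/2..r + 1/2}}"
    unfolding dual_curtain_def vimage_def using gcoord_proj_mem[OF g s] by simp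
  show "neg_halfspace I \<alpha> r = {x. gcoord I \<alpha> x < r - 1/2}"
    unfolding neg_halfspace_def vimage_def
    using gcoord_proj_mem[OF g, of "I \<inter> {..<r-1/2}"] gcoord_mem[OF g] by auto
  show "pos_halfspace I \<alpha> r = {x. gcoord I \<alpha> x > r + 1/2}"
    unfolding pos_halfspace_def vimage_def
    using gcoord_proj_mem[OF g, of "I \<inter> {r+1/2<..}"] gcoord_mem[OF g] by auto
qed

lemma separates_iff:
  "separates h A B \<longleftrightarrow> (\<exists>I (\<alpha> :: real \<Rightarrow> 'a) r. curtain_datum I \<alpha> r \<and>
     h = {x. gcoord I \<alpha> x \<in> {r - 1/2..r + 1/2}} \<and>
     ((\<forall>x\<in>A. gcoord I \<alpha> x < r - 1/2) \<and> (\<forall>x\<in>B. gcoord I \<alpha> x > r + 1/2) \<or>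
      (\<forall>x\<in>B. gcoord I \<alpha> x < r - 1/2) \<and> (\<forall>x\<in>A. gcoord I \<alpha> x > r + 1/2)))"
proof -
  have "curtain_datum I \<alpha> r \<and> h = dual_curtain I \<alpha> r \<and>
        (A \<subseteq> neg_halfspace I \<alpha> r \<and> B \<subseteq> pos_halfspace I \<alpha> r \<or>
         B \<subseteq> neg_halfspace I \<alpha> r \<and> A \<subseteq> pos_halfspace I \<alpha> r) \<longleftrightarrow>
     curtain_datum I \<alpha> r \<and> h = {x. gcoord I \<alpha> x \<in> {r - 1/2..r + 1/2}} \<and>
     ((\<forall>x\<in>A. gcoord I \<alpha> x < r - 1/2) \<and> (\<forall>x\<in>B. gcoord I \<alpha> x > r + 1/2) \<or>
      (\<forall>x\<in>B. gcoord I \<alpha> x < r - 1/2) \<and> (\<forall>x\<in>A. gcoord I \<alpha> x > r + 1/2))" for I \<alpha> r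
    by (rule conj_cong[OF refl])
      (simp only: dual_curtain_eq neg_halfspace_eq pos_halfspace_eq subset_iff mem_Collect_eq Ball_def)
  then show ?thesis unfolding separates_def by simp
qed

lemma separates_commute: "separates h A B \<longleftrightarrow> separates h B A"
  unfolding separates_def by blast

lemma separates_point:
  "separates h A B \<Longrightarrow> x \<in> A \<Longrightarrow> y \<in> B \<Longrightarrow> separates h {x} {y}"
  unfolding separates_def by blast

lemma separates_not_mem:
  assumes "separates h {x} {y :: 'a}" shows "x \<notin> h" "y \<notin> h"
  using assms by (auto simp: separates_iff)

text \<open>A curtain between \<open>x\<close> and \<open>y\<close> is thereby followed along any
  detour: it contains the intermediate point or separates it from one of the ends. All later counts
  rest on this.\<close>

lemma separates_cases:
  assumes "separates h {x} {y}" "z \<notin> h"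
  shows "separates h {x} {z} \<or> separates h {z} {y :: 'a}"
proof -
  from assms(1) obtain I \<alpha> r where c: "curtain_datum I \<alpha> r" "h = {x. gcoord I \<alpha> x \<in> {r - 1/2..r + 1/2}}"
    and *: "gcoord I \<alpha> x < r - 1/2 \<and> gcoord I \<alpha> y > r + 1/2 \<or> gcoord I \<alpha> y < r - 1/2 \<and> gcoord I \<alpha> x > r + 1/2"
    unfolding separates_iff by auto
  from assms(2) c have "gcoord I \<alpha> z < r - 1/2 \<or> gcoord I \<alpha> z > r + 1/2" by auto
  with * c show ?thesis unfolding separates_iff by blast
qed

lemma connected_curtain:
  assumes "curtain (h :: 'a set)" shows "connected h"
proof -
  obtain I \<alpha> r where d: "curtain_datum I \<alpha> r" and h: "h = dual_curtain I \<alpha> r"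
    using assms by (auto simp: curtain_def)
  have "geodesic I \<alpha>" "{r - 1/2..r + 1/2} \<subseteq> I"
    using d interior_subset[of I] by (auto simp: curtain_datum_def)
  then show ?thesis unfolding h dual_curtain_eq[OF d]
    by (rule connected_gcoord_vimage) (auto simp: is_interval_cc)
qed

lemma curtain_nonempty:
  assumes "curtain (h :: 'a set)" shows "h \<noteq> {}"
proof -
  obtain I \<alpha> r where d: "curtain_datum I \<alpha> r" and h: "h = dual_curtain I \<alpha> r"
    using assms by (auto simp: curtain_def)
  then have "\<alpha> r \<in> h"
    using curtain_datum_mem[OF d, of r] by (auto simp: dual_curtain_eq curtain_datum_def)
  then show ?thesis by blast
qed

lemma curtain_if_separates: "separates h A B \<Longrightarrow> curtain h"
  unfolding separates_def curtain_def by blast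

lemma connected_real_image:
  assumes "connected T" "continuous_on T (f :: 'a \<Rightarrow> real)" "x \<in> T" "y \<in> T" "f x \<le> c" "c \<le> f y"
  shows "\<exists>z\<in>T. f z = c"
proof -
  have "connected (f ` T)" by (rule connected_continuous_image) fact+
  then have "c \<in> f ` T"
    using assms connectedD_interval[of "f ` T" "f x" "f y" c] by auto
  then show ?thesis by auto
qed

lemma separates_meets_connected:
  assumes "separates h {x} {y :: 'a}" "connected T" "x \<in> T" "y \<in> T"
  shows "h \<inter> T \<noteq> {}"
proof -
  from assms(1) obtain I \<alpha> r where c: "curtain_datum I \<alpha> r" "h = {x. gcoord I \<alpha> x \<in> {r - 1/2..r + 1/2}}"
    and *: "gcoord I \<alpha> x < r - 1/2 \<and> gcoord I \<alpha> y > r + 1/2 \<or> gcoord I \<alpha> y < r - 1/2 \<and> gcoord I \<alpha> x > r + 1/2"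
    unfolding separates_iff by auto
  have "continuous_on T (gcoord I \<alpha>)"
    using c by (intro continuous_gcoord) (auto simp: curtain_datum_def)
  then have "\<exists>z\<in>T. gcoord I \<alpha> z = r"
    using * connected_real_image[OF assms(2), of _ x y r] connected_real_image[OF assms(2), of _ y x r] assms by force
  then show ?thesis using c by auto
qed

text \<open>After the last crossing of level \<open>a\<close> the values stay at least
  \<open>a\<close>, and for one more unit of length they cannot exceed \<open>a + 1\<close>; that
  unit fits because the end value lies beyond \<open>a + 1\<close>.\<close>

lemma crossing_interval:
  fixes g :: "'a \<Rightarrow> real"
  assumes g: "\<And>x y. \<bar>g x - g y\<bar> \<le> dist x y" and a: "g x < a" "g y > a + 1"
  shows "\<exists>s. 0 \<le> s \<and> s + 1 \<le> dist x y \<and> (\<forall>u\<in>{s..s+1}. a \<le> g (gseg x y u) \<and> g (gseg x y u) \<le> a + 1)"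
proof -
  let ?d = "dist x y" let ?f = "\<lambda>u. g (gseg x y u)"
  have lip: "\<bar>?f u - ?f v\<bar> \<le> \<bar>u - v\<bar>" if "u \<in> {0..?d}" "v \<in> {0..?d}" for u v
    using g[of "gseg x y u" "gseg x y v"] dist_gseg[OF that] by simp
  have "continuous_on {0..?d} ?f"
    by (rule lipschitz_on_continuous_on[of 1], rule lipschitz_onI) (use lip in \<open>auto simp: dist_real_def\<close>)
  then obtain s where s: "s \<in> {0..?d}" "?f s = a" "\<And>u. u \<in> {s..?d} \<Longrightarrow> a \<le> ?f u"
    by (rule last_crossing[of 0 ?d ?f a]) (use a in auto)
  have "s + 1 \<le> ?d" using lip[of ?d s] s(1,2) a by auto
  moreover have "?f u \<le> a + 1" if "u \<in> {s..s+1}" for u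
    using lip[of u s] s(1,2) that \<open>s + 1 \<le> ?d\<close> by auto
  ultimately show ?thesis using s by (intro exI[of _ s]) auto
qed

lemma separates_interval:
  assumes "separates h {x} {y :: 'a}"
  shows "\<exists>s. 0 \<le> s \<and> s + 1 \<le> dist x y \<and> (\<forall>u\<in>{s..s+1}. gseg x y u \<in> h)"
proof -
  from assms(1) obtain I \<alpha> r where c: "curtain_datum I \<alpha> r" "h = {x. gcoord I \<alpha> x \<in> {r - 1/2..r + 1/2}}"
    and *: "gcoord I \<alpha> x < r - 1/2 \<and> gcoord I \<alpha> y > r + 1/2 \<or> gcoord I \<alpha> y < r - 1/2 \<and> gcoord I \<alpha> x > r + 1/2"
    unfolding separates_iff by auto
  have lip: "\<bar>gcoord I \<alpha> x - gcoord I \<alpha> y\<bar> \<le> dist x y" for x y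
    using c gcoord_Lipschitz by (auto simp: curtain_datum_def)
  from * show ?thesis
  proof
    assume "gcoord I \<alpha> x < r - 1/2 \<and> gcoord I \<alpha> y > r + 1/2"
    then obtain s where "0 \<le> s" "s + 1 \<le> dist x y"
      "\<forall>u\<in>{s..s+1}. r - 1/2 \<le> gcoord I \<alpha> (gseg x y u) \<and> gcoord I \<alpha> (gseg x y u) \<le> r - 1/2 + 1"
      using crossing_interval[of "gcoord I \<alpha>" x "r - 1/2" y] lip by auto
    then show ?thesis using c by (intro exI[of _ s]) auto
  next
    assume A: "gcoord I \<alpha> y < r - 1/2 \<and> gcoord I \<alpha> x > r + 1/2"
    have "\<bar>- gcoord I \<alpha> x - - gcoord I \<alpha> y\<bar> \<le> dist x y" for x y using lip[of y x] by (simp add: dist_commute)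
    with A obtain s where "0 \<le> s" "s + 1 \<le> dist x y"
      "\<forall>u\<in>{s..s+1}. - r - 1/2 \<le> - gcoord I \<alpha> (gseg x y u) \<and> - gcoord I \<alpha> (gseg x y u) \<le> - r - 1/2 + 1"
      using crossing_interval[of "\<lambda>x. - gcoord I \<alpha> x" x "- r - 1/2" y] by auto
    then show ?thesis using c by (intro exI[of _ s]) force
  qed
qed

text \<open>Disjoint curtains contain disjoint unit pieces of the geodesic. Two unit pieces whose
  left ends have the same integer part meet, so the integer part of the left end is
  injective.\<close>

lemma card_disjoint_separating:
  assumes dis: "pairwise disjnt c" and sep: "\<And>h. h \<in> c \<Longrightarrow> separates h {x} {y :: 'a}"
  shows "finite c \<and> real (card c) \<le> dist x y"
proof -
  obtain s where s: "\<And>h. h \<in> c \<Longrightarrow> 0 \<le> s h \<and> s h + 1 \<le> dist x y \<and> (\<forall>u\<in>{s h..s h+1}. gseg x y u \<in> h)"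
    using separates_interval[OF sep] by metis
  let ?F = "\<lambda>h. nat \<lfloor>s h\<rfloor>"
  have inj: "inj_on ?F c"
  proof (rule inj_onI, rule ccontr)
    fix h h' assume h: "h \<in> c" "h' \<in> c" "?F h = ?F h'" "h \<noteq> h'"
    then have "\<lfloor>s h\<rfloor> = \<lfloor>s h'\<rfloor>" using s by (metis nat_eq_iff2 zero_le_floor)
    then have "\<bar>s h - s h'\<bar> < 1" by linarith
    then have "max (s h) (s h') \<in> {s h..s h+1}" "max (s h) (s h') \<in> {s h'..s h'+1}" by auto
    then have "gseg x y (max (s h) (s h')) \<in> h \<inter> h'" using s h by blast
    then show False using dis h by (auto simp: pairwise_def disjnt_def)
  qed
  have sub: "?F ` c \<subseteq> {..<nat \<lfloor>dist x y\<rfloor>}"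
  proof
    fix k assume "k \<in> ?F ` c"
    then obtain h where h: "h \<in> c" "k = ?F h" by auto
    then have "\<lfloor>s h\<rfloor> + 1 \<le> \<lfloor>dist x y\<rfloor>" "0 \<le> \<lfloor>s h\<rfloor>" using s[OF h(1)] by linarith+
    then have "nat \<lfloor>s h\<rfloor> < nat \<lfloor>dist x y\<rfloor>" by linarith
    then show "k \<in> {..<nat \<lfloor>dist x y\<rfloor>}" using h by simp
  qed
  have fin: "finite c" using finite_imageD[OF finite_subset[OF sub] inj] by simp
  have "card c \<le> nat \<lfloor>dist x y\<rfloor>"
    using card_mono[OF _ sub] card_image[OF inj] by simp
  then have "real (card c) \<le> real (nat \<lfloor>dist x y\<rfloor>)" by (simp only: of_nat_le_iff)
  also have "\<dots> \<le> dist x y" by (rule of_nat_floor) simp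
  finally have "real (card c) \<le> dist x y" .
  with fin show ?thesis by blast
qed

section \<open>Elementary bounds on \<open>curtain_dist\<close>\<close>

lemma L_separated_disjnt: "L_separated L h h' \<Longrightarrow> disjnt h h'"
  by (simp add: L_separated_def disjnt_def)

lemma L_chain_pairwise_disjnt: "L_chain L c \<Longrightarrow> pairwise disjnt c"
  by (auto simp: L_chain_def pairwise_def intro: L_separated_disjnt)

lemma curtain_dist_le:
  assumes "\<And>c. L_chain L c \<Longrightarrow> (\<forall>h\<in>c. separates h {x} {y :: 'a}) \<Longrightarrow> card c \<le> n"
  shows "curtain_dist L x y \<le> 1 + n"
proof -
  let ?S = "{card c | c. L_chain L c \<and> (\<forall>h\<in>c. separates h {x} {y})}"
  have "?S \<subseteq> {..n}" using assms by blast
  then have fin: "finite ?S" by (rule finite_subset) simp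
  have "curtain_chain ({} :: 'a set set)"
    unfolding curtain_chain_def by (rule exI[of _ "{}"]) (simp add: bij_betw_def)
  then have "L_chain L ({} :: 'a set set)" by (simp add: L_chain_def)
  then have "card ({} :: 'a set set) \<in> ?S" by blast
  then have "?S \<noteq> {}" by blast
  with fin have "Max ?S \<in> ?S" by (rule Max_in)
  with \<open>?S \<subseteq> {..n}\<close> have "Max ?S \<le> n" by blast
  then show ?thesis by (simp add: curtain_dist_def)
qed

lemma card_L_chain_le_dist:
  assumes "L_chain L c" "\<forall>h\<in>c. separates h {x} {y :: 'a}"
  shows "real (card c) \<le> dist x y"
  using card_disjoint_separating[OF L_chain_pairwise_disjnt[OF assms(1)], of x y] assms(2) by auto

lemma curtain_dist_le_dist: "real (curtain_dist L x y) \<le> 1 + dist x (y::'a)"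
proof -
  have "curtain_dist L x y \<le> 1 + nat \<lfloor>dist x y\<rfloor>"
    by (rule curtain_dist_le) (rule le_nat_floor, rule card_L_chain_le_dist)
  then have "real (curtain_dist L x y) \<le> 1 + real (nat \<lfloor>dist x y\<rfloor>)" by linarith
  also have "\<dots> \<le> 1 + dist x y" using of_nat_floor[of "dist x y"] by simp
  finally show ?thesis .
qed

lemma curtain_dist_ge:
  assumes "L_chain L c" "\<forall>h\<in>c. separates h {x} {y :: 'a}" "x \<noteq> y"
  shows "card c \<le> curtain_dist L x y"
proof -
  let ?S = "{card c | c. L_chain L c \<and> (\<forall>h\<in>c. separates h {x} {y})}"
  have "card c \<le> nat \<lfloor>dist x y\<rfloor>" if "L_chain L c" "\<forall>h\<in>c. separates h {x} {y}" for c
    using card_L_chain_le_dist[OF that] by (rule le_nat_floor)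
  then have "?S \<subseteq> {..nat \<lfloor>dist x y\<rfloor>}" by blast
  then have "finite ?S" by (rule finite_subset) simp
  then have "card c \<le> Max ?S" by (rule Max_ge) (use assms in blast)
  then show ?thesis using assms by (simp add: curtain_dist_def)
qed

subsection \<open>Chains dual to one geodesic\<close>

context
  fixes I :: "real set" and \<alpha> :: "real \<Rightarrow> 'a" and r :: real and k :: nat
  assumes data: "\<And>j. j < k \<Longrightarrow> curtain_datum I \<alpha> (r + 2 * real j)"
begin

text \<open>Centres at spacing 2 leave unit gaps between curtains of width 1, so the curtains are
  disjoint and ordered by their coordinate.\<close>

definition dual_chain :: "'a set set" where
  "dual_chain = (\<lambda>j. dual_curtain I \<alpha> (r + 2 * real j)) ` {..<k}"

lemma dual_curtain_disjoint:
  assumes "i < k" "j < k" "i \<noteq> j"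
  shows "dual_curtain I \<alpha> (r + 2 * real i) \<inter> dual_curtain I \<alpha> (r + 2 * real j) = {}"
proof -
  have "\<bar>real i - real j\<bar> \<ge> 1" using assms(3) by linarith
  then show ?thesis using data[OF assms(1)] data[OF assms(2)] by (auto simp: dual_curtain_eq)
qed

lemma inj_on_dual_curtain: "inj_on (\<lambda>j. dual_curtain I \<alpha> (r + 2 * real j)) {..<k}"
proof (rule inj_onI, rule ccontr)
  fix i j assume *: "i \<in> {..<k}" "j \<in> {..<k}" "dual_curtain I \<alpha> (r + 2 * real i) = dual_curtain I \<alpha> (r + 2 * real j)" "i \<noteq> j"
  have "curtain (dual_curtain I \<alpha> (r + 2 * real i))"
    using data[of i] * by (auto simp: curtain_def)
  then show False using dual_curtain_disjoint[of i j] * curtain_nonempty by blast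
qed

lemma card_dual_chain: "card dual_chain = k"
  using card_image[OF inj_on_dual_curtain] by (simp add: dual_chain_def)

lemma curtain_chain_dual_chain: "curtain_chain dual_chain"
  unfolding curtain_chain_def
proof (intro exI conjI)
  let ?J = "{0..<int k}" and ?h = "\<lambda>i. dual_curtain I \<alpha> (r + 2 * real (nat i))"
  show "\<forall>i\<in>?J. \<forall>j\<in>?J. {i..j} \<subseteq> ?J" by auto
  have "bij_betw nat ?J {..<k}"
    by (rule bij_betwI[of _ _ _ int]) auto
  then have "bij_betw ((\<lambda>j. dual_curtain I \<alpha> (r + 2 * real j)) \<circ> nat) ?J dual_chain"
    unfolding dual_chain_def
    by (rule bij_betw_trans) (simp add: bij_betw_def inj_on_dual_curtain)
  then show "bij_betw ?h ?J dual_chain" by (simp add: o_def)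
  show "\<forall>i\<in>?J. curtain (?h i)"
  proof
    fix i assume "i \<in> ?J"
    then show "curtain (?h i)" using data[of "nat i"] unfolding curtain_def by fastforce
  qed
  show "\<forall>i. i - 1 \<in> ?J \<and> i \<in> ?J \<and> i + 1 \<in> ?J \<longrightarrow> separates (?h i) (?h (i - 1)) (?h (i + 1))"
  proof (intro allI impI)
    fix i assume i: "i - 1 \<in> ?J \<and> i \<in> ?J \<and> i + 1 \<in> ?J"
    then have d: "curtain_datum I \<alpha> (r + 2 * real (nat i))" "curtain_datum I \<alpha> (r + 2 * real (nat (i-1)))" "curtain_datum I \<alpha> (r + 2 * real (nat (i+1)))"
      by (intro data; auto)+
    show "separates (?h i) (?h (i - 1)) (?h (i + 1))"
      unfolding separates_iff
      by (intro exI[of _ I] exI[of _ \<alpha>] exI[of _ "r + 2 * real (nat i)"])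
        (use d i in \<open>auto simp: dual_curtain_eq\<close>)
  qed
qed

text \<open>The outer edges of the chain are \<open>r - 1/2\<close> and
  \<open>r + 2 * (real k - 1) + 1/2\<close>.\<close>

lemma dual_chain_separates:
  assumes "h \<in> dual_chain" "gcoord I \<alpha> p < r - 1/2" "gcoord I \<alpha> q > r + 2 * real k - 3/2"
  shows "separates h {p} {q}"
proof -
  obtain j where j: "j < k" "h = dual_curtain I \<alpha> (r + 2 * real j)" using assms(1) by (auto simp: dual_chain_def)
  then have "real j \<le> real k - 1" by linarith
  then show ?thesis unfolding separates_iff
    by (intro exI[of _ I] exI[of _ \<alpha>] exI[of _ "r + 2 * real j"])
      (use j data[OF j(1)] assms in \<open>auto simp: dual_curtain_eq\<close>)
qed

text \<open>A connected set whose coordinates range from the first centre to the last one passes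
  through every centre.\<close>

lemma dual_chain_meets:
  assumes "h' \<in> dual_chain" "connected h" "p \<in> h" "q \<in> h" "gcoord I \<alpha> p \<le> r" "gcoord I \<alpha> q \<ge> r + 2 * real k - 2"
  shows "h' \<inter> h \<noteq> {}"
proof -
  obtain j where j: "j < k" "h' = dual_curtain I \<alpha> (r + 2 * real j)" using assms(1) by (auto simp: dual_chain_def)
  have "continuous_on h (gcoord I \<alpha>)"
    using data[OF j(1)] by (intro continuous_gcoord) (auto simp: curtain_datum_def)
  moreover have "real j \<le> real k - 1" using j by linarith
  then have "gcoord I \<alpha> p \<le> r + 2 * real j" "r + 2 * real j \<le> gcoord I \<alpha> q"
    using assms by auto
  ultimately obtain z where "z \<in> h" "gcoord I \<alpha> z = r + 2 * real j"
    using connected_real_image[OF assms(2)] assms(3,4) by blast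
  then show ?thesis using j data[OF j(1)] by (auto simp: dual_curtain_eq)
qed

end

lemma curtain_datum_gseg:
  assumes "1/2 < r" "r + 1/2 < dist p q" shows "curtain_datum {0..dist p q} (gseg p q) r"
  using assms geodesic_gseg by (auto simp: curtain_datum_def)

text \<open>The curtains dual to the segment with centres \<open>s + 1\<close>,
  \<open>s + 3\<close>, ..., \<open>s + 1 + 2 * L\<close> form a chain of \<open>L + 1\<close>
  members that meet both \<open>h\<close> and \<open>h'\<close>. The length \<open>2 * L + 4\<close>
  keeps them all inside the segment.\<close>

lemma not_L_separated:
  assumes h: "curtain h" "p \<in> h" "p' \<in> h" and h': "curtain h'" "q \<in> h'" "q' \<in> h'"
    and s: "0 \<le> s" "gcoord {0..dist u v} (gseg u v) p \<le> s" "gcoord {0..dist u v} (gseg u v) q \<le> s"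
    and t: "gcoord {0..dist u v} (gseg u v) p' \<ge> s + 2 * real L + 4" "gcoord {0..dist u v} (gseg u v) q' \<ge> s + 2 * real L + 4"
  shows "\<not> L_separated L h h'"
proof
  assume A: "L_separated L h h'"
  let ?I = "{0..dist u v}" and ?\<alpha> = "gseg u v"
  have "gcoord ?I ?\<alpha> p' \<le> dist u v" using gcoord_mem[OF geodesic_gseg, of u v p'] by simp
  then have d: "curtain_datum ?I ?\<alpha> ((s + 1) + 2 * real j)" if "j < Suc L" for j
  proof (intro curtain_datum_gseg)
    have "real j \<le> real L" using that by simp
    then show "s + 1 + 2 * real j + 1 / 2 < dist u v" using t \<open>gcoord ?I ?\<alpha> p' \<le> dist u v\<close> by linarith
  qed (use s in linarith)
  let ?c = "dual_chain ?I ?\<alpha> (s+1) (Suc L)"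
  have "\<forall>k\<in>?c. k \<inter> h \<noteq> {} \<and> k \<inter> h' \<noteq> {}"
    using dual_chain_meets[OF d, where h=h and p=p and q=p'] dual_chain_meets[OF d, where h=h' and p=q and q=q']
      connected_curtain h h' s t by auto
  then have "card ?c \<le> L" using A curtain_chain_dual_chain[OF d] unfolding L_separated_def by blast
  then show False using card_dual_chain[OF d] by simp
qed

end

lemma (in group) inv_commute:
  assumes "c \<in> carrier G" "s \<in> carrier G" "c \<otimes> s = s \<otimes> c" shows "inv c \<otimes> s = s \<otimes> inv c"
proof -
  have "c \<otimes> (s \<otimes> inv c) = s \<otimes> c \<otimes> inv c" using assms by (simp flip: m_assoc)
  also have "\<dots> = s" using assms by (simp add: m_assoc)
  finally show ?thesis using assms inv_solve_left[of "s \<otimes> inv c" c s] by simp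
qed

subsection \<open>Geometric actions and the coarse kernel\<close>

locale geometric_CAT0 = CAT0 X for X :: "'a::metric_space itself" +
  fixes G :: "'g monoid" (structure) and \<phi> :: "'g \<Rightarrow> 'a \<Rightarrow> 'a"
  assumes geometric: "geometric_action G \<phi>"
begin

lemma group_action: "group_action G UNIV \<phi>"
  using geometric by (simp add: geometric_action_def isometric_action_def)

sublocale group G
  using group_action unfolding group_action_def group_hom_def by blast

lemma dist_act [simp]: "g \<in> carrier G \<Longrightarrow> dist (\<phi> g x) (\<phi> g y) = dist x y"
  using geometric by (simp add: geometric_action_def isometric_action_def)

lemma act_mult: "g \<in> carrier G \<Longrightarrow> h \<in> carrier G \<Longrightarrow> \<phi> (g \<otimes> h) x = \<phi> g (\<phi> h x)"
  using group_action.composition_rule[OF group_action] by simp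

lemma act_one [simp]: "\<phi> \<one> x = x"
  using fun_cong[OF group_action.id_eq_one[OF group_action], of x] by simp

lemma act_inv [simp]:
  assumes "g \<in> carrier G" shows "\<phi> (inv g) (\<phi> g x) = x" "\<phi> g (\<phi> (inv g) x) = x"
  using assms by (simp_all flip: act_mult)

lemma dist_act_inv: "g \<in> carrier G \<Longrightarrow> dist (\<phi> (inv g) x) y = dist x (\<phi> g y)"
  using dist_act[of g "\<phi> (inv g) x" y] by simp

lemma continuous_act: "g \<in> carrier G \<Longrightarrow> continuous_on S (\<phi> g)"
  by (rule lipschitz_on_continuous_on[of 1], rule lipschitz_onI) auto

lemma act_gpt: "g \<in> carrier G \<Longrightarrow> 0 \<le> t \<Longrightarrow> t \<le> 1 \<Longrightarrow> \<phi> g (gpt p q t) = gpt (\<phi> g p) (\<phi> g q) t"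
  by (rule gpt_isometry) auto

lemma finite_displacement: "finite {g \<in> carrier G. dist x (\<phi> g x) \<le> r}"
proof -
  have "finite {g \<in> carrier G. dist (\<phi> g x) x \<le> max r 1}"
    using geometric unfolding geometric_action_def properly_discontinuous_action_def
    by (metis less_max_iff_disj zero_less_one)
  then show ?thesis by (rule rev_finite_subset) (auto simp: dist_commute)
qed

lemma cocompact: "\<exists>K. compact K \<and> (\<forall>x. \<exists>g\<in>carrier G. \<exists>k\<in>K. x = \<phi> g k)"
proof -
  obtain K where K: "compact K" "(\<Union>g\<in>carrier G. \<phi> g ` K) = UNIV"
    using geometric unfolding geometric_action_def cocompact_action_def by blast
  have "\<exists>g\<in>carrier G. \<exists>k\<in>K. x = \<phi> g k" for x
  proof -
    have "x \<in> (\<Union>g\<in>carrier G. \<phi> g ` K)" unfolding K(2) by simp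
    then show ?thesis by blast
  qed
  with K(1) show ?thesis by blast
qed

abbreviation GX where "GX \<equiv> coarse_kernel G \<phi>"

lemma coarse_kernel_carrier: "g \<in> GX \<Longrightarrow> g \<in> carrier G"
  by (simp add: coarse_kernel_def)

lemma coarse_kernelE:
  assumes "g \<in> GX" obtains C where "C > 0" "\<And>x. dist x (\<phi> g x) \<le> C"
  using assms by (auto simp: coarse_kernel_def dist_commute)

lemma coarse_kernelI:
  assumes "g \<in> carrier G" "\<And>x. dist x (\<phi> g x) \<le> C" shows "g \<in> GX"
proof -
  have "\<forall>x. dist (\<phi> g x) x \<le> max C 1" using assms(2) by (simp add: dist_commute le_max_iff_disj)
  then show ?thesis using assms(1) unfolding coarse_kernel_def by (auto intro!: exI[of _ "max C 1"])
qed

lemma subgroup_coarse_kernel: "subgroup GX G"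
proof
  show "GX \<subseteq> carrier G" using coarse_kernel_carrier by blast
  show "\<one> \<in> GX" by (rule coarse_kernelI[of _ 0]) auto
next
  fix x y assume x: "x \<in> GX" and y: "y \<in> GX"
  obtain C where C: "\<And>z. dist z (\<phi> x z) \<le> C" using coarse_kernelE[OF x] by blast
  obtain D where D: "\<And>z. dist z (\<phi> y z) \<le> D" using coarse_kernelE[OF y] by blast
  show "x \<otimes> y \<in> GX"
  proof (rule coarse_kernelI[of _ "D + C"])
    fix z show "dist z (\<phi> (x \<otimes> y) z) \<le> D + C"
      using D[of z] C[of "\<phi> y z"] dist_triangle[of z "\<phi> x (\<phi> y z)" "\<phi> y z"] x y
      by (simp add: act_mult coarse_kernel_carrier)
  qed (use x y in \<open>auto intro: coarse_kernel_carrier\<close>)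
next
  fix x assume x: "x \<in> GX"
  then obtain C where C: "\<And>z. dist z (\<phi> x z) \<le> C" using coarse_kernelE by blast
  show "inv x \<in> GX"
    by (rule coarse_kernelI[of _ C]) (use x C in \<open>auto simp: coarse_kernel_carrier dist_commute[of _ "\<phi> (inv x) _"] dist_act_inv\<close>)
qed

lemma act_conj:
  "g \<in> carrier G \<Longrightarrow> h \<in> carrier G \<Longrightarrow> dist x (\<phi> (inv h \<otimes> g \<otimes> h) x) = dist (\<phi> h x) (\<phi> g (\<phi> h x))"
  using dist_act[of h x "\<phi> (inv h \<otimes> g \<otimes> h) x"] by (simp add: act_mult)

lemma coarse_kernel_conj:
  assumes g: "g \<in> GX" and h: "h \<in> carrier G" shows "inv h \<otimes> g \<otimes> h \<in> GX"
proof -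
  obtain C where C: "\<And>z. dist z (\<phi> g z) \<le> C" using coarse_kernelE[OF g] by blast
  show ?thesis
    by (rule coarse_kernelI[of _ C]) (use g h C in \<open>auto simp: coarse_kernel_carrier act_conj\<close>)
qed

lemma normal_coarse_kernel: "GX \<lhd> G"
proof (rule normal_invI[OF subgroup_coarse_kernel])
  fix x h assume "x \<in> carrier G" "h \<in> GX"
  then show "x \<otimes> h \<otimes> inv x \<in> GX" using coarse_kernel_conj[of h "inv x"] by simp
qed

section \<open>Finite conjugacy classes and cocompact centralizers\<close>

definition conjugates where "conjugates g = (\<lambda>h. inv h \<otimes> g \<otimes> h) ` carrier G"

text \<open>Conjugation only changes the point at which the displacement is measured, so all
  conjugates move one base point (here \<open>undefined\<close>, an arbitrary one) by at most
  \<open>C\<close>.\<close>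

lemma finite_conjugates:
  assumes g: "g \<in> GX" shows "finite (conjugates g)"
proof -
  obtain C where C: "\<And>z. dist z (\<phi> g z) \<le> C" using coarse_kernelE[OF g] by blast
  have "conjugates g \<subseteq> {u \<in> carrier G. dist undefined (\<phi> u undefined) \<le> C}"
    unfolding conjugates_def using g C by (auto simp: coarse_kernel_carrier act_conj)
  then show ?thesis using finite_displacement finite_subset by blast
qed

text \<open>The displacement of \<open>m\<close> at \<open>\<phi> h k\<close> is that of a conjugate
  of \<open>m\<close> at \<open>k\<close>; the conjugates stay in the finite \<open>M\<close> and
  \<open>k\<close> ranges over a compact set.\<close>

lemma finite_normal_subset_coarse_kernel:
  assumes "M \<lhd> G" "finite M" shows "M \<subseteq> GX"
proof
  fix m assume m: "m \<in> M"
  interpret M: normal M G by fact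
  obtain K where K: "compact K" "\<And>x. \<exists>g\<in>carrier G. \<exists>k\<in>K. x = \<phi> g k"
    using cocompact by metis
  obtain C where C: "\<And>x y. x \<in> K \<Longrightarrow> y \<in> K \<Longrightarrow> dist x y \<le> C"
    using compact_imp_bounded[OF K(1)] unfolding bounded_two_points by blast
  obtain k0 where k0: "k0 \<in> K" using K(2) by blast
  \<comment> \<open>The sum is a convenient upper bound for the maximum over
    \<open>M\<close>.\<close>
  define B where "B = 2 * C + (\<Sum>u\<in>M. dist k0 (\<phi> u k0))"
  have "dist x (\<phi> m x) \<le> B" for x
  proof -
    obtain h k where h: "h \<in> carrier G" "k \<in> K" "x = \<phi> h k" using K(2) by blast
    define u where "u = inv h \<otimes> m \<otimes> h"
    have u: "u \<in> M" "u \<in> carrier G" using M.inv_op_closed1[OF h(1) m] M.subset unfolding u_def by auto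
    have "dist x (\<phi> m x) = dist k (\<phi> u k)"
      using act_conj[of m h k] h m M.subset unfolding u_def by auto
    also have "\<dots> \<le> dist k k0 + dist k0 (\<phi> u k0) + dist (\<phi> u k0) (\<phi> u k)"
      using dist_triangle[of k "\<phi> u k" k0] dist_triangle[of k0 "\<phi> u k" "\<phi> u k0"] by linarith
    also have "\<dots> \<le> 2 * C + dist k0 (\<phi> u k0)"
      using C[OF h(2) k0] C[OF k0 h(2)] u by simp
    also have "\<dots> \<le> B" unfolding B_def using member_le_sum[OF u(1), of "\<lambda>u. dist k0 (\<phi> u k0)"] assms by simp
    finally show ?thesis .
  qed
  then show "m \<in> GX" using m M.subset by (intro coarse_kernelI) auto
qed

text \<open>Conjugating \<open>S\<close> by \<open>g\<close> gives a map from \<open>S\<close> into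
  finite conjugacy classes, so only finitely many maps occur, and elements with equal maps differ by
  a factor that centralizes \<open>S\<close>. The representatives stay in \<open>D\<close> because
  the result serves both the whole group and the coarse kernel.\<close>

lemma centralizer_cosets:
  assumes "finite S" "S \<subseteq> GX" "D \<subseteq> carrier G"
  shows "\<exists>V. finite V \<and> V \<subseteq> D \<and> (\<forall>g\<in>D. \<exists>v\<in>V. \<forall>s\<in>S. (g \<otimes> inv v) \<otimes> s = s \<otimes> (g \<otimes> inv v))"
proof -
  define f where "f g = (\<lambda>s\<in>S. inv g \<otimes> s \<otimes> g)" for g
  have "f ` D \<subseteq> PiE S conjugates"
    using assms(3) by (auto simp: f_def conjugates_def)
  moreover have "finite (PiE S conjugates)"
    using assms finite_conjugates by (intro finite_PiE) auto
  ultimately have fin: "finite (f ` D)" by (rule finite_subset)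
  define r where "r v = inv_into D f v" for v
  have r: "r (f g) \<in> D" "f (r (f g)) = f g" if "g \<in> D" for g
    using that by (auto simp: r_def inv_into_into f_inv_into_f)
  have "\<forall>s\<in>S. (g \<otimes> inv (r (f g))) \<otimes> s = s \<otimes> (g \<otimes> inv (r (f g)))" if gD: "g \<in> D" for g
  proof
    fix s assume s: "s \<in> S"
    let ?u = "r (f g)"
    have c: "s \<in> carrier G" "g \<in> carrier G" "?u \<in> carrier G"
      using s assms coarse_kernel_carrier gD r by blast+
    have "f g s = f ?u s" using r(2)[OF gD] by simp
    then have e: "inv g \<otimes> s \<otimes> g = inv ?u \<otimes> s \<otimes> ?u" using s by (simp add: f_def)
    have "s \<otimes> g = g \<otimes> (inv g \<otimes> s \<otimes> g)" using c by (simp flip: m_assoc)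
    also have "\<dots> = g \<otimes> inv ?u \<otimes> s \<otimes> ?u" using e c by (simp add: m_assoc)
    finally have "s \<otimes> g \<otimes> inv ?u = g \<otimes> inv ?u \<otimes> s \<otimes> ?u \<otimes> inv ?u" by simp
    then show "(g \<otimes> inv ?u) \<otimes> s = s \<otimes> (g \<otimes> inv ?u)" using c by (simp add: m_assoc)
  qed
  with r fin show ?thesis by (intro exI[of _ "r ` f ` D"]) blast
qed

lemma centralizer_cocompact:
  assumes "finite S" "S \<subseteq> GX"
  shows "\<exists>K. compact K \<and> (\<forall>x. \<exists>c\<in>carrier G. (\<forall>s\<in>S. c \<otimes> s = s \<otimes> c) \<and> (\<exists>k\<in>K. x = \<phi> c k))"
proof -
  obtain K where K: "compact K" "\<And>x. \<exists>g\<in>carrier G. \<exists>k\<in>K. x = \<phi> g k"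
    using cocompact by metis
  obtain V where V: "finite V" "V \<subseteq> carrier G"
    "\<forall>g\<in>carrier G. \<exists>v\<in>V. \<forall>s\<in>S. (g \<otimes> inv v) \<otimes> s = s \<otimes> (g \<otimes> inv v)"
    using centralizer_cosets[OF assms order_refl] by blast
  define K' where "K' = (\<Union>v \<in> V. \<phi> v ` K)"
  show ?thesis
  proof (intro exI conjI allI)
    show "compact K'" unfolding K'_def
      using V K by (intro compact_UN) (auto intro!: compact_continuous_image continuous_act)
    fix x
    obtain g k where g: "g \<in> carrier G" "k \<in> K" "x = \<phi> g k" using K by blast
    obtain v where v: "v \<in> V" "\<forall>s\<in>S. (g \<otimes> inv v) \<otimes> s = s \<otimes> (g \<otimes> inv v)" using V g by blast
    have vc: "v \<in> carrier G" using v V by blast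
    have "x = \<phi> (g \<otimes> inv v) (\<phi> v k)" using g vc by (simp flip: act_mult) (simp add: m_assoc)
    moreover have "\<phi> v k \<in> K'" using g v by (auto simp: K'_def)
    ultimately show "\<exists>c\<in>carrier G. (\<forall>s\<in>S. c \<otimes> s = s \<otimes> c) \<and> (\<exists>k\<in>K'. x = \<phi> c k)"
      using v(2) g vc by (intro bexI[of _ "g \<otimes> inv v"]) auto
  qed
qed

subsection \<open>Minimal displacement\<close>

definition gconvex :: "'a set \<Rightarrow> bool" where
  "gconvex M \<longleftrightarrow> (\<forall>x\<in>M. \<forall>y\<in>M. \<forall>t. 0 \<le> t \<and> t \<le> 1 \<longrightarrow> gpt x y t \<in> M)"

text \<open>If \<open>b \<otimes> b\<close> moves \<open>y\<close> by \<open>d\<close>, then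
  \<open>b\<close> moves the midpoint of \<open>y\<close> and \<open>\<phi> b y\<close> by at most
  \<open>d / 2\<close>: this midpoint and its image are midpoints of two sides of the triangle with
  apex \<open>\<phi> b y\<close>. Convexity and invariance keep the midpoint in
  \<open>M\<close>.\<close>

lemma displacement_halving:
  assumes "gconvex M" "b \<in> carrier G" "\<And>x. x \<in> M \<Longrightarrow> \<phi> b x \<in> M" "x \<in> M"
  shows "\<exists>y\<in>M. 2^j * dist y (\<phi> b y) \<le> dist x (\<phi> (b [^] (2^j::nat)) x)"
  using assms(2-)
proof (induction j arbitrary: b)
  case 0
  then show ?case by (auto intro!: bexI[of _ x])
next
  case (Suc j)
  have bb: "b \<otimes> b \<in> carrier G" "\<And>x. x \<in> M \<Longrightarrow> \<phi> (b \<otimes> b) x \<in> M" using Suc.prems by (auto simp: act_mult)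
  obtain y where y: "y \<in> M" "2^j * dist y (\<phi> (b \<otimes> b) y) \<le> dist x (\<phi> ((b \<otimes> b) [^] (2^j::nat)) x)"
    using Suc.IH[OF bb Suc.prems(3)] by blast
  have "b \<otimes> b = b [^] (2::nat)" using Suc.prems by (simp add: numeral_2_eq_2)
  then have e: "(b \<otimes> b) [^] (2^j::nat) = b [^] (2^Suc j::nat)" using Suc.prems by (simp add: nat_pow_pow)
  let ?m = "gpt y (\<phi> b y) (1/2)"
  have "?m = gpt (\<phi> b y) y (1/2)" using gpt_commute[of "1/2" "\<phi> b y" y] by simp
  moreover have "\<phi> b ?m = gpt (\<phi> b y) (\<phi> (b \<otimes> b) y) (1/2)" using Suc.prems by (simp add: act_gpt act_mult)
  ultimately have "dist ?m (\<phi> b ?m) \<le> (1/2) * dist y (\<phi> (b \<otimes> b) y)"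
    using dist_gpt_gpt_le[of "1/2" "\<phi> b y" y "\<phi> (b \<otimes> b) y"] by simp
  then have "2^Suc j * dist ?m (\<phi> b ?m) \<le> 2^j * dist y (\<phi> (b \<otimes> b) y)" by simp
  also have "\<dots> \<le> dist x (\<phi> (b [^] (2^Suc j::nat)) x)" using y(2) unfolding e .
  finally have "2^Suc j * dist ?m (\<phi> b ?m) \<le> dist x (\<phi> (b [^] (2^Suc j::nat)) x)" .
  moreover have "?m \<in> M" using y Suc.prems assms(1) unfolding gconvex_def by auto
  ultimately show ?case by blast
qed

lemma displacement_pow_le:
  assumes "b \<in> carrier G" shows "dist z (\<phi> (b [^] (n::nat)) z) \<le> real n * dist z (\<phi> b z)"
proof (induction n)
  case (Suc n)
  have "dist z (\<phi> (b [^] Suc n) z) \<le> dist z (\<phi> (b [^] n) z) + dist (\<phi> (b [^] n) z) (\<phi> (b [^] Suc n) z)"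
    by (rule dist_triangle)
  also have "dist (\<phi> (b [^] n) z) (\<phi> (b [^] Suc n) z) = dist z (\<phi> b z)" using assms by (simp add: act_mult)
  finally show ?case using Suc by (simp add: algebra_simps)
qed simp

text \<open>For a high power of \<open>b\<close>, moving the base point from \<open>z\<close> to
  \<open>x\<close> costs only \<open>2 * dist x z\<close>, and halving divides this cost by
  \<open>2^j\<close>. Hence the infimum over \<open>M\<close> is the infimum over the whole
  space.\<close>

lemma displacement_inf_le:
  assumes M: "gconvex M" "b \<in> carrier G" "\<And>x. x \<in> M \<Longrightarrow> \<phi> b x \<in> M" "x \<in> M" and e: "e > 0"
  shows "\<exists>y\<in>M. dist y (\<phi> b y) \<le> dist z (\<phi> b z) + e"
proof -
  obtain j where j: "2 * dist x z / e < 2^j" using real_arch_pow[of 2 "2 * dist x z / e"] by auto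
  obtain y where y: "y \<in> M" "2^j * dist y (\<phi> b y) \<le> dist x (\<phi> (b [^] (2^j::nat)) x)"
    using displacement_halving[OF M] by blast
  let ?c = "b [^] (2^j::nat)"
  have c: "?c \<in> carrier G" using M by simp
  have "dist x (\<phi> ?c x) \<le> dist x z + dist z (\<phi> ?c z) + dist (\<phi> ?c z) (\<phi> ?c x)"
    using dist_triangle[of x "\<phi> ?c x" z] dist_triangle[of z "\<phi> ?c x" "\<phi> ?c z"] by linarith
  also have "\<dots> \<le> 2 * dist x z + 2^j * dist z (\<phi> b z)"
    using displacement_pow_le[OF M(2), of z "2^j"] dist_act[OF c, of z x] by (simp add: dist_commute)
  also have "\<dots> \<le> 2^j * (dist z (\<phi> b z) + e)" using j e by (simp add: field_simps)
  finally have "2^j * dist y (\<phi> b y) \<le> 2^j * (dist z (\<phi> b z) + e)" using y(2) by linarith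
  then show ?thesis using y(1) by auto
qed

definition Minset :: "'g set \<Rightarrow> 'a set" where
  "Minset S = {x. \<forall>s\<in>S. \<forall>z. dist x (\<phi> s x) \<le> dist z (\<phi> s z)}"

lemma gconvex_Minset:
  assumes "S \<subseteq> carrier G" shows "gconvex (Minset S)"
  unfolding gconvex_def Minset_def
proof (intro ballI allI impI CollectI)
  fix x y t s z
  assume x: "x \<in> {x. \<forall>s\<in>S. \<forall>z. dist x (\<phi> s x) \<le> dist z (\<phi> s z)}"
    and y: "y \<in> {x. \<forall>s\<in>S. \<forall>z. dist x (\<phi> s x) \<le> dist z (\<phi> s z)}"
    and t: "0 \<le> t \<and> t \<le> (1::real)" and s: "s \<in> S"
  have "dist (gpt x y t) (\<phi> s (gpt x y t)) \<le> (1-t) * dist x (\<phi> s x) + t * dist y (\<phi> s y)"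
    using s assms t dist_gpt_convex[of t x y] by (auto simp: act_gpt)
  also have "\<dots> \<le> (1-t) * dist z (\<phi> s z) + t * dist z (\<phi> s z)"
    using x y s t by (intro add_mono mult_left_mono) auto
  finally show "dist (gpt x y t) (\<phi> s (gpt x y t)) \<le> dist z (\<phi> s z)" by (simp add: algebra_simps)
qed

lemma displacement_commute:
  assumes "s \<in> carrier G" "c \<in> carrier G" "c \<otimes> s = s \<otimes> c"
  shows "dist (\<phi> c x) (\<phi> s (\<phi> c x)) = dist x (\<phi> s x)"
  using assms by (metis act_mult dist_act)

lemma Minset_commute:
  assumes "S \<subseteq> carrier G" "c \<in> carrier G" "\<And>s. s \<in> S \<Longrightarrow> c \<otimes> s = s \<otimes> c" "x \<in> Minset S"
  shows "\<phi> c x \<in> Minset S"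
proof -
  have "dist (\<phi> c x) (\<phi> s (\<phi> c x)) = dist x (\<phi> s x)" if "s \<in> S" for s
    using assms that by (intro displacement_commute) auto
  then show ?thesis using assms(4) by (simp add: Minset_def)
qed

lemma continuous_displacement: "s \<in> carrier G \<Longrightarrow> continuous_on A (\<lambda>x. dist x (\<phi> s x))"
  by (intro continuous_intros continuous_act)

lemma closed_Minset:
  assumes "S \<subseteq> carrier G" shows "closed (Minset S)"
proof -
  have "Minset S = (\<Inter>s\<in>S. \<Inter>z. {x. dist x (\<phi> s x) \<le> dist z (\<phi> s z)})" by (auto simp: Minset_def)
  also have "closed \<dots>"
    using assms continuous_displacement by (intro closed_INT ballI closed_Collect_le) auto
  finally show ?thesis .
qed

text \<open>The centralizer of \<open>insert b S\<close> preserves \<open>Minset S\<close> and the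
  displacement of \<open>b\<close> and acts cocompactly, so this displacement attains its minimum on
  \<open>Minset S\<close>. By \<open>displacement_inf_le\<close> the minimum is global.\<close>

lemma Minset_nonempty:
  assumes "finite S" "S \<subseteq> GX" "\<And>s t. s \<in> S \<Longrightarrow> t \<in> S \<Longrightarrow> s \<otimes> t = t \<otimes> s"
  shows "Minset S \<noteq> {}"
  using assms
proof (induction S rule: finite_induct)
  case empty
  then show ?case by (simp add: Minset_def)
next
  case (insert b S)
  let ?M = "Minset S"
  have car: "insert b S \<subseteq> carrier G" using insert.prems(1) coarse_kernel_carrier by blast
  have "?M \<noteq> {}" using insert by auto
  then obtain x where x: "x \<in> ?M" by blast
  obtain K where K: "compact K"
    "\<And>x. \<exists>c\<in>carrier G. (\<forall>s\<in>insert b S. c \<otimes> s = s \<otimes> c) \<and> (\<exists>k\<in>K. x = \<phi> c k)"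
    using centralizer_cocompact[of "insert b S"] insert.prems(1) insert.hyps(1) by (metis finite_insert)
  have red: "\<exists>k\<in>K \<inter> ?M. dist k (\<phi> b k) = dist y (\<phi> b y)" if y: "y \<in> ?M" for y
  proof -
    obtain c k where c: "c \<in> carrier G" "\<forall>s\<in>insert b S. c \<otimes> s = s \<otimes> c" "k \<in> K" "y = \<phi> c k"
      using K(2) by blast
    then have "inv c \<otimes> s = s \<otimes> inv c" if "s \<in> S" for s using inv_commute that car by auto
    then have "\<phi> (inv c) y \<in> ?M" using y c car by (intro Minset_commute) auto
    then have "k \<in> ?M" using c by simp
    then show ?thesis using c displacement_commute[of b c k] car by auto
  qed
  have "compact (K \<inter> ?M)" using K closed_Minset[of S] car by (auto intro: compact_Int_closed)
  moreover have "K \<inter> ?M \<noteq> {}" using red[OF x] by blast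
  ultimately obtain x0 where x0: "x0 \<in> K \<inter> ?M" "\<And>y. y \<in> K \<inter> ?M \<Longrightarrow> dist x0 (\<phi> b x0) \<le> dist y (\<phi> b y)"
    using continuous_attains_inf[of "K \<inter> ?M" "\<lambda>x. dist x (\<phi> b x)"] continuous_displacement[of b] car by auto
  have x0': "dist x0 (\<phi> b x0) \<le> dist y (\<phi> b y)" if "y \<in> ?M" for y using red[OF that] x0(2) by metis
  have "dist x0 (\<phi> b x0) \<le> dist z (\<phi> b z)" for z
  proof (rule field_le_epsilon)
    fix e :: real assume e: "0 < e"
    have bM: "\<phi> b x \<in> ?M" if "x \<in> ?M" for x using that car insert.prems(2) by (intro Minset_commute) auto
    obtain y where "y \<in> ?M" "dist y (\<phi> b y) \<le> dist z (\<phi> b z) + e"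
      using displacement_inf_le[OF gconvex_Minset _ bM x e, of z] car by auto
    then show "dist x0 (\<phi> b x0) \<le> dist z (\<phi> b z) + e" using x0'[of y] by linarith
  qed
  then have "x0 \<in> Minset (insert b S)" using x0(1) by (auto simp: Minset_def)
  then show ?case by blast
qed

subsection \<open>Translation lengths\<close>

definition tlen :: "'g \<Rightarrow> real" where
  "tlen g = (INF x. dist x (\<phi> g x))"

lemma tlen_le: "tlen g \<le> dist x (\<phi> g x)"
  unfolding tlen_def by (rule cINF_lower) (auto intro: bdd_belowI[of _ 0])

lemma tlen_greatest: "(\<And>x. c \<le> dist x (\<phi> g x)) \<Longrightarrow> c \<le> tlen g"
  unfolding tlen_def by (rule cINF_greatest) auto

lemma tlen_nonneg: "0 \<le> tlen g"
  by (rule tlen_greatest) simp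

lemma Minset_tlen: "x \<in> Minset S \<Longrightarrow> s \<in> S \<Longrightarrow> dist x (\<phi> s x) = tlen s"
  unfolding Minset_def by (intro antisym tlen_le tlen_greatest) auto

lemma Minset_antimono: "x \<in> Minset S \<Longrightarrow> T \<subseteq> S \<Longrightarrow> x \<in> Minset T"
  by (auto simp: Minset_def)

lemma pow2_tlen_le:
  assumes "b \<in> carrier G" shows "2^j * tlen b \<le> dist x (\<phi> (b [^] (2^j::nat)) x)"
proof -
  obtain y where "2^j * dist y (\<phi> b y) \<le> dist x (\<phi> (b [^] (2^j::nat)) x)"
    using displacement_halving[of UNIV b x j] assms by (auto simp: gconvex_def)
  moreover have "2^j * tlen b \<le> 2^j * dist y (\<phi> b y)" using tlen_le[of b y] by simp
  ultimately show ?thesis by linarith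
qed

text \<open>The orbit of a minimal point runs along a geodesic. The lower bound holds for
  \<open>2^n\<close>, a power of two above \<open>n\<close>, and passes to \<open>n\<close> because
  the remaining \<open>2^n - n\<close> steps cover at most their own length.\<close>

lemma dist_nat_pow:
  assumes b: "b \<in> carrier G" and x: "x \<in> Minset {b}"
  shows "dist x (\<phi> (b [^] (n::nat)) x) = real n * tlen b"
proof (rule antisym)
  have up: "dist x (\<phi> (b [^] (n::nat)) x) \<le> real n * tlen b" for n
    using displacement_pow_le[OF b, of x n] Minset_tlen[OF x] by simp
  then show "dist x (\<phi> (b [^] n) x) \<le> real n * tlen b" .
  have n: "n \<le> 2^n" by (rule less_imp_le[OF less_exp])
  have "2^n * tlen b \<le> dist x (\<phi> (b [^] (2^n::nat)) x)" by (rule pow2_tlen_le[OF b])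
  also have "\<dots> \<le> dist x (\<phi> (b [^] n) x) + dist (\<phi> (b [^] n) x) (\<phi> (b [^] (2^n::nat)) x)" by (rule dist_triangle)
  also have "b [^] (2^n::nat) = b [^] n \<otimes> b [^] (2^n - n)" using n b by (simp add: nat_pow_mult)
  also have "dist (\<phi> (b [^] n) x) (\<phi> (b [^] n \<otimes> b [^] (2^n - n)) x) = dist x (\<phi> (b [^] (2^n - n)) x)"
    using b by (simp add: act_mult)
  also have "\<dots> \<le> real (2^n - n) * tlen b" by (rule up)
  also have "real (2^n - n) = 2^n - real n" using n by (simp add: of_nat_diff)
  finally show "real n * tlen b \<le> dist x (\<phi> (b [^] n) x)" by (simp add: algebra_simps)
qed

lemma displacement_inv: "g \<in> carrier G \<Longrightarrow> dist x (\<phi> (inv g) x) = dist x (\<phi> g x)"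
  using dist_act_inv[of g x x] by (simp add: dist_commute)

lemma dist_int_pow:
  assumes b: "b \<in> carrier G" and x: "x \<in> Minset {b}"
  shows "dist (\<phi> (b [^] (i::int)) x) (\<phi> (b [^] (j::int)) x) = \<bar>real_of_int (i - j)\<bar> * tlen b"
proof -
  have 1: "dist x (\<phi> (b [^] (k::int)) x) = \<bar>real_of_int k\<bar> * tlen b" for k
  proof (cases k rule: int_cases2)
    case (nonneg n) then show ?thesis using dist_nat_pow[OF b x, of n] by (simp add: int_pow_int)
  next
    case (nonpos n) then show ?thesis using dist_nat_pow[OF b x, of n] b by (simp add: int_pow_neg_int displacement_inv)
  qed
  have "b [^] j = b [^] i \<otimes> b [^] (j - i)" using b by (simp flip: int_pow_mult)
  then have "dist (\<phi> (b [^] i) x) (\<phi> (b [^] j) x) = dist x (\<phi> (b [^] (j - i)) x)"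
    using b by (simp add: act_mult)
  then show ?thesis using 1[of "j - i"] by (simp add: abs_minus_commute)
qed

lemma coarse_kernel_nat_pow: "g \<in> GX \<Longrightarrow> g [^] (n::nat) \<in> GX"
  by (induction n) (simp_all add: subgroup.one_closed[OF subgroup_coarse_kernel] subgroup.m_closed[OF subgroup_coarse_kernel])

lemma coarse_kernel_int_pow: "g \<in> GX \<Longrightarrow> g [^] (n::int) \<in> GX"
  unfolding int_pow_def2
  by (cases "n < 0") (simp_all only: if_True if_False not_False_eq_True coarse_kernel_nat_pow subgroup.m_inv_closed[OF subgroup_coarse_kernel])

text \<open>Evaluation at a common minimal point of \<open>g\<close> and its power.\<close>

lemma tlen_nat_pow:
  assumes g: "g \<in> GX" shows "tlen (g [^] (n::nat)) = real n * tlen g"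
proof -
  have gc: "g \<in> carrier G" by (rule coarse_kernel_carrier[OF g])
  have "g \<otimes> g [^] n = g [^] n \<otimes> g" using group_commutes_pow[of g g n] gc by simp
  then have "Minset {g, g [^] n} \<noteq> {}"
    using g coarse_kernel_nat_pow[OF g] by (intro Minset_nonempty) auto
  then obtain x where x: "x \<in> Minset {g, g [^] n}" by blast
  then have "x \<in> Minset {g}" by (rule Minset_antimono) auto
  then show ?thesis using dist_nat_pow[OF gc, of x n] Minset_tlen[OF x, of "g [^] n"] by simp
qed

lemma tlen_inv: "g \<in> carrier G \<Longrightarrow> tlen (inv g) = tlen g"
  by (simp add: tlen_def displacement_inv)

lemma tlen_int_pow:
  assumes g: "g \<in> GX" shows "tlen (g [^] (k::int)) = \<bar>real_of_int k\<bar> * tlen g"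
  using tlen_nat_pow[OF g] coarse_kernel_carrier[OF g]
  by (cases k rule: int_cases2) (simp_all add: int_pow_int int_pow_neg_int tlen_inv)

lemma Minset_pair:
  assumes "a \<in> GX" "b \<in> GX" "a \<otimes> b = b \<otimes> a"
  shows "\<exists>x. dist x (\<phi> a x) = tlen a \<and> dist x (\<phi> b x) = tlen b"
proof -
  have "Minset {a, b} \<noteq> {}" using assms by (intro Minset_nonempty) auto
  then show ?thesis using Minset_tlen by blast
qed

lemma tlen_mult_le:
  assumes "a \<in> GX" "b \<in> GX" "a \<otimes> b = b \<otimes> a"
  shows "tlen (a \<otimes> b) \<le> tlen a + tlen b"
proof -
  obtain x where x: "dist x (\<phi> a x) = tlen a" "dist x (\<phi> b x) = tlen b" using Minset_pair[OF assms] by blast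
  have "tlen (a \<otimes> b) \<le> dist x (\<phi> (a \<otimes> b) x)" by (rule tlen_le)
  also have "\<dots> \<le> dist x (\<phi> a x) + dist (\<phi> a x) (\<phi> a (\<phi> b x))"
    using act_mult[of a b x] assms dist_triangle by (metis coarse_kernel_carrier)
  finally show ?thesis using x assms by (simp add: coarse_kernel_carrier)
qed

text \<open>At a common minimal point \<open>x\<close>, the points \<open>x\<close>,
  \<open>\<phi> a x\<close>, \<open>\<phi> (a \<otimes> b) x\<close>, \<open>\<phi> b x\<close> form
  a quadrilateral with sides \<open>tlen a\<close> and \<open>tlen b\<close>, whose diagonals
  dominate the two translation lengths on the left.\<close>

lemma tlen_parallelogram:
  assumes "a \<in> GX" "b \<in> GX" "a \<otimes> b = b \<otimes> a"
  shows "(tlen (a \<otimes> b))\<^sup>2 + (tlen (inv a \<otimes> b))\<^sup>2 \<le> 2 * (tlen a)\<^sup>2 + 2 * (tlen b)\<^sup>2"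
proof -
  obtain x where x: "dist x (\<phi> a x) = tlen a" "dist x (\<phi> b x) = tlen b" using Minset_pair[OF assms] by blast
  have c: "a \<in> carrier G" "b \<in> carrier G" using assms coarse_kernel_carrier by auto
  have ab: "\<phi> (a \<otimes> b) x = \<phi> a (\<phi> b x)" "\<phi> (a \<otimes> b) x = \<phi> b (\<phi> a x)" using c assms(3) by (simp_all flip: act_mult)
  have "tlen (inv a \<otimes> b) \<le> dist (\<phi> a x) (\<phi> b x)"
    using tlen_le[of "inv a \<otimes> b" x] c dist_act[of a x "\<phi> (inv a \<otimes> b) x"] by (simp add: act_mult)
  moreover have "tlen (a \<otimes> b) \<le> dist x (\<phi> (a \<otimes> b) x)" by (rule tlen_le)
  ultimately have "(tlen (a \<otimes> b))\<^sup>2 + (tlen (inv a \<otimes> b))\<^sup>2 \<le> (dist x (\<phi> (a \<otimes> b) x))\<^sup>2 + (dist (\<phi> a x) (\<phi> b x))\<^sup>2"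
    by (intro add_mono power_mono tlen_nonneg)
  also have "\<dots> \<le> (dist x (\<phi> a x))\<^sup>2 + (dist (\<phi> a x) (\<phi> (a \<otimes> b) x))\<^sup>2 + (dist (\<phi> (a \<otimes> b) x) (\<phi> b x))\<^sup>2 + (dist (\<phi> b x) x)\<^sup>2"
    by (rule quadrilateral)
  also have "dist (\<phi> a x) (\<phi> (a \<otimes> b) x) = tlen b" unfolding ab(1) using x c by simp
  also have "dist (\<phi> (a \<otimes> b) x) (\<phi> b x) = tlen a" unfolding ab(2) using x c by (simp add: dist_commute)
  finally show ?thesis using x by (simp add: dist_commute)
qed

text \<open>Up to conjugation the displacement is attained in a fixed compact set, and elements of the
  coarse kernel have finite conjugacy classes.\<close>

lemma finite_tlen_le: "finite {g \<in> GX. tlen g \<le> R}"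
proof -
  obtain K where K: "compact K" "\<And>x. \<exists>g\<in>carrier G. \<exists>k\<in>K. x = \<phi> g k"
    using cocompact by metis
  obtain C where C: "\<And>x y. x \<in> K \<Longrightarrow> y \<in> K \<Longrightarrow> dist x y \<le> C"
    using compact_imp_bounded[OF K(1)] unfolding bounded_two_points by blast
  obtain k0 where k0: "k0 \<in> K" using K(2) by blast
  let ?F = "{u \<in> carrier G. dist k0 (\<phi> u k0) \<le> R + 2 * C} \<inter> GX"
  have "{g \<in> GX. tlen g \<le> R} \<subseteq> (\<Union>u\<in>?F. conjugates u)"
  proof
    fix g assume "g \<in> {g \<in> GX. tlen g \<le> R}"
    then have g: "g \<in> GX" "tlen g \<le> R" "g \<in> carrier G" using coarse_kernel_carrier by auto
    have "Minset {g} \<noteq> {}" using g by (intro Minset_nonempty) auto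
    then obtain x where x: "dist x (\<phi> g x) = tlen g" using Minset_tlen by blast
    obtain h k where h: "h \<in> carrier G" "k \<in> K" "x = \<phi> h k" using K(2) by blast
    define u where "u = inv h \<otimes> g \<otimes> h"
    have u: "u \<in> carrier G" "u \<in> GX" using g h by (auto simp: u_def coarse_kernel_conj)
    have "dist k (\<phi> u k) \<le> R" using x g h act_conj[of g h k] by (simp add: u_def)
    then have "dist k0 (\<phi> u k0) \<le> R + 2 * C"
      using dist_triangle[of k0 "\<phi> u k0" k] dist_triangle[of k "\<phi> u k0" "\<phi> u k"] C[OF k0 h(2)] C[OF h(2) k0] u by simp
    moreover have "g = inv (inv h) \<otimes> u \<otimes> inv h"
      using g h by (simp add: u_def m_assoc) (simp flip: m_assoc)
    then have "g \<in> conjugates u" using h unfolding conjugates_def by blast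
    ultimately show "g \<in> (\<Union>u\<in>?F. conjugates u)" using u by blast
  qed
  moreover have "finite (\<Union>u\<in>?F. conjugates u)"
    using finite_displacement[of k0 "R + 2 * C"] finite_conjugates by (intro finite_UN_I) auto
  ultimately show ?thesis by (rule finite_subset)
qed

text \<open>All powers of \<open>g\<close> have translation length 0, so only finitely many of them
  are distinct.\<close>

lemma tlen_eq_0_torsion:
  assumes g: "g \<in> GX" and "tlen g = 0" shows "\<exists>k::nat. k \<ge> 1 \<and> g [^] k = \<one>"
proof -
  have "range (\<lambda>n::nat. g [^] n) \<subseteq> {g \<in> GX. tlen g \<le> 0}"
    using tlen_nat_pow[OF g] coarse_kernel_nat_pow[OF g] assms(2) by auto
  then have "finite (range (\<lambda>n::nat. g [^] n))" using finite_tlen_le finite_subset by blast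
  then have "\<not> inj (\<lambda>n::nat. g [^] n)" using finite_imageD[of "\<lambda>n::nat. g [^] n" UNIV] infinite_UNIV_nat by blast
  then obtain m n :: nat where mn: "g [^] m = g [^] n" "m \<noteq> n" unfolding inj_def by blast
  then show ?thesis using pow_eq_div2[OF coarse_kernel_carrier[OF g], of m n] pow_eq_div2[OF coarse_kernel_carrier[OF g], of n m]
mn
    by (intro exI[of _ "if m < n then n - m else m - n"]) auto
qed

subsection \<open>Packing\<close>

text \<open>The hypothesis \<open>e\<close> says that the comparison angle at \<open>x\<close> is at
  most 120 degrees. Euclidean points at distance \<open>r\<close> on such sides are at most
  \<open>sqrt 3 * r\<close> apart; \<open>CN\<close> along each side in turn carries this
  over.\<close>

lemma opposite_rays_dist:
  assumes t: "0 < r" "r \<le> dist x u" "r \<le> dist x v" and e: "(dist u v)\<^sup>2 \<le> (dist x u)\<^sup>2 + (dist x v)\<^sup>2 + dist x u * dist x v"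
  shows "(dist (gpt x u (r / dist x u)) (gpt x v (r / dist x v)))\<^sup>2 \<le> 3 * r\<^sup>2"
proof -
  define a b where "a = dist x u" and "b = dist x v"
  have ab: "0 < a" "0 < b" "r \<le> a" "r \<le> b" using t by (auto simp: a_def b_def)
  let ?p = "gpt x u (r / a)"
  have f: "0 \<le> r / a" "r / a \<le> 1" "0 \<le> r / b" "r / b \<le> 1" using ab t by auto
  have px: "dist ?p x = r" using dist_gpt_left[OF f(1,2), of x u] ab by (simp add: dist_commute a_def)
  have "(dist v ?p)\<^sup>2 \<le> (1 - r/a) * b\<^sup>2 + r/a * (dist u v)\<^sup>2 - r/a * (1 - r/a) * a\<^sup>2"
    using CN[OF f(1,2), of v x u] by (simp add: dist_commute a_def b_def)
  also have "\<dots> \<le> (1 - r/a) * b\<^sup>2 + r/a * (a\<^sup>2 + b\<^sup>2 + a * b) - r/a * (1 - r/a) * a\<^sup>2"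
    using e f by (intro diff_right_mono add_left_mono mult_left_mono) (auto simp: a_def b_def)
  also have "\<dots> = b\<^sup>2 + r * b + r\<^sup>2" using ab by (simp add: field_simps power2_eq_square)
  finally have pv: "(dist ?p v)\<^sup>2 \<le> b\<^sup>2 + r * b + r\<^sup>2" by (simp add: dist_commute)
  have "(dist ?p (gpt x v (r/b)))\<^sup>2 \<le> (1 - r/b) * (dist ?p x)\<^sup>2 + r/b * (dist ?p v)\<^sup>2 - r/b * (1 - r/b) * b\<^sup>2"
    using CN[OF f(3,4), of ?p x v] by (simp add: b_def)
  also have "\<dots> \<le> (1 - r/b) * r\<^sup>2 + r/b * (b\<^sup>2 + r * b + r\<^sup>2) - r/b * (1 - r/b) * b\<^sup>2"
    unfolding px using pv f by (intro diff_right_mono add_left_mono mult_left_mono) auto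
  also have "\<dots> = 3 * r\<^sup>2" using ab by (simp add: field_simps power2_eq_square)
  finally show ?thesis by (simp add: a_def b_def)
qed

text \<open>From a common minimal point \<open>x\<close>, walk the distance \<open>r\<close> towards
  every \<open>\<phi> (a i) x\<close>. The bound on \<open>a i \<otimes> a j\<close> makes the angle
  between \<open>a j\<close> and the inverse of \<open>a i\<close> at most 120 degrees, hence the
  angle between \<open>a i\<close> and \<open>a j\<close> at least 60.\<close>

lemma packing_points:
  fixes a :: "nat \<Rightarrow> 'g"
  assumes a: "\<And>i. i < n \<Longrightarrow> a i \<in> GX" and comm: "\<And>i j. i < n \<Longrightarrow> j < n \<Longrightarrow> a i \<otimes> a j = a j \<otimes> a i"
    and r: "0 < r" "\<And>i. i < n \<Longrightarrow> r \<le> tlen (a i)"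
    and mono: "\<And>i j. i < j \<Longrightarrow> j < n \<Longrightarrow> tlen (a i) \<le> tlen (a j)"
    and obtuse: "\<And>i j. i < j \<Longrightarrow> j < n \<Longrightarrow> (tlen (a i \<otimes> a j))\<^sup>2 \<le> 2 * (tlen (a i))\<^sup>2 + (tlen (a j))\<^sup>2"
  shows "\<exists>x (p :: nat \<Rightarrow> 'a). (\<forall>i<n. dist x (p i) \<le> r) \<and> (\<forall>i j. i < j \<longrightarrow> j < n \<longrightarrow> r \<le> dist (p i) (p j))"
proof -
  \<comment> \<open>The products are included so that the same \<open>x\<close> also realizes their
    translation lengths.\<close>
  define S where "S = a ` {..<n} \<union> (\<lambda>(i,j). a i \<otimes> a j) ` ({..<n} \<times> {..<n})"
  have ac: "a i \<in> carrier G" if "i < n" for i using a[OF that] by (rule coarse_kernel_carrier)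
  have SG: "S \<subseteq> GX" unfolding S_def using a subgroup.m_closed[OF subgroup_coarse_kernel] by auto
  have Sc: "s \<otimes> a i = a i \<otimes> s" if "s \<in> S" "i < n" for s i
  proof -
    have "a j \<otimes> a k \<otimes> a i = a i \<otimes> (a j \<otimes> a k)" if "j < n" "k < n" for j k
    proof -
      have "a j \<otimes> a k \<otimes> a i = a j \<otimes> (a i \<otimes> a k)" using comm[of k i] that \<open>i < n\<close> ac by (simp add: m_assoc)
      also have "\<dots> = a i \<otimes> a j \<otimes> a k" using comm[of j i] that \<open>i < n\<close> ac by (simp flip: m_assoc)
      finally show ?thesis using that \<open>i < n\<close> ac by (simp add: m_assoc)
    qed
    then show ?thesis using that comm by (auto simp: S_def)
  qed
  have "s \<otimes> t = t \<otimes> s" if "s \<in> S" "t \<in> S" for s t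
  proof -
    have "s \<otimes> (a i \<otimes> a j) = (a i \<otimes> a j) \<otimes> s" if "i < n" "j < n" for i j
    proof -
      have s: "s \<in> carrier G" using SG \<open>s \<in> S\<close> coarse_kernel_carrier by blast
      have "s \<otimes> (a i \<otimes> a j) = a i \<otimes> s \<otimes> a j" using Sc[OF \<open>s \<in> S\<close>, of i] that ac s by (simp flip: m_assoc)
      also have "\<dots> = a i \<otimes> (a j \<otimes> s)" using Sc[OF \<open>s \<in> S\<close>, of j] that ac s by (simp add: m_assoc)
      finally show ?thesis using that ac s by (simp add: m_assoc)
    qed
    then show ?thesis using that(2) Sc[OF that(1)] by (auto simp: S_def)
  qed
  moreover have "finite S" by (simp add: S_def)
  ultimately have "Minset S \<noteq> {}" using SG by (intro Minset_nonempty)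
  then obtain x where x: "x \<in> Minset S" by blast
  define t where "t i = tlen (a i)" for i
  have d: "dist x (\<phi> (a i) x) = t i" "dist x (\<phi> (inv (a i)) x) = t i" if "i < n" for i
    using Minset_tlen[OF x, of "a i"] that ac by (auto simp: S_def t_def displacement_inv)
  have dd: "dist x (\<phi> (a i \<otimes> a j) x) = tlen (a i \<otimes> a j)" if "i < n" "j < n" for i j
  proof (rule Minset_tlen[OF x])
    show "a i \<otimes> a j \<in> S" unfolding S_def using that by (intro UnI2 image_eqI[of _ _ "(i, j)"]) auto
  qed
  define p q where "p i = gpt x (\<phi> (a i) x) (r / t i)" and "q i = gpt x (\<phi> (inv (a i)) x) (r / t i)" for i
  have t: "0 < t i" "r \<le> t i" "0 \<le> r / t i" "r / t i \<le> 1" if "i < n" for i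
    using r(1) r(2)[OF that] by (auto simp: t_def)
  have pr: "dist x (p i) = r" "dist x (q i) = r" if "i < n" for i
    using dist_gpt_left[OF t(3,4)[OF that], of x] d[OF that] t(1)[OF that] by (auto simp: p_def q_def)
  have pu: "dist (p i) (\<phi> (a i) x) = t i - r" "dist (q i) (\<phi> (inv (a i)) x) = t i - r" if "i < n" for i
    using dist_gpt_right[OF t(3,4)[OF that], of x] d[OF that] t(1)[OF that] by (auto simp: p_def q_def left_diff_distrib)
  \<comment> \<open>The orbit of \<open>x\<close> under \<open>a i\<close> is geodesic, so the
    directions to \<open>p i\<close> and \<open>q i\<close> are opposite.\<close>
  have opp: "x = gpt (q i) (p i) (1/2)" if i: "i < n" for i
  proof -
    have "x \<in> Minset {a i}" using i by (intro Minset_antimono[OF x]) (auto simp: S_def)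
    then have "dist x (\<phi> (a i [^] (2::nat)) x) = 2 * t i" using dist_nat_pow[OF ac[OF i], of x 2] by (simp add: t_def)
    moreover have "dist x (\<phi> (a i [^] (2::nat)) x) = dist (\<phi> (inv (a i)) x) (\<phi> (a i) x)"
      using ac[OF i] by (simp add: dist_act_inv numeral_2_eq_2 act_mult)
    moreover have "dist (\<phi> (inv (a i)) x) (\<phi> (a i) x) \<le> dist (\<phi> (inv (a i)) x) (q i) + dist (q i) (p i) + dist (p i) (\<phi> (a i) x)"
      using dist_triangle[of "\<phi> (inv (a i)) x" "\<phi> (a i) x" "q i"] dist_triangle[of "q i" "\<phi> (a i) x" "p i"] by linarith
    ultimately have "2 * r \<le> dist (q i) (p i)" using pu[OF i] by (simp add: dist_commute)
    moreover have "dist (q i) (p i) \<le> 2 * r" using dist_triangle[of "q i" "p i" x] pr[OF i] by (simp add: dist_commute)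
    ultimately have "dist (q i) (p i) = 2 * r" by simp
    then show ?thesis using pr[OF i] by (intro gpt_unique) (auto simp: dist_commute)
  qed
  have "r \<le> dist (p i) (p j)" if ij: "i < j" "j < n" for i j
  proof -
    have i: "i < n" using ij by simp
    have "dist (\<phi> (inv (a i)) x) (\<phi> (a j) x) = tlen (a i \<otimes> a j)"
      using dd[OF i ij(2)] ac i ij by (simp add: dist_act_inv act_mult)
    \<comment> \<open>Monotonicity replaces one \<open>(t i)\<^sup>2\<close> by
      \<open>t i * t j\<close>, which gives the 120 degree form of the bound.\<close>
    moreover have "t i * t i \<le> t i * t j" using mono[OF ij] t(1)[OF i] by (intro mult_left_mono) (auto simp: t_def)
    ultimately have "(dist (\<phi> (inv (a i)) x) (\<phi> (a j) x))\<^sup>2 \<le> (t i)\<^sup>2 + (t j)\<^sup>2 + t i * t j"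
      using obtuse[OF ij] by (simp add: t_def power2_eq_square)
    then have qp: "(dist (q i) (p j))\<^sup>2 \<le> 3 * r\<^sup>2"
      using opposite_rays_dist[of r x "\<phi> (inv (a i)) x" "\<phi> (a j) x"] r(1) t[OF i] t[OF ij(2)] d[OF i] d[OF ij(2)]
      by (simp add: p_def q_def)
    have "dist (q i) (p i) = 2 * r"
      using dist_gpt_left[of "1/2" "q i" "p i"] opp[OF i] pr[OF i] by (simp add: dist_commute)
    \<comment> \<open>\<open>CN\<close> at the midpoint \<open>x\<close> of \<open>q i\<close> and
      \<open>p i\<close>, with \<open>p j\<close> as apex: since \<open>q i\<close> is not far from
      \<open>p j\<close>, the opposite point \<open>p i\<close> cannot be close to it.\<close>
    then have "(dist (p j) x)\<^sup>2 \<le> (1/2) * (dist (p j) (q i))\<^sup>2 + (1/2) * (dist (p j) (p i))\<^sup>2 - r\<^sup>2"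
      using CN[of "1/2" "p j" "q i" "p i"] opp[OF i] by (simp add: power2_eq_square)
    then have "r\<^sup>2 \<le> (dist (p i) (p j))\<^sup>2" using qp pr[OF ij(2)] by (simp add: dist_commute)
    then show ?thesis using r(1) by (simp add: power2_le_iff_abs_le abs_le_square_iff[symmetric])
  qed
  then show ?thesis using pr by (intro exI[of _ x] exI[of _ p]) auto
qed

text \<open>The centre is translated into \<open>K\<close>. All \<open>r\<close>-balls about points
  of \<open>K\<close> lie in finitely many translates of \<open>K\<close>, and a ball of radius
  \<open>r/2\<close> contains at most one of the points.\<close>

lemma packing_bound:
  assumes r: "0 < r"
  shows "\<exists>N. \<forall>n x (p :: nat \<Rightarrow> 'a). (\<forall>i<n. dist x (p i) \<le> r) \<and> (\<forall>i j. i < j \<longrightarrow> j < n \<longrightarrow> r \<le> dist (p i) (p j)) \<longrightarrow> n \<le> N"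
proof -
  obtain K where K: "compact K" "\<And>x. \<exists>g\<in>carrier G. \<exists>k\<in>K. x = \<phi> g k"
    using cocompact by metis
  obtain C where C: "\<And>x y. x \<in> K \<Longrightarrow> y \<in> K \<Longrightarrow> dist x y \<le> C"
    using compact_imp_bounded[OF K(1)] unfolding bounded_two_points by blast
  obtain k0 where k0: "k0 \<in> K" using K(2) by blast
  let ?F = "{u \<in> carrier G. dist k0 (\<phi> u k0) \<le> r + 2 * C}"
  let ?B = "\<Union>u\<in>?F. \<phi> u ` K"
  have B: "y \<in> ?B" if y: "k \<in> K" "dist k y \<le> r" for k y
  proof -
    obtain h k' where h: "h \<in> carrier G" "k' \<in> K" "y = \<phi> h k'" using K(2) by blast
    have "dist k0 (\<phi> h k0) \<le> dist k0 k + dist k y + dist y (\<phi> h k0)"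
      using dist_triangle[of k0 "\<phi> h k0" k] dist_triangle[of k "\<phi> h k0" y] by linarith
    also have "\<dots> \<le> r + 2 * C" using y h C[OF k0 y(1)] C[OF h(2) k0] by simp
    finally show ?thesis using h by blast
  qed
  have "compact ?B"
    using finite_displacement K(1) by (intro compact_UN) (auto intro!: compact_continuous_image continuous_act)
  then obtain T where T: "finite T" "?B \<subseteq> (\<Union>x\<in>T. ball x (r/2))"
    using half_gt_zero[OF r] unfolding compact_eq_totally_bounded by blast
  have "n \<le> card T" if p: "\<forall>i<n. dist x (p i) \<le> r" "\<forall>i j. i < j \<longrightarrow> j < n \<longrightarrow> r \<le> dist (p i) (p j)"
    for n x and p :: "nat \<Rightarrow> 'a"
  proof -
    obtain g k where g: "g \<in> carrier G" "k \<in> K" "x = \<phi> g k" using K(2) by blast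
    have "\<exists>c\<in>T. dist c (\<phi> (inv g) (p i)) < r/2" if "i < n" for i
    proof -
      have "dist k (\<phi> (inv g) (p i)) = dist x (p i)"
        using dist_act_inv[OF g(1), of "p i" k] g(3) by (simp add: dist_commute)
      then have "\<phi> (inv g) (p i) \<in> ?B" using p that g by (intro B[of k]) auto
      then show ?thesis using T(2) by fastforce
    qed
    then obtain c where c: "\<And>i. i < n \<Longrightarrow> c i \<in> T \<and> dist (c i) (\<phi> (inv g) (p i)) < r/2" by metis
    have sep: "c i \<noteq> c j" if ij: "i < j" "j < n" for i j
    proof
      assume e: "c i = c j"
      have "dist (p i) (p j) = dist (\<phi> (inv g) (p i)) (\<phi> (inv g) (p j))" using g by simp
      also have "\<dots> < r" using c[of i] c[of j] ij e
          dist_triangle3[of "\<phi> (inv g) (p i)" "\<phi> (inv g) (p j)" "c i"] by simp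
      finally show False using p(2) ij by force
    qed
    then have "inj_on c {..<n}" by (intro inj_onI) (metis lessThan_iff nat_neq_iff)
    then have "card {..<n} \<le> card T" using c T(1) by (intro card_inj_on_le[of c]) auto
    then show ?thesis by simp
  qed
  then show ?thesis by blast
qed

end

subsection \<open>Products of powers of commuting elements\<close>

context group
begin

text \<open>Exponent vectors are functions on all naturals of which only the values below
  \<open>n\<close> count; for commuting elements the range is then the subgroup generated by
  \<open>a 0\<close>, ..., \<open>a (n - 1)\<close>.\<close>

primrec zprod :: "(nat \<Rightarrow> 'a) \<Rightarrow> nat \<Rightarrow> (nat \<Rightarrow> int) \<Rightarrow> 'a" where
  "zprod a 0 f = \<one>"
| "zprod a (Suc n) f = zprod a n f \<otimes> a n [^] f n"

definition commuting :: "(nat \<Rightarrow> 'a) \<Rightarrow> nat \<Rightarrow> bool" where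
  "commuting a n \<longleftrightarrow> (\<forall>i<n. a i \<in> carrier G) \<and> (\<forall>i<n. \<forall>j<n. a i \<otimes> a j = a j \<otimes> a i)"

lemma commuting_le: "commuting a n \<Longrightarrow> m \<le> n \<Longrightarrow> commuting a m"
  by (auto simp: commuting_def)

lemma zprod_closed: "commuting a n \<Longrightarrow> zprod a n f \<in> carrier G"
  by (induction n) (auto simp: commuting_def)

lemma int_pow_commute:
  assumes "c \<in> carrier G" "x \<in> carrier G" "c \<otimes> x = x \<otimes> c"
  shows "c \<otimes> x [^] (k::int) = x [^] k \<otimes> c"
proof -
  have n: "x [^] (n::nat) \<otimes> c = c \<otimes> x [^] n" for n
    using assms by (intro group_commutes_pow) auto
  then have "inv (x [^] n) \<otimes> c = c \<otimes> inv (x [^] n)" for n :: nat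
    using assms by (intro inv_commute) auto
  with n assms show ?thesis by (cases k rule: int_cases2) (simp_all add: int_pow_int int_pow_neg_int)
qed

lemma zprod_commute:
  assumes "commuting a n" "c \<in> carrier G" "\<And>i. i < n \<Longrightarrow> c \<otimes> a i = a i \<otimes> c"
  shows "c \<otimes> zprod a n f = zprod a n f \<otimes> c"
  using assms
proof (induction n)
  case (Suc n)
  have *: "zprod a n f \<in> carrier G" "a n \<in> carrier G"
    using Suc.prems zprod_closed[OF commuting_le] by (auto simp: commuting_def)
  have "c \<otimes> zprod a (Suc n) f = (c \<otimes> zprod a n f) \<otimes> a n [^] f n" using * Suc.prems by (simp add: m_assoc)
  also have "\<dots> = (zprod a n f \<otimes> c) \<otimes> a n [^] f n" using Suc commuting_le[OF Suc.prems(1), of n] by simp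
  also have "\<dots> = zprod a n f \<otimes> (c \<otimes> a n [^] f n)" using * Suc.prems by (simp add: m_assoc)
  also have "\<dots> = zprod a n f \<otimes> (a n [^] f n \<otimes> c)" using int_pow_commute[of c "a n"] * Suc.prems by simp
  finally show ?case using * Suc.prems by (simp add: m_assoc)
qed simp

lemma zprod_Suc_commute:
  assumes "commuting a (Suc n)" shows "zprod a n f \<otimes> a n [^] (k::int) = a n [^] k \<otimes> zprod a n f"
proof -
  have "a n [^] k \<otimes> a i = a i \<otimes> a n [^] k" if "i < n" for i
    using int_pow_commute[of "a i" "a n" k] assms that by (auto simp: commuting_def)
  then show ?thesis
    using zprod_commute[of a n "a n [^] k" f] assms commuting_le[OF assms, of n] by (auto simp: commuting_def)
qed

lemma zprod_add:
  assumes "commuting a n"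
  shows "zprod a n (\<lambda>i. f i + g i) = zprod a n f \<otimes> zprod a n g"
  using assms
proof (induction n)
  case (Suc n)
  have *: "zprod a n f \<in> carrier G" "zprod a n g \<in> carrier G" "a n \<in> carrier G"
    using Suc.prems zprod_closed[OF commuting_le] by (auto simp: commuting_def)
  have "zprod a (Suc n) (\<lambda>i. f i + g i) = zprod a n f \<otimes> (zprod a n g \<otimes> a n [^] f n) \<otimes> a n [^] g n"
    using Suc commuting_le[OF Suc.prems, of n] * by (simp add: int_pow_mult m_assoc)
  also have "\<dots> = zprod a n f \<otimes> (a n [^] f n \<otimes> zprod a n g) \<otimes> a n [^] g n"
    using zprod_Suc_commute[OF Suc.prems] by simp
  finally show ?case using * by (simp add: m_assoc)
qed simp

lemma zprod_cong: "(\<And>i. i < n \<Longrightarrow> f i = g i) \<Longrightarrow> (\<And>i. i < n \<Longrightarrow> a i = b i) \<Longrightarrow> zprod a n f = zprod b n g"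
  by (induction n) auto

lemma zprod_zero [simp]: "zprod a n (\<lambda>_. 0) = \<one>"
  by (induction n) auto

lemma zprod_uminus:
  assumes "commuting a n" shows "zprod a n (\<lambda>i. - f i) = inv (zprod a n f)"
proof -
  have "zprod a n (\<lambda>i. - f i) \<otimes> zprod a n f = \<one>" using zprod_add[OF assms, of "\<lambda>i. - f i" f] by simp
  then show ?thesis using zprod_closed[OF assms] by (metis inv_equality)
qed

lemma zprod_scale:
  assumes "commuting a n" shows "zprod a n (\<lambda>i. f i * k) = zprod a n f [^] k"
  using assms
proof (induction n)
  case (Suc n)
  have *: "zprod a n f \<in> carrier G" "a n \<in> carrier G"
    using Suc.prems zprod_closed[OF commuting_le] by (auto simp: commuting_def)
  have "(zprod a n f \<otimes> a n [^] f n) [^] k = zprod a n f [^] k \<otimes> (a n [^] f n) [^] k"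
    using zprod_Suc_commute[OF Suc.prems] * by (intro int_pow_mult_distrib) auto
  then show ?case using Suc commuting_le[OF Suc.prems, of n] * by (simp add: int_pow_pow)
qed simp

lemma zprod_restrict:
  assumes "commuting a n" "m \<le> n" shows "zprod a n (\<lambda>i. if i < m then f i else 0) = zprod a m f"
  using assms
proof (induction n)
  case (Suc n)
  show ?case
  proof (cases "m = Suc n")
    case True show ?thesis unfolding True by (rule zprod_cong) auto
  next
    case False
    then show ?thesis using Suc commuting_le[OF Suc.prems(1), of n] zprod_closed[of a n]
        zprod_closed[OF commuting_le[OF Suc.prems]]
      by simp
  qed
qed simp

lemma zprod_single:
  assumes "commuting a n" "i < n" shows "zprod a n (\<lambda>j. if j = i then k else 0) = a i [^] k"
proof -
  have "zprod a n (\<lambda>j. if j = i then k else 0) = zprod a n (\<lambda>j. if j < Suc i then (if j = i then k else 0) else 0)"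
    by (rule zprod_cong) auto
  also have "\<dots> = zprod a (Suc i) (\<lambda>j. if j = i then k else 0)" using assms by (intro zprod_restrict) auto
  also have "\<dots> = zprod a i (\<lambda>_. 0) \<otimes> a i [^] k"
    using zprod_cong[of i "\<lambda>j. if j = i then k else 0" "\<lambda>_. 0" a a] by simp
  finally show ?thesis using assms by (simp add: commuting_def)
qed

lemma subgroup_range_zprod:
  assumes "commuting a n" shows "subgroup (range (zprod a n)) G"
proof
  show "range (zprod a n) \<subseteq> carrier G" using zprod_closed[OF assms] by blast
  show "\<one> \<in> range (zprod a n)" using zprod_zero by (metis rangeI)
next
  fix x y assume "x \<in> range (zprod a n)" "y \<in> range (zprod a n)"
  then obtain f g where "x = zprod a n f" "y = zprod a n g" by blast
  then have "x \<otimes> y = zprod a n (\<lambda>i. f i + g i)" by (simp add: zprod_add[OF assms])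
  then show "x \<otimes> y \<in> range (zprod a n)" by blast
next
  fix x assume "x \<in> range (zprod a n)"
  then obtain f where "x = zprod a n f" by blast
  then have "inv x = zprod a n (\<lambda>i. - f i)" by (simp add: zprod_uminus[OF assms])
  then show "inv x \<in> range (zprod a n)" by blast
qed

lemma range_zprod_mono:
  assumes "commuting a n" "m \<le> n" shows "range (zprod a m) \<subseteq> range (zprod a n)"
proof
  fix x assume "x \<in> range (zprod a m)"
  then obtain f where "x = zprod a n (\<lambda>i. if i < m then f i else 0)" using zprod_restrict[OF assms] by auto
  then show "x \<in> range (zprod a n)" by blast
qed

lemma zprod_in_subgroup:
  assumes "subgroup H G" "\<And>i. i < n \<Longrightarrow> a i \<in> H" shows "zprod a n f \<in> H"
  using assms(2)
proof (induction n)
  case (Suc n)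
  have "a n [^] k \<in> H" for k :: int using subgroup_int_pow_closed[OF assms(1)] Suc.prems by simp
  then show ?case using Suc subgroup.m_closed[OF assms(1)] by simp
qed (simp add: subgroup.one_closed[OF assms(1)])

text \<open>A nonzero last exponent would put a positive power of the last element into the subgroup
  of its predecessors; so it vanishes, and induction does the rest.\<close>

lemma zprod_eq_one:
  assumes c: "commuting a n"
    and ind: "\<And>j k::nat. j < n \<Longrightarrow> k \<ge> 1 \<Longrightarrow> a j [^] k \<notin> range (zprod a j)"
    and 1: "zprod a n f = \<one>" and i: "i < n"
  shows "f i = 0"
  using assms
proof (induction n)
  case (Suc n)
  have c: "commuting a n" by (rule commuting_le[OF Suc.prems(1)]) simp
  have *: "zprod a n f \<in> carrier G" "a n \<in> carrier G"
    using Suc.prems zprod_closed[OF c] by (auto simp: commuting_def)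
  have e: "zprod a n f \<otimes> a n [^] f n = \<one>" using Suc.prems by simp
  have "f n = 0"
  proof (rule ccontr)
    assume "f n \<noteq> 0"
    then consider "f n > 0" | "f n < 0" by linarith
    then have "a n [^] nat \<bar>f n\<bar> \<in> range (zprod a n)"
    proof cases
      case 1
      have "a n [^] f n = inv (zprod a n f)" using e * by (metis int_pow_closed inv_comm inv_equality)
      then have "a n [^] nat \<bar>f n\<bar> = zprod a n (\<lambda>i. - f i)" using 1 c by (simp add: pow_nat zprod_uminus)
      then show ?thesis by simp
    next
      case 2
      have "zprod a n f = inv (a n [^] f n)" using e * by (metis int_pow_closed inv_equality)
      also have "\<dots> = a n [^] nat \<bar>f n\<bar>" using 2 * by (simp add: pow_nat int_pow_neg)
      finally show ?thesis by (metis rangeI)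
    qed
    moreover have "nat \<bar>f n\<bar> \<ge> 1" using \<open>f n \<noteq> 0\<close> by linarith
    ultimately show False using Suc.prems(2) by blast
  qed
  then show ?case using Suc c e * by (cases "i = n") auto
qed simp

lemma free_abelian_iso:
  assumes c: "commuting a n"
    and ind: "\<And>j k::nat. j < n \<Longrightarrow> k \<ge> 1 \<Longrightarrow> a j [^] k \<notin> range (zprod a j)"
  shows "G\<lparr>carrier := range (zprod a n)\<rparr> \<cong> free_abelian_of_rank n"
proof -
  let ?Z = "free_abelian_of_rank n"
  have Z: "group ?Z" by (simp add: free_abelian_of_rank_def)
  have "zprod a n \<in> iso ?Z (G\<lparr>carrier := range (zprod a n)\<rparr>)"
    unfolding iso_iff
  proof (intro conjI)
    show "zprod a n \<in> hom ?Z (G\<lparr>carrier := range (zprod a n)\<rparr>)"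
    proof (rule homI)
      fix f g
      have "zprod a n (f \<otimes>\<^bsub>?Z\<^esub> g) = zprod a n (\<lambda>i. f i + g i)"
        by (rule zprod_cong) (auto simp: free_abelian_of_rank_def)
      then show "zprod a n (f \<otimes>\<^bsub>?Z\<^esub> g) = zprod a n f \<otimes>\<^bsub>G\<lparr>carrier := range (zprod a n)\<rparr>\<^esub> zprod a n g"
        using zprod_add[OF c] by simp
    qed simp
    show "zprod a n ` carrier ?Z = carrier (G\<lparr>carrier := range (zprod a n)\<rparr>)"
    proof -
      have "zprod a n f \<in> zprod a n ` carrier ?Z" for f
      proof (rule image_eqI)
        \<comment> \<open>The carrier of the product group consists of extensional functions, hence
          the restriction.\<close>
        show "zprod a n f = zprod a n (restrict f {..<n})" by (rule zprod_cong) auto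
        show "restrict f {..<n} \<in> carrier ?Z" by (simp add: free_abelian_of_rank_def)
      qed
      then show ?thesis by auto
    qed
    show "inj_on (zprod a n) (carrier ?Z)"
    proof (rule inj_onI)
      fix f g assume fg: "f \<in> carrier ?Z" "g \<in> carrier ?Z" "zprod a n f = zprod a n g"
      have "zprod a n (\<lambda>i. f i + - g i) = \<one>"
        using fg zprod_add[OF c, of f "\<lambda>i. - g i"] zprod_uminus[OF c] zprod_closed[OF c] by simp
      then have "f i + - g i = 0" if "i < n" for i using zprod_eq_one[OF c ind _ that] by metis
      then have "f i = g i" if "i < n" for i using that by fastforce
      then show "f = g" using fg unfolding free_abelian_of_rank_def
        by (intro PiE_ext[of f "{..<n}" "\<lambda>_. UNIV" g]) auto
    qed
  qed
  then show ?thesis using group.iso_sym[OF Z] is_isoI by blast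
qed

end

context geometric_CAT0
begin

lemmas coarse_kernel_mult = subgroup.m_closed[OF subgroup_coarse_kernel]
lemmas coarse_kernel_inv = subgroup.m_inv_closed[OF subgroup_coarse_kernel]

subsection \<open>A maximal independent commuting sequence in the coarse kernel\<close>

text \<open>Independence is required up to powers, so that torsion is ignored. For
  \<open>n = 0\<close> these are exactly the elements of infinite order in the coarse
  kernel.\<close>

definition cand :: "(nat \<Rightarrow> 'g) \<Rightarrow> nat \<Rightarrow> 'g set" where
  "cand a n = {g \<in> GX. (\<forall>i<n. g \<otimes> a i = a i \<otimes> g) \<and> (\<forall>k::nat. k \<ge> 1 \<longrightarrow> g [^] k \<notin> range (zprod a n))}"

text \<open>\<open>cand a i\<close> reads only the entries of \<open>a\<close> before
  \<open>i\<close>, so each element is minimal with respect to its own predecessors.\<close>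

definition greedy :: "(nat \<Rightarrow> 'g) \<Rightarrow> nat \<Rightarrow> bool" where
  "greedy a n \<longleftrightarrow> (\<forall>i<n. a i \<in> cand a i \<and> (\<forall>g\<in>cand a i. tlen (a i) \<le> tlen g))"

lemma cand_cong: "(\<And>i. i < n \<Longrightarrow> a i = b i) \<Longrightarrow> cand a n = cand b n"
proof -
  assume *: "\<And>i. i < n \<Longrightarrow> a i = b i"
  then have "zprod a n = zprod b n" by (intro ext zprod_cong) auto
  with * show ?thesis by (auto simp: cand_def)
qed

lemma greedy_cand: "greedy a n \<Longrightarrow> i < n \<Longrightarrow> a i \<in> cand a i"
  by (auto simp: greedy_def)

lemma greedy_coarse_kernel: "greedy a n \<Longrightarrow> i < n \<Longrightarrow> a i \<in> GX"
  using greedy_cand by (auto simp: cand_def)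

lemma greedy_commuting:
  assumes "greedy a n" shows "commuting a n"
  unfolding commuting_def
proof (intro conjI allI impI)
  fix i assume "i < n"
  then show "a i \<in> carrier G" using greedy_coarse_kernel[OF assms] coarse_kernel_carrier by blast
next
  fix i j assume "i < n" "j < n"
  then show "a i \<otimes> a j = a j \<otimes> a i"
    using greedy_cand[OF assms, of i] greedy_cand[OF assms, of j]
    by (cases i j rule: linorder_cases) (auto simp: cand_def)
qed

lemma cand_antimono:
  assumes "commuting a n" "m \<le> n" shows "cand a n \<subseteq> cand a m"
  using range_zprod_mono[OF assms] assms(2) by (auto simp: cand_def)

lemma greedy_tlen_pos:
  assumes "greedy a n" "i < n" shows "0 < tlen (a i)"
proof -
  have "tlen (a i) \<noteq> 0"
  proof
    assume "tlen (a i) = 0"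
    then obtain k :: nat where "k \<ge> 1" "a i [^] k = \<one>"
      using tlen_eq_0_torsion[OF greedy_coarse_kernel[OF assms]] by blast
    moreover have "\<one> \<in> range (zprod a i)" using zprod_zero by (metis rangeI)
    ultimately show False using greedy_cand[OF assms] by (auto simp: cand_def)
  qed
  then show ?thesis using tlen_nonneg[of "a i"] by simp
qed

text \<open>\<open>a j\<close> was already a candidate at stage \<open>i\<close>, hence is no
  shorter than \<open>a i\<close>. At stage \<open>j\<close> also
  \<open>inv (a i) \<otimes> a j\<close> is a candidate: a power of it in the subgroup of the
  predecessors would put the same power of \<open>a j\<close> there. So it is no shorter than
  \<open>a j\<close>, and \<open>tlen_parallelogram\<close> yields the second bound.\<close>

lemma greedy_obtuse:
  assumes gr: "greedy a n" and ij: "i < j" "j < n"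
  shows "tlen (a i) \<le> tlen (a j)" "(tlen (a i \<otimes> a j))\<^sup>2 \<le> 2 * (tlen (a i))\<^sup>2 + (tlen (a j))\<^sup>2"
proof -
  note c = greedy_commuting[OF gr]
  have cj: "commuting a j" by (rule commuting_le[OF c]) (use ij in simp)
  have m: "a i \<in> GX" "a j \<in> GX" using greedy_coarse_kernel[OF gr] ij by auto
  then have ca: "a i \<in> carrier G" "a j \<in> carrier G" using coarse_kernel_carrier by auto
  have com: "a i \<otimes> a j = a j \<otimes> a i" using c ij by (auto simp: commuting_def)
  have "a j \<in> cand a i" using greedy_cand[OF gr ij(2)] cand_antimono[OF cj, of i] ij by auto
  then show "tlen (a i) \<le> tlen (a j)" using gr ij by (auto simp: greedy_def)
  let ?g = "inv (a i) \<otimes> a j"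
  have "?g \<in> cand a j" unfolding cand_def
  proof (intro CollectI conjI allI impI)
    show "?g \<in> GX" by (intro coarse_kernel_mult coarse_kernel_inv m)
  next
    fix l assume l: "l < j"
    have lc: "a l \<in> carrier G" "a l \<otimes> a i = a i \<otimes> a l" "a l \<otimes> a j = a j \<otimes> a l"
      using c l ij by (auto simp: commuting_def)
    have "inv (a i) \<otimes> a l = a l \<otimes> inv (a i)" using inv_commute[of "a i" "a l"] lc ca by simp
    then have "a l \<otimes> inv (a i) \<otimes> a j = inv (a i) \<otimes> a l \<otimes> a j" by simp
    also have "\<dots> = inv (a i) \<otimes> (a j \<otimes> a l)" using lc ca by (simp add: m_assoc)
    finally show "?g \<otimes> a l = a l \<otimes> ?g" using lc ca by (simp add: m_assoc)
  next
    fix k :: nat assume k: "k \<ge> 1"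
    show "?g [^] k \<notin> range (zprod a j)"
    proof
      assume A: "?g [^] k \<in> range (zprod a j)"
      have "?g [^] k = inv (a i [^] k) \<otimes> a j [^] k"
        unfolding nat_pow_inv[OF ca(1), symmetric]
        by (rule pow_mult_distrib) (use inv_commute[OF ca com] ca in auto)
      then have "a j [^] k = a i [^] k \<otimes> ?g [^] k" using ca by (simp flip: m_assoc)
      moreover have "a i [^] k = a i [^] int k" by (simp add: int_pow_int)
      then have "a i [^] k \<in> range (zprod a j)" using zprod_single[OF cj ij(1), of "int k"] by (metis rangeI)
      ultimately have "a j [^] k \<in> range (zprod a j)"
        using A subgroup.m_closed[OF subgroup_range_zprod[OF cj]] by simp
      then show False using greedy_cand[OF gr ij(2)] k by (auto simp: cand_def)
    qed
  qed
  then have "tlen (a j) \<le> tlen ?g" using gr ij by (auto simp: greedy_def)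
  then have "(tlen (a j))\<^sup>2 \<le> (tlen ?g)\<^sup>2" by (intro power_mono tlen_nonneg)
  then show "(tlen (a i \<otimes> a j))\<^sup>2 \<le> 2 * (tlen (a i))\<^sup>2 + (tlen (a j))\<^sup>2"
    using tlen_parallelogram[OF m com] by linarith
qed

lemma greedy_bounded: "\<exists>N. \<forall>a n. greedy a n \<longrightarrow> n \<le> N"
proof -
  let ?T = "tlen ` {g \<in> GX. tlen g \<le> 1 \<and> tlen g > 0}"
  have "finite ?T" by (rule finite_imageI, rule finite_subset[OF _ finite_tlen_le[of 1]]) auto
  \<comment> \<open>One radius for all sequences: only finitely many translation lengths lie in
    \<open>(0, 1]\<close>, and the inserted 1 keeps the set nonempty.\<close>
  define r where "r = Min (insert 1 ?T)"
  have r: "r > 0" "\<And>g. g \<in> GX \<Longrightarrow> tlen g > 0 \<Longrightarrow> r \<le> tlen g"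
  proof -
    show "r > 0" unfolding r_def using \<open>finite ?T\<close> by (subst Min_gr_iff) auto
    fix g assume g: "g \<in> GX" "tlen g > 0"
    show "r \<le> tlen g"
    proof (cases "tlen g \<le> 1")
      case True
      then show ?thesis unfolding r_def using \<open>finite ?T\<close> g by (intro Min_le) auto
    next
      case False
      then have "r \<le> 1" unfolding r_def using \<open>finite ?T\<close> by (intro Min_le) auto
      with False show ?thesis by simp
    qed
  qed
  obtain N where N: "\<And>n x (p :: nat \<Rightarrow> 'a). (\<forall>i<n. dist x (p i) \<le> r) \<and> (\<forall>i j. i < j \<longrightarrow> j < n \<longrightarrow> r \<le> dist (p i) (p j)) \<Longrightarrow> n \<le> N"
    using packing_bound[OF r(1)] by metis
  have "n \<le> N" if gr: "greedy a n" for a n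
  proof -
    have "\<exists>x (p :: nat \<Rightarrow> 'a). (\<forall>i<n. dist x (p i) \<le> r) \<and> (\<forall>i j. i < j \<longrightarrow> j < n \<longrightarrow> r \<le> dist (p i) (p j))"
      by (rule packing_points[of n a])
        (use greedy_coarse_kernel[OF gr] greedy_commuting[OF gr] greedy_tlen_pos[OF gr] greedy_obtuse[OF gr] r in
          \<open>auto simp: commuting_def\<close>)
    then show ?thesis using N by blast
  qed
  then show ?thesis by blast
qed

text \<open>A shortest candidate exists because only finitely many are no longer than a given
  one.\<close>

lemma greedy_extend:
  assumes "greedy a n" "cand a n \<noteq> {}" shows "\<exists>b. greedy b (Suc n)"
proof -
  obtain g0 where g0: "g0 \<in> cand a n" using assms by blast
  let ?S = "{g \<in> cand a n. tlen g \<le> tlen g0}"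
  have "?S \<subseteq> {g \<in> GX. tlen g \<le> tlen g0}" by (auto simp: cand_def)
  then have "finite ?S" using finite_tlen_le finite_subset by blast
  then obtain g where g: "g \<in> ?S" "\<And>h. h \<in> ?S \<Longrightarrow> tlen g \<le> tlen h"
  proof -
    assume fin: "finite ?S" and *: "\<And>g. g \<in> ?S \<Longrightarrow> (\<And>h. h \<in> ?S \<Longrightarrow> tlen g \<le> tlen h) \<Longrightarrow> thesis"
    have ne: "?S \<noteq> {}" using g0 by blast
    show thesis by (rule *[OF arg_min_if_finite(1)[OF fin ne, of tlen] arg_min_least[OF fin ne]])
  qed
  have min: "tlen g \<le> tlen h" if "h \<in> cand a n" for h
    using g that by (cases "tlen h \<le> tlen g0") auto
  define b where "b = a(n := g)"
  have "cand b i = cand a i" if "i \<le> n" for i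
    using that by (intro cand_cong) (auto simp: b_def)
  then have "greedy b (Suc n)" using assms(1) g(1) min
    unfolding greedy_def by (auto simp: b_def less_Suc_eq)
  then show ?thesis by blast
qed

lemma greedy_maximal: "\<exists>a n. greedy a n \<and> cand a n = {}"
proof (rule ccontr)
  assume A: "\<not> ?thesis"
  have "\<exists>a. greedy a n" for n
  proof (induction n)
    case 0 show ?case by (simp add: greedy_def)
  next
    case (Suc n) then show ?case using A greedy_extend by blast
  qed
  moreover obtain N where "\<And>a n. greedy a n \<Longrightarrow> n \<le> N" using greedy_bounded by blast
  ultimately have "Suc N \<le> N" by blast
  then show False by simp
qed

lemma tlen_zprod_le:
  assumes "greedy a n" shows "tlen (zprod a n f) \<le> (\<Sum>i<n. \<bar>real_of_int (f i)\<bar> * tlen (a i))"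
proof -
  note c = greedy_commuting[OF assms]
  have "m \<le> n \<Longrightarrow> tlen (zprod a m f) \<le> (\<Sum>i<m. \<bar>real_of_int (f i)\<bar> * tlen (a i))" for m
  proof (induction m)
    case 0 show ?case using tlen_le[of \<one>] by simp
  next
    case (Suc m)
    have z: "zprod a m f \<in> GX"
      using Suc.prems greedy_coarse_kernel[OF assms] by (intro zprod_in_subgroup[OF subgroup_coarse_kernel]) auto
    have am: "a m \<in> GX" using Suc.prems greedy_coarse_kernel[OF assms] by auto
    have "tlen (zprod a (Suc m) f) \<le> tlen (zprod a m f) + tlen (a m [^] f m)"
      unfolding zprod.simps
      by (intro tlen_mult_le z coarse_kernel_int_pow am zprod_Suc_commute commuting_le[OF c Suc.prems])
    then show ?case using Suc tlen_int_pow[OF am, of "f m"] by simp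
  qed
  then show ?thesis by simp
qed

text \<open>Up to finitely many factors \<open>v\<close>, an element of the kernel commutes with
  every \<open>a i\<close>, and maximality places some power of it in the subgroup. Division of the
  exponents with remainder leaves a factor of bounded translation length, of which there are
  finitely many.\<close>

lemma maximal_greedy_finite_cosets:
  assumes gr: "greedy a n" and mx: "cand a n = {}"
  shows "\<exists>R. finite R \<and> R \<subseteq> GX \<and> (\<forall>g\<in>GX. \<exists>r\<in>R. \<exists>u\<in>range (zprod a n). g = u \<otimes> r)"
proof -
  note c = greedy_commuting[OF gr]
  have GXc: "GX \<subseteq> carrier G" using coarse_kernel_carrier by blast
  obtain V where V: "finite V" "V \<subseteq> GX"
    "\<forall>g\<in>GX. \<exists>v\<in>V. \<forall>s\<in>a ` {..<n}. (g \<otimes> inv v) \<otimes> s = s \<otimes> (g \<otimes> inv v)"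
  proof -
    have "a ` {..<n} \<subseteq> GX" using greedy_coarse_kernel[OF gr] by auto
    then show ?thesis using centralizer_cosets[OF _ _ GXc, of "a ` {..<n}"] that by auto
  qed
  define B where "B = (\<Sum>i<n. tlen (a i))"
  let ?T = "{g \<in> GX. tlen g \<le> B}"
  let ?R = "(\<lambda>(t, v). t \<otimes> v) ` (?T \<times> V)"
  have "finite ?R" using V finite_tlen_le by (intro finite_imageI finite_cartesian_product) auto
  moreover have "?R \<subseteq> GX" using V(2) by (auto intro: coarse_kernel_mult)
  moreover have "\<exists>r\<in>?R. \<exists>u\<in>range (zprod a n). g = u \<otimes> r" if g: "g \<in> GX" for g
  proof -
    obtain v where v: "v \<in> V" "\<forall>i<n. (g \<otimes> inv v) \<otimes> a i = a i \<otimes> (g \<otimes> inv v)" using V(3) g by auto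
    define h where "h = g \<otimes> inv v"
    have h: "h \<in> GX" unfolding h_def
      using g v(1) V(2) by (intro coarse_kernel_mult coarse_kernel_inv) auto
    have car: "g \<in> carrier G" "v \<in> carrier G" "h \<in> carrier G" using g v h V GXc by auto
    have "h \<notin> cand a n" using mx by simp
    then obtain k :: nat and f where k: "k \<ge> 1" "h [^] k = zprod a n f"
      using h v(2) unfolding cand_def h_def[symmetric] by auto
    \<comment> \<open>Rounded \<open>k\<close>-th root of \<open>h [^] k\<close>: the quotient
      \<open>t\<close> has a \<open>k\<close>-th power whose exponents are remainders below
      \<open>k\<close>, so \<open>tlen t\<close> is at most \<open>B\<close> whatever
      \<open>k\<close> is.\<close>
    define u where "u = zprod a n (\<lambda>i. f i div int k)"
    define t where "t = inv u \<otimes> h"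
    have u: "u \<in> carrier G" "u \<in> GX" unfolding u_def
      by (rule zprod_closed[OF c], rule zprod_in_subgroup[OF subgroup_coarse_kernel greedy_coarse_kernel[OF gr]])
    have t: "t \<in> GX" unfolding t_def by (intro coarse_kernel_mult coarse_kernel_inv u h)
    have uh: "u \<otimes> h = h \<otimes> u" unfolding u_def
      using zprod_commute[OF c car(3)] v(2) by (simp add: h_def)
    have "t [^] k = inv (u [^] k) \<otimes> h [^] k"
      unfolding t_def nat_pow_inv[OF u(1), symmetric]
      by (rule pow_mult_distrib) (use inv_commute[OF u(1) car(3) uh] u car in auto)
    also have "u [^] k = zprod a n (\<lambda>i. (f i div int k) * int k)"
      unfolding u_def by (simp add: zprod_scale[OF c] int_pow_int)
    also have "inv \<dots> \<otimes> h [^] k = zprod a n (\<lambda>i. - ((f i div int k) * int k) + f i)"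
      unfolding k(2) by (simp only: zprod_add[OF c] zprod_uminus[OF c])
    also have "\<dots> = zprod a n (\<lambda>i. f i mod int k)"
      by (rule zprod_cong) (simp_all add: minus_div_mult_eq_mod[symmetric])
    finally have "real k * tlen t = tlen (zprod a n (\<lambda>i. f i mod int k))" using tlen_nat_pow[OF t, of k] by simp
    also have "\<dots> \<le> (\<Sum>i<n. \<bar>real_of_int (f i mod int k)\<bar> * tlen (a i))" by (rule tlen_zprod_le[OF gr])
    also have "\<dots> \<le> (\<Sum>i<n. real k * tlen (a i))"
    proof (intro sum_mono mult_right_mono tlen_nonneg)
      fix i
      have "0 \<le> f i mod int k" "f i mod int k < int k" using k(1) by auto
      then show "\<bar>real_of_int (f i mod int k)\<bar> \<le> real k" by linarith
    qed
    also have "\<dots> = real k * B" by (simp add: B_def sum_distrib_left)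
    finally have "tlen t \<le> B" using k(1) by simp
    then have r: "t \<otimes> v \<in> ?R" using t v by auto
    have e: "g = u \<otimes> (t \<otimes> v)" unfolding t_def h_def using u car by (simp add: m_assoc) (simp flip: m_assoc)
    have "u \<in> range (zprod a n)" unfolding u_def by (rule rangeI)
    with e have "\<exists>u\<in>range (zprod a n). g = u \<otimes> (t \<otimes> v)" by (rule bexI)
    then show ?thesis using r by (rule bexI)
  qed
  ultimately show ?thesis by (intro exI[of _ ?R] conjI ballI)
qed

lemma maximal_greedy_finite_index:
  assumes gr: "greedy a n" and mx: "cand a n = {}"
  shows "finite_index_subgroup (range (zprod a n)) (G\<lparr>carrier := GX\<rparr>)"
  unfolding finite_index_subgroup_def
proof (intro conjI)
  let ?A = "range (zprod a n)"
  note c = greedy_commuting[OF gr]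
  have A: "subgroup ?A G" by (rule subgroup_range_zprod[OF c])
  show "Group.group (G\<lparr>carrier := GX\<rparr>)" using subgroup.subgroup_is_group[OF subgroup_coarse_kernel] is_group by blast
  show "subgroup ?A (G\<lparr>carrier := GX\<rparr>)"
    using zprod_in_subgroup[OF subgroup_coarse_kernel greedy_coarse_kernel[OF gr]] A
    by (intro subgroup_incl subgroup_coarse_kernel) auto
  obtain R where R: "finite R" "R \<subseteq> GX" "\<forall>g\<in>GX. \<exists>r\<in>R. \<exists>u\<in>?A. g = u \<otimes> r"
    using maximal_greedy_finite_cosets[OF assms] by blast
  have "rcosets\<^bsub>G\<lparr>carrier := GX\<rparr>\<^esub> ?A \<subseteq> (\<lambda>r. ?A #> r) ` R"
  proof
    fix C assume "C \<in> rcosets\<^bsub>G\<lparr>carrier := GX\<rparr>\<^esub> ?A"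
    then obtain g where g: "g \<in> GX" "C = ?A #> g" by (auto simp: RCOSETS_def r_coset_def)
    then obtain r u where r: "r \<in> R" "u \<in> ?A" "g = u \<otimes> r" using R by blast
    have "?A #> r = ?A #> g"
      by (rule repr_independence[OF _ _ A]) (use r R coarse_kernel_carrier in \<open>auto simp: r_coset_def\<close>)
    then show "C \<in> (\<lambda>r. ?A #> r) ` R" using g r by blast
  qed
  then show "finite (rcosets\<^bsub>G\<lparr>carrier := GX\<rparr>\<^esub> ?A)" using R(1) finite_subset by blast
qed

end

context CAT0
begin

subsection \<open>Counting curtains\<close>

abbreviation coord :: "'a \<Rightarrow> 'a \<Rightarrow> 'a \<Rightarrow> real" where
  "coord u v \<equiv> gcoord {0..dist u v} (gseg u v)"

lemma coord_Lipschitz: "\<bar>coord u v p - coord u v q\<bar> \<le> dist p q"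
  by (rule gcoord_Lipschitz[OF geodesic_gseg])

lemma coord_gseg: "0 \<le> s \<Longrightarrow> s \<le> dist u v \<Longrightarrow> coord u v (gseg u v s) = s"
  by (rule gcoord_geodesic[OF geodesic_gseg]) simp

lemma coord_left [simp]: "coord u v u = 0" and coord_right [simp]: "coord u v v = dist u v"
  using coord_gseg[of 0 u v] coord_gseg[of "dist u v" u v] by simp_all

lemma connected_gseg_image:
  assumes "0 \<le> s" "t \<le> dist u v" shows "connected (gseg u v ` {s..t})"
  by (intro connected_continuous_image continuous_on_subset[OF continuous_gseg]) (use assms in auto)

lemma separates_meets_gseg:
  assumes "separates h {gseg u v s} {gseg u v t}" "0 \<le> s" "s \<le> t" "t \<le> dist u v"
  shows "\<exists>r\<in>{s..t}. gseg u v r \<in> h"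
  using separates_meets_connected[OF assms(1) connected_gseg_image[of s t u v]] assms by auto

lemma separates_meets_segment:
  assumes "separates h {u} {v :: 'a} \<or> u \<in> h \<or> v \<in> h"
  shows "\<exists>z\<in>h. \<exists>r\<in>{0..dist u v}. z = gseg u v r"
proof -
  have "\<exists>r\<in>{0..dist u v}. gseg u v r \<in> h"
    using assms
  proof (elim disjE)
    assume "separates h {u} {v}"
    then show ?thesis using separates_meets_gseg[of h u v 0 "dist u v"] by simp
  next
    assume "u \<in> h" then show ?thesis by (intro bexI[of _ 0]) auto
  next
    assume "v \<in> h" then show ?thesis by (intro bexI[of _ "dist u v"]) auto
  qed
  then show ?thesis by blast
qed

lemma card_le_1:
  assumes "\<And>h h'. h \<in> S \<Longrightarrow> h' \<in> S \<Longrightarrow> h = h'" shows "finite S \<and> real (card S) \<le> 1"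
proof -
  have "S = {} \<or> (\<exists>h. S = {h})" using assms by blast
  then show ?thesis by auto
qed

lemma card_separating:
  assumes "pairwise disjnt c" shows "finite {h \<in> c. separates h {x} {y :: 'a}} \<and> real (card {h \<in> c. separates h {x} {y}}) \<le> dist x y"
  by (rule card_disjoint_separating) (use assms in \<open>auto intro: pairwise_subset\<close>)

lemma card_containing:
  assumes "pairwise disjnt c" shows "finite {h \<in> c. x \<in> h} \<and> real (card {h \<in> c. x \<in> h}) \<le> 1"
  by (rule card_le_1) (use assms in \<open>auto simp: pairwise_def disjnt_def\<close>)

lemma card_Un_real:
  assumes "finite A \<and> real (card A) \<le> a" "finite B \<and> real (card B) \<le> b"
  shows "finite (A \<union> B) \<and> real (card (A \<union> B)) \<le> a + b"
  using assms card_Un_le[of A B] by auto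

lemma card_subset_real:
  assumes "finite B \<and> real (card B) \<le> b" "A \<subseteq> B" shows "finite A \<and> real (card A) \<le> b"
  using assms card_mono[of B A] finite_subset[of A B] by auto

lemma pairwise_L_separated_disjnt: "pairwise (L_separated L) c \<Longrightarrow> pairwise disjnt c"
  by (auto simp: pairwise_def dest: L_separated_disjnt)

lemma card_pairwise_L_separated:
  assumes "pairwise (L_separated L) c"
    and "\<And>h h'. h \<in> c \<Longrightarrow> h' \<in> c \<Longrightarrow> P h \<Longrightarrow> P h' \<Longrightarrow> \<not> L_separated L h h'"
  shows "finite {h \<in> c. P h} \<and> real (card {h \<in> c. P h}) \<le> 1"
  by (rule card_le_1) (use assms in \<open>auto simp: pairwise_def\<close>)

text \<open>Every member of \<open>c\<close> meets the segment from \<open>x\<close> to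
  \<open>y\<close>, at coordinate at most \<open>dist x y\<close> along the segment from
  \<open>x\<close> to \<open>v\<close>. One that also reaches the far segment from \<open>v\<close>
  to \<open>w\<close> gains \<open>2 * L + 4\<close>, so two such members contradict
  \<open>not_L_separated\<close>.\<close>

lemma card_meeting_far_segment:
  assumes c: "pairwise (L_separated L) c" and sep: "\<And>h. h \<in> c \<Longrightarrow> separates h {x} {y :: 'a}"
    and D: "dist v w \<le> dist x y" "dist x v \<ge> 2 * dist x y + 2 * real L + 4"
  defines "C \<equiv> {h \<in> c. separates h {v} {w} \<or> v \<in> h \<or> w \<in> h}"
  shows "finite C \<and> real (card C) \<le> 1"
  unfolding C_def
proof (rule card_pairwise_L_separated[OF c])
  fix h h' assume h: "h \<in> c" "separates h {v} {w} \<or> v \<in> h \<or> w \<in> h"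
    and h': "h' \<in> c" "separates h' {v} {w} \<or> v \<in> h' \<or> w \<in> h'"
  have near: "\<exists>p\<in>k. coord x v p \<le> dist x y" if k: "k \<in> c" for k
  proof -
    obtain r where r: "r \<in> {0..dist x y}" "gseg x y r \<in> k"
      using separates_meets_segment[of k x y] sep[OF k] by blast
    have "dist x (gseg x y r) = r" using dist_gseg[of 0 x y r] r by simp
    then show ?thesis using coord_Lipschitz[of x v "gseg x y r" x] r
      by (intro bexI[of _ "gseg x y r"]) (auto simp: dist_commute[of "gseg x y r" x])
  qed
  have far: "\<exists>p\<in>k. coord x v p \<ge> dist x y + 2 * real L + 4" if k: "separates k {v} {w} \<or> v \<in> k \<or> w \<in> k" for k
  proof -
    obtain r where r: "r \<in> {0..dist v w}" "gseg v w r \<in> k"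
      using separates_meets_segment[OF k] by blast
    have "dist v (gseg v w r) = r" using dist_gseg[of 0 v w r] r by simp
    then show ?thesis using coord_Lipschitz[of x v "gseg v w r" v] r D
      by (intro bexI[of _ "gseg v w r"]) (auto simp: dist_commute[of "gseg v w r" v])
  qed
  obtain p p' where "p \<in> h" "coord x v p \<le> dist x y" "p' \<in> h" "coord x v p' \<ge> dist x y + 2 * real L + 4"
    using near[OF h(1)] far[OF h(2)] by blast
  moreover obtain q q' where "q \<in> h'" "coord x v q \<le> dist x y" "q' \<in> h'" "coord x v q' \<ge> dist x y + 2 * real L + 4"
    using near[OF h'(1)] far[OF h'(2)] by blast
  ultimately show "\<not> L_separated L h h'"
    using sep[OF h(1)] sep[OF h'(1)] not_L_separated[of h p p' h' q q' "dist x y" x v L] curtain_if_separates by auto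
qed

text \<open>Here \<open>x\<close> lies on a geodesic from \<open>v'\<close> to \<open>v\<close>, and
  a curtain in \<open>C\<close> cuts both arms. At most one does so beyond \<open>w\<close> and
  \<open>w'\<close>; each other one separates \<open>x\<close> from \<open>w\<close> or
  \<open>w'\<close> or contains one of these two points.\<close>

lemma card_separating_both_sides:
  assumes c: "pairwise (L_separated L) c"
    and x: "dist v' x + dist x v = dist v' (v :: 'a)"
  defines "C \<equiv> {h \<in> c. separates h {x} {v} \<and> separates h {x} {v'}}"
  shows "finite C \<and> real (card C) \<le> 2 * real L + 7"
proof -
  \<comment> \<open>Half of the range \<open>2 * L + 4\<close>; the total is
    \<open>2 * \<rho> + 3\<close>.\<close>
  define \<rho> where "\<rho> = real L + 2"
  have dis: "pairwise disjnt c" by (rule pairwise_L_separated_disjnt[OF c])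
  consider "dist x v \<le> \<rho>" | "dist x v' \<le> \<rho>" | "dist x v > \<rho>" "dist x v' > \<rho>" by linarith
  then show ?thesis
  proof cases
    case 1
    have "finite C \<and> real (card C) \<le> dist x v"
      by (rule card_subset_real[OF card_separating[OF dis]]) (auto simp: C_def)
    then show ?thesis using 1 by (auto simp: \<rho>_def)
  next
    case 2
    have "finite C \<and> real (card C) \<le> dist x v'"
      by (rule card_subset_real[OF card_separating[OF dis]]) (auto simp: C_def)
    then show ?thesis using 2 by (auto simp: \<rho>_def)
  next
    case 3
    define s where "s = dist v' x"
    define w w' where "w = gseg v' v (s + \<rho>)" and "w' = gseg v' v (s - \<rho>)"
    have s: "0 \<le> s - \<rho>" "s + \<rho> \<le> dist v' v" "0 \<le> \<rho>" "s \<le> dist v' v"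
      using 3 x by (auto simp: s_def \<rho>_def dist_commute)
    have xs: "x = gseg v' v s" using gseg_unique[OF x] by (simp add: s_def)
    have dw: "dist x w = \<rho>" "dist x w' = \<rho>" unfolding xs w_def w'_def using s by (auto simp: dist_gseg)
    define E where "E = {h \<in> c. separates h {w} {v} \<and> separates h {w'} {v'}}"
    have E: "finite E \<and> real (card E) \<le> 1" unfolding E_def
    proof (rule card_pairwise_L_separated[OF c])
      fix h h' assume h: "separates h {w} {v} \<and> separates h {w'} {v'}" and h': "separates h' {w} {v} \<and> separates h' {w'} {v'}"
      have hi: "\<exists>p\<in>k. coord v' v p \<ge> (s - \<rho>) + 2 * real L + 4" if k: "separates k {w} {v}" for k
      proof -
        obtain r where "r \<in> {s + \<rho>..dist v' v}" "gseg v' v r \<in> k"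
          using separates_meets_gseg[of k v' v "s + \<rho>" "dist v' v"] k s by (auto simp: w_def)
        then show ?thesis using s by (intro bexI[of _ "gseg v' v r"]) (auto simp: coord_gseg \<rho>_def)
      qed
      have lo: "\<exists>p\<in>k. coord v' v p \<le> s - \<rho>" if k: "separates k {w'} {v'}" for k
      proof -
        obtain r where "r \<in> {0..s - \<rho>}" "gseg v' v r \<in> k"
          using separates_meets_gseg[of k v' v 0 "s - \<rho>"] k s separates_commute[of k "{w'}"] by (auto simp: w'_def)
        then show ?thesis using s by (intro bexI[of _ "gseg v' v r"]) (auto simp: coord_gseg)
      qed
      obtain p p' where "p \<in> h" "coord v' v p \<le> s - \<rho>" "p' \<in> h" "coord v' v p' \<ge> (s - \<rho>) + 2 * real L + 4"
        using hi lo h by blast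
      moreover obtain q q' where "q \<in> h'" "coord v' v q \<le> s - \<rho>" "q' \<in> h'" "coord v' v q' \<ge> (s - \<rho>) + 2 * real L + 4"
        using hi lo h' by blast
      ultimately show "\<not> L_separated L h h'"
        using h h' s not_L_separated[of h p p' h' q q' "s - \<rho>" v' v L] curtain_if_separates by auto
    qed
    let ?U = "{h\<in>c. w \<in> h} \<union> {h\<in>c. w' \<in> h} \<union> {h\<in>c. separates h {x} {w}} \<union> {h\<in>c. separates h {x} {w'}} \<union> E"
    have "C \<subseteq> ?U"
    proof
      fix h assume "h \<in> C"
      then have h: "h \<in> c" "separates h {x} {v}" "separates h {x} {v'}" by (auto simp: C_def)
      then show "h \<in> ?U"
        using separates_cases[of h x v w] separates_cases[of h x v' w'] by (auto simp: E_def)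
    qed
    moreover have "finite (?U) \<and>
       real (card (?U)) \<le> 1 + 1 + dist x w + dist x w' + 1"
      by (intro card_Un_real card_containing card_separating dis E)
    ultimately have "finite C \<and> real (card C) \<le> 1 + 1 + dist x w + dist x w' + 1" by (rule card_subset_real[rotated])
    then show ?thesis unfolding dw by (simp add: \<rho>_def)
  qed
qed

text \<open>A curtain between \<open>v\<close> and \<open>v'\<close> either leaves through one of
  the sides \<open>v z\<close>, \<open>v' z'\<close> or their ends \<open>z\<close>,
  \<open>z'\<close>, or it separates \<open>z\<close> from \<open>z'\<close> as well. A curtain of
  the last kind runs over the full range along the segment from \<open>u0\<close> to
  \<open>v0\<close>, so there is at most one.\<close>

lemma card_separating_parallel:
  assumes c: "pairwise (L_separated L) c"
    and s: "0 \<le> s" and lo: "\<And>r. r \<in> {0..dist v v'} \<Longrightarrow> coord u0 v0 (gseg v v' r) \<le> s"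
    and hi: "\<And>r. r \<in> {0..dist z z'} \<Longrightarrow> coord u0 v0 (gseg z z' r) \<ge> s + 2 * real L + 4"
  defines "C \<equiv> {h \<in> c. separates h {v} {v' :: 'a}}"
  shows "finite C \<and> real (card C) \<le> dist v z + dist v' z' + 3"
proof -
  have dis: "pairwise disjnt c" by (rule pairwise_L_separated_disjnt[OF c])
  define E where "E = {h \<in> c. separates h {v} {v'} \<and> separates h {z} {z'}}"
  have E: "finite E \<and> real (card E) \<le> 1" unfolding E_def
  proof (rule card_pairwise_L_separated[OF c])
    fix h h' assume h: "separates h {v} {v'} \<and> separates h {z} {z'}" and h': "separates h' {v} {v'} \<and> separates h' {z} {z'}"
    have 1: "\<exists>p\<in>k. coord u0 v0 p \<le> s" if "separates k {v} {v'}" for k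
      using separates_meets_segment[of k v v'] that lo by blast
    have 2: "\<exists>p\<in>k. coord u0 v0 p \<ge> s + 2 * real L + 4" if "separates k {z} {z'}" for k
      using separates_meets_segment[of k z z'] that hi by blast
    obtain p p' where "p \<in> h" "coord u0 v0 p \<le> s" "p' \<in> h" "coord u0 v0 p' \<ge> s + 2 * real L + 4"
      using 1 2 h by blast
    moreover obtain q q' where "q \<in> h'" "coord u0 v0 q \<le> s" "q' \<in> h'" "coord u0 v0 q' \<ge> s + 2 * real L + 4"
      using 1 2 h' by blast
    ultimately show "\<not> L_separated L h h'"
      using h h' s not_L_separated[of h p p' h' q q' s u0 v0 L] curtain_if_separates by auto
  qed
  let ?U = "{h\<in>c. z \<in> h} \<union> {h\<in>c. z' \<in> h} \<union> {h\<in>c. separates h {v} {z}} \<union> {h\<in>c. separates h {v'} {z'}} \<union> E"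
  have "C \<subseteq> ?U"
  proof
    fix h assume "h \<in> C"
    then have h: "h \<in> c" "separates h {v} {v'}" by (auto simp: C_def)
    then show "h \<in> ?U"
      using separates_cases[of h v v' z] separates_cases[of h z v' z'] separates_commute[of h "{z'}" "{v'}"] by (auto simp: E_def)
  qed
  moreover have "finite (?U) \<and>
     real (card (?U)) \<le> 1 + 1 + dist v z + dist v' z' + 1"
    by (intro card_Un_real card_containing card_separating dis E)
  ultimately have "finite C \<and> real (card C) \<le> 1 + 1 + dist v z + dist v' z' + 1" by (rule card_subset_real[rotated])
  then show ?thesis by simp
qed

end

lemma affine_int_sequence:
  fixes f :: "int \<Rightarrow> real"
  assumes "\<And>t. f (t + 1) + f (t - 1) = 2 * f t"
  shows "f t = f 0 + of_int t * (f 1 - f 0)"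
proof -
  have nat: "g (int n) = g 0 + real n * (g 1 - g 0)" if g: "\<And>t. g (t + 1) + g (t - 1) = 2 * g t" for g :: "int \<Rightarrow> real" and n
  proof -
    have "g (int n) = g 0 + real n * (g 1 - g 0) \<and> g (int n + 1) = g 0 + (real n + 1) * (g 1 - g 0)"
    proof (induction n)
      case (Suc n)
      then show ?case using g[of "int n + 1"] by (simp add: algebra_simps)
    qed simp
    then show ?thesis by blast
  qed
  show ?thesis
  proof (cases t rule: int_cases2)
    case (nonneg n)
    then show ?thesis using nat[of f n] assms by simp
  next
    case (nonpos n)
    have "f (- (t + 1)) + f (- (t - 1)) = 2 * f (- t)" for t
    proof -
      have "- (t + 1) = - t - 1" "- (t - 1) = - t + 1" by simp_all
      then show ?thesis using assms[of "- t"] by (simp only: add.commute)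
    qed
    note nat[of "\<lambda>t. f (- t)", OF this, of n]
    moreover have "f (- 1) = 2 * f 0 - f 1" using assms[of 0] by simp
    ultimately show ?thesis using nonpos by (simp add: algebra_simps)
  qed
qed

subsection \<open>The axes of an infinite order element of the coarse kernel\<close>

locale axial = geometric_CAT0 X G \<phi> for X :: "'a::metric_space itself" and G :: "'g monoid" (structure) and \<phi> +
  fixes a :: 'g
  assumes a: "a \<in> GX" and tlen_pos: "tlen a > 0"
begin

abbreviation T where "T \<equiv> tlen a"
abbreviation M where "M \<equiv> Minset {a}"
definition ax :: "int \<Rightarrow> 'a \<Rightarrow> 'a" where "ax i = \<phi> (a [^] i)"

lemma a_carrier: "a \<in> carrier G" by (rule coarse_kernel_carrier[OF a])

lemma dist_ax [simp]: "dist (ax i x) (ax i y) = dist x y"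
  by (simp add: ax_def a_carrier)

lemma ax_ax: "ax i (ax j x) = ax (i + j) x"
  by (simp add: ax_def a_carrier int_pow_mult act_mult)

lemma ax_0 [simp]: "ax 0 x = x"
  by (simp add: ax_def)

lemma ax_1: "ax 1 x = \<phi> a x"
  by (simp add: ax_def a_carrier)

lemma dist_ax_shift: "dist (ax i x) (ax j y) = dist (ax (i - j) x) y"
  using dist_ax[of j "ax (i - j) x" y] by (simp add: ax_ax)

lemma dist_ax_ax: "x \<in> M \<Longrightarrow> dist (ax i x) (ax j x) = \<bar>real_of_int (i - j)\<bar> * T"
  unfolding ax_def by (rule dist_int_pow[OF a_carrier])

lemma M_iff: "x \<in> M \<longleftrightarrow> dist x (ax 1 x) = T"
  using Minset_tlen[of x "{a}" a] tlen_le[of a] unfolding ax_1 by (auto simp: Minset_def)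

lemma ax_M: "x \<in> M \<Longrightarrow> ax i x \<in> M"
  unfolding M_iff ax_ax using dist_ax[of i x "ax 1 x"] by (simp add: ax_ax add.commute)

lemma gpt_M: "x \<in> M \<Longrightarrow> y \<in> M \<Longrightarrow> 0 \<le> t \<Longrightarrow> t \<le> 1 \<Longrightarrow> gpt x y t \<in> M"
  using gconvex_Minset[of "{a}"] a_carrier by (simp add: gconvex_def)

text \<open>The centralizer of \<open>a\<close> preserves \<open>M\<close> and acts
  cocompactly.\<close>

lemma M_coarsely_dense: "\<exists>R\<ge>0. \<forall>p. \<exists>x\<in>M. dist p x \<le> R"
proof -
  obtain K where K: "compact K" "\<And>x. \<exists>c\<in>carrier G. (\<forall>s\<in>{a}. c \<otimes> s = s \<otimes> c) \<and> (\<exists>k\<in>K. x = \<phi> c k)"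
    using centralizer_cocompact[of "{a}"] a by auto
  have "M \<noteq> {}" using a by (intro Minset_nonempty) auto
  then obtain x0 where x0: "x0 \<in> M" by blast
  obtain R where R: "\<And>k. k \<in> K \<Longrightarrow> dist x0 k \<le> R"
    using compact_imp_bounded[OF K(1)] bounded_any_center[of K x0] by blast
  have "\<exists>x\<in>M. dist p x \<le> R" for p
  proof -
    obtain c k where c: "c \<in> carrier G" "c \<otimes> a = a \<otimes> c" "k \<in> K" "p = \<phi> c k" using K(2) by blast
    have "\<phi> c x0 \<in> M" using c a_carrier x0 by (intro Minset_commute) auto
    moreover have "dist p (\<phi> c x0) \<le> R" using c R[of k] by (simp add: dist_commute)
    ultimately show ?thesis by blast
  qed
  then show ?thesis by (metis dual_order.trans zero_le_dist)
qed

lemma dist_axis: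
  assumes "x \<in> M" "i \<le> j" shows "dist (ax i x) (ax j x) = real_of_int (j - i) * T"
  using dist_ax_ax[OF assms(1), of i j] assms(2) by simp

lemma gseg_axis:
  assumes "x \<in> M" "i \<le> k" "k \<le> j"
  shows "gseg (ax i x) (ax j x) (real_of_int (k - i) * T) = ax k x"
proof -
  have "dist (ax i x) (ax k x) + dist (ax k x) (ax j x) = dist (ax i x) (ax j x)"
    using assms dist_axis[of x i k] dist_axis[of x k j] dist_axis[of x i j] by (simp add: algebra_simps)
  then show ?thesis using gseg_unique[of "ax i x" "ax k x" "ax j x"] dist_axis[OF assms(1,2)] by simp
qed

lemma near_axis:
  assumes x: "x \<in> M" and ij: "i \<le> j" and r: "r \<in> {0..dist (ax i x) (ax j x)}"
  shows "\<exists>k. i \<le> k \<and> k \<le> j \<and> dist (gseg (ax i x) (ax j x) r) (ax k x) \<le> T"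
proof -
  define k where "k = i + \<lfloor>r / T\<rfloor>"
  have r': "0 \<le> r" "r \<le> real_of_int (j - i) * T" using r dist_axis[OF x ij] by auto
  have "r / T \<le> real_of_int (j - i)" using r' tlen_pos by (simp add: divide_le_eq)
  then have k: "i \<le> k" "k \<le> j" using r' tlen_pos by (auto simp: k_def floor_le_iff)  linarith
  have fl: "real_of_int (k - i) \<le> r / T" "r / T < real_of_int (k - i) + 1" by (simp_all add: k_def)
  have "real_of_int (k - i) * T \<le> r" "r < (real_of_int (k - i) + 1) * T"
    using fl tlen_pos by (simp_all add: pos_le_divide_eq pos_divide_less_eq)
  moreover have "real_of_int (k - i) * T \<in> {0..dist (ax i x) (ax j x)}"
    using k tlen_pos by (simp add: dist_axis[OF x ij])
  ultimately have "dist (gseg (ax i x) (ax j x) r) (gseg (ax i x) (ax j x) (real_of_int (k - i) * T)) \<le> T"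
    using dist_gseg[OF r, of "real_of_int (k - i) * T"] by (simp add: algebra_simps)
  then show ?thesis using gseg_axis[OF x k] k by auto
qed

text \<open>One inequality is \<open>quadrilateral\<close> for steps on both axes, the other is
  \<open>CN\<close> at the midpoint \<open>ax t x\<close>. That they agree is the rigidity behind
  flat strips.\<close>

lemma dist_axis_recurrence:
  assumes "x \<in> M" "z \<in> M"
  shows "(dist (ax (t + 1) x) z)\<^sup>2 + (dist (ax (t - 1) x) z)\<^sup>2 = 2 * (dist (ax t x) z)\<^sup>2 + 2 * T\<^sup>2"
proof (rule antisym)
  have "dist (ax t x) (ax 1 z) = dist (ax (t - 1) x) z" "dist (ax (t + 1) x) (ax 1 z) = dist (ax t x) z"
    using dist_ax_shift[of t x 1 z] dist_ax_shift[of "t + 1" x 1 z] by simp_all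
  moreover have "dist (ax t x) (ax (t + 1) x) = T" "dist (ax 1 z) z = T"
    using dist_axis[OF assms(1), of t "t + 1"] dist_axis[OF assms(2), of 0 1] by (simp_all add: dist_commute)
  ultimately show "(dist (ax (t + 1) x) z)\<^sup>2 + (dist (ax (t - 1) x) z)\<^sup>2 \<le> 2 * (dist (ax t x) z)\<^sup>2 + 2 * T\<^sup>2"
    using quadrilateral[of "ax t x" "ax 1 z" "ax (t + 1) x" z] by (simp add: dist_commute)
  have "ax t x = gpt (ax (t - 1) x) (ax (t + 1) x) (1/2)"
    using dist_axis[OF assms(1), of "t - 1" t] dist_axis[OF assms(1), of t "t + 1"] dist_axis[OF assms(1), of "t - 1" "t + 1"]
    by (intro gpt_unique) auto
  then have "(dist z (ax t x))\<^sup>2 \<le> (1/2) * (dist z (ax (t - 1) x))\<^sup>2 + (1/2) * (dist z (ax (t + 1) x))\<^sup>2 - (1/4) * (2 * T)\<^sup>2"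
    using CN[of "1/2" z "ax (t - 1) x" "ax (t + 1) x"] dist_axis[OF assms(1), of "t - 1" "t + 1"] by simp
  then show "2 * (dist (ax t x) z)\<^sup>2 + 2 * T\<^sup>2 \<le> (dist (ax (t + 1) x) z)\<^sup>2 + (dist (ax (t - 1) x) z)\<^sup>2"
    by (simp add: dist_commute power_mult_distrib)
qed

text \<open>In a flat strip this is \<open>- 2 * T\<close> times the coordinate of \<open>z\<close>
  along the axis of \<open>x\<close>, measured from \<open>x\<close>.\<close>

definition slant :: "'a \<Rightarrow> 'a \<Rightarrow> real" where
  "slant x z = (dist (ax 1 x) z)\<^sup>2 - (dist x z)\<^sup>2 - T\<^sup>2"

text \<open>Flat strip: the squared distance from a point to the orbit on a parallel axis is a quadratic
  polynomial; its linear term \<^term>\<open>slant x z\<close> vanishes if \<open>z\<close> projects to \<open>x\<close>.\<close>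

lemma dist_axis_square:
  assumes "x \<in> M" "z \<in> M"
  shows "(dist (ax t x) z)\<^sup>2 = (dist x z)\<^sup>2 + of_int t * slant x z + (of_int t)\<^sup>2 * T\<^sup>2"
proof -
  define f where "f t = (dist (ax t x) z)\<^sup>2 - (real_of_int t)\<^sup>2 * T\<^sup>2" for t
  have "f (t + 1) + f (t - 1) = 2 * f t" for t
    using dist_axis_recurrence[OF assms, of t] by (simp add: f_def power2_eq_square algebra_simps)
  from affine_int_sequence[OF this, of t] show ?thesis by (simp add: f_def slant_def algebra_simps)
qed

lemma slant_ax:
  assumes "x \<in> M" "z \<in> M" shows "slant x (ax k z) = slant x z - 2 * of_int k * T\<^sup>2"
proof -
  have "dist (ax 1 x) (ax k z) = dist (ax (1 - k) x) z" "dist x (ax k z) = dist (ax (- k) x) z"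
    using dist_ax_shift[of 1 x k z] dist_ax_shift[of 0 x k z] by simp_all
  then show ?thesis unfolding slant_def[of x "ax k z"] using dist_axis_square[OF assms]
    by (simp add: power2_eq_square algebra_simps)
qed

text \<open>\<open>CN\<close> seen from \<open>ax t x\<close> gives
  \<open>of_int t * slant x (gpt x u \<theta>) \<le> 0\<close> for both signs of
  \<open>t\<close>.\<close>

lemma slant_gpt:
  assumes "x \<in> M" "u \<in> M" "slant x u = 0" and \<theta>: "0 \<le> \<theta>" "\<theta> \<le> 1"
  shows "slant x (gpt x u \<theta>) = 0"
proof -
  let ?w = "gpt x u \<theta>"
  have w: "?w \<in> M" using assms by (intro gpt_M)
  have d: "dist x ?w = \<theta> * dist x u" by (rule dist_gpt_left[OF \<theta>])
  have "of_int t * slant x ?w \<le> 0" for t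
  proof -
    have "(dist (ax t x) ?w)\<^sup>2 \<le> (1 - \<theta>) * (dist (ax t x) x)\<^sup>2 + \<theta> * (dist (ax t x) u)\<^sup>2 - \<theta> * (1 - \<theta>) * (dist x u)\<^sup>2"
      by (rule CN[OF \<theta>])
    also have "(dist (ax t x) x)\<^sup>2 = (of_int t)\<^sup>2 * T\<^sup>2"
      using dist_ax_ax[OF assms(1), of t 0] by (simp add: power_mult_distrib)
    also have "(dist (ax t x) u)\<^sup>2 = (dist x u)\<^sup>2 + (of_int t)\<^sup>2 * T\<^sup>2" using dist_axis_square[OF assms(1,2)] assms(3) by simp
    finally show ?thesis using dist_axis_square[OF assms(1) w, of t] d by (simp add: power_mult_distrib power2_eq_square algebra_simps)
  qed
  from this[of 1] this[of "-1"] show ?thesis by simp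
qed

lemma slant_commute:
  assumes "x \<in> M" "z \<in> M" shows "slant z x = - slant x z"
proof -
  have "dist (ax 1 z) x = dist (ax (-1) x) z" using dist_ax_shift[of 1 z 1 "ax (-1) x"] dist_ax_shift[of "0" z 1 x]
    using dist_ax_shift[of 0 x 1 z] by (simp add: dist_commute)
  then show ?thesis unfolding slant_def[of z x] using dist_axis_square[OF assms, of "-1"] by (simp add: dist_commute)
qed

text \<open>The two orbits project to the two ends of the perpendicular segment, since no point of
  the segment is nearer to \<open>ax t x\<close> than \<open>x\<close> is. The coordinate along the
  segment thus tells the parallel axes apart.\<close>

lemma coord_orbit:
  assumes "x \<in> M" "w \<in> M" "slant x w = 0"
  shows "coord x w (ax t x) = 0" "coord x w (ax t w) = dist x w"
proof -
  have le: "dist (ax t y) y \<le> dist (ax t y) (gpt y v \<theta>)" if "y \<in> M" "v \<in> M" "slant y v = 0" "0 \<le> \<theta>" "\<theta> \<le> 1" for y v \<theta>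
  proof -
    have "(dist (ax t y) y)\<^sup>2 = (of_int t)\<^sup>2 * T\<^sup>2"
      using dist_ax_ax[OF that(1), of t 0] by (simp add: power_mult_distrib)
    also have "\<dots> \<le> (dist (ax t y) (gpt y v \<theta>))\<^sup>2"
      using dist_axis_square[OF that(1) gpt_M[OF that(1,2,4,5)]] slant_gpt[OF that] by simp
    finally show ?thesis by (simp add: power2_le_iff_abs_le)
  qed
  have \<theta>: "0 \<le> s / dist x w" "s / dist x w \<le> 1" if "s \<in> {0..dist x w}" for s
    using that by (auto simp: divide_le_eq_1)
  show "coord x w (ax t x) = 0"
  proof (rule gcoord_unique[OF geodesic_gseg])
    fix s assume "s \<in> {0..dist x w}"
    then show "dist (ax t x) (gseg x w 0) \<le> dist (ax t x) (gseg x w s)"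
      using le[OF assms \<theta>] by (simp add: gseg_def)
  qed simp
  have "slant w x = 0" using slant_commute[OF assms(1,2)] assms(3) by simp
  show "coord x w (ax t w) = dist x w"
  proof (rule gcoord_unique[OF geodesic_gseg])
    fix s assume "s \<in> {0..dist x w}"
    then show "dist (ax t w) (gseg x w (dist x w)) \<le> dist (ax t w) (gseg x w s)"
      using le[OF assms(2,1) \<open>slant w x = 0\<close>, of "1 - s / dist x w"] \<theta>[of s] gpt_commute[of "s / dist x w" w x]
      by (simp add: gseg_def[of x w s])
  qed simp
qed

text \<open>A far point of \<open>M\<close> is slid along its axis until its slant vanishes; the
  segment from \<open>x\<close> to the point so found stays perpendicular and is cut at length
  \<open>R\<close>.\<close>

lemma perpendicular_point_exists:
  assumes x: "x \<in> M" and far: "\<And>Q. \<exists>p. \<forall>n. Q < dist p (ax n x)" and R: "0 \<le> R"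
  shows "\<exists>w\<in>M. dist x w = R \<and> slant x w = 0"
proof -
  obtain R0 where R0: "\<And>p. \<exists>x\<in>M. dist p x \<le> R0" using M_coarsely_dense by blast
  \<comment> \<open>\<open>R0\<close> pays for moving \<open>p\<close> into \<open>M\<close>, and
    \<open>T\<close> for the slide to slant zero.\<close>
  obtain p where p: "\<And>n. R0 + R + T < dist p (ax n x)" using far by blast
  obtain z where z: "z \<in> M" "dist p z \<le> R0" using R0 by blast
  have zf: "R + T < dist z (ax n x)" for n
    using p[of n] z dist_triangle[of p "ax n x" z] by linarith
  \<comment> \<open>The slant drops by \<open>2 * T\<^sup>2\<close> with each step along the orbit
    of \<open>z\<close>, so it changes sign between \<open>k\<close> and
    \<open>k + 1\<close>.\<close>
  define k where "k = \<lfloor>slant x z / (2 * T\<^sup>2)\<rfloor>"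
  define z1 z2 where "z1 = ax k z" and "z2 = ax (k + 1) z"
  have zM: "z1 \<in> M" "z2 \<in> M" using z by (auto simp: z1_def z2_def intro: ax_M)
  have "of_int k \<le> slant x z / (2 * T\<^sup>2)" "slant x z / (2 * T\<^sup>2) < of_int k + 1" by (simp_all add: k_def)
  then have "2 * of_int k * T\<^sup>2 \<le> slant x z" "slant x z < 2 * (of_int k + 1) * T\<^sup>2"
    using tlen_pos by (simp_all add: pos_le_divide_eq pos_divide_less_eq algebra_simps)
  then have b: "slant x z1 \<ge> 0" "slant x z2 \<le> 0"
    unfolding z1_def z2_def slant_ax[OF x z(1)] by (auto simp: algebra_simps)
  have "continuous_on {0..1} (\<lambda>\<theta>. slant x (gpt z1 z2 \<theta>))"
    unfolding slant_def by (intro continuous_intros continuous_gpt)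
  then obtain \<theta> where \<theta>: "0 \<le> \<theta>" "\<theta> \<le> 1" "slant x (gpt z1 z2 \<theta>) = 0"
    using IVT2'[of "\<lambda>\<theta>. slant x (gpt z1 z2 \<theta>)" 1 0 0] b by auto
  define u where "u = gpt z1 z2 \<theta>"
  have u: "u \<in> M" "slant x u = 0" using zM \<theta> by (auto simp: u_def intro: gpt_M)
  have "dist z1 z2 = T" using dist_axis[OF z(1), of k "k + 1"] by (simp add: z1_def z2_def)
  then have "dist z1 u \<le> T" using \<theta> tlen_pos dist_gpt_left[OF \<theta>(1,2), of z1 z2] by (simp add: u_def mult_left_le_one_le)
  moreover have "dist z1 x = dist z (ax (- k) x)"
    using dist_ax_shift[of 0 x k z] by (simp add: z1_def dist_commute)
  ultimately have xu: "R < dist x u"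
    using zf[of "- k"] dist_triangle[of z1 x u] by (simp add: dist_commute)
  have f: "0 \<le> R / dist x u" "R / dist x u \<le> 1" using xu R by (auto simp: divide_le_eq_1)
  have "dist x (gpt x u (R / dist x u)) = R" using dist_gpt_left[OF f, of x u] xu R by auto
  then show ?thesis using gpt_M[OF x u(1) f] slant_gpt[OF x u f] by blast
qed

text \<open>The orbit segment on the axis of \<open>x\<close> and the one on a parallel axis form
  the long sides of a strip of width \<open>R\<close>, to which
  \<open>card_separating_parallel\<close> applies. The bound is independent of \<open>i\<close> and
  \<open>j\<close>.\<close>

lemma card_transverse:
  assumes c: "pairwise (L_separated L) c" and x: "x \<in> M" and n: "i \<le> j"
    and far: "\<And>Q. \<exists>p. \<forall>n. Q < dist p (ax n x)"
  defines "C \<equiv> {h \<in> c. separates h {ax i x} {ax j x}}"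
  shows "finite C \<and> real (card C) \<le> 4 * T + 4 * real L + 11"
proof -
  \<comment> \<open>Points of an axis are within \<open>T\<close> of its orbit, so both sides
    together lose \<open>2 * T\<close> and a range of \<open>2 * L + 4\<close> is left.\<close>
  define R where "R = 2 * T + 2 * real L + 4"
  obtain w where w: "w \<in> M" "dist x w = R" "slant x w = 0"
    using perpendicular_point_exists[OF x far, of R] tlen_pos by (auto simp: R_def)
  have "finite C \<and> real (card C) \<le> dist (ax i x) (ax i w) + dist (ax j x) (ax j w) + 3"
    unfolding C_def
  proof (rule card_separating_parallel[OF c, of T _ _ x w])
    fix r assume "r \<in> {0..dist (ax i x) (ax j x)}"
    then obtain k where "dist (gseg (ax i x) (ax j x) r) (ax k x) \<le> T" using near_axis[OF x n] by blast
    then show "coord x w (gseg (ax i x) (ax j x) r) \<le> T"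
      using coord_Lipschitz[of x w "gseg (ax i x) (ax j x) r" "ax k x"] coord_orbit(1)[OF x w(1,3), of k] by simp
  next
    fix r assume "r \<in> {0..dist (ax i w) (ax j w)}"
    then obtain k where "dist (gseg (ax i w) (ax j w) r) (ax k w) \<le> T" using near_axis[OF w(1) n] by blast
    then show "T + 2 * real L + 4 \<le> coord x w (gseg (ax i w) (ax j w) r)"
      using coord_Lipschitz[of x w "gseg (ax i w) (ax j w) r" "ax k w"] coord_orbit(2)[OF x w(1,3), of k] w(2)
      by (simp add: R_def)
  qed (use tlen_pos in simp)
  then show ?thesis using w by (simp add: R_def)
qed

text \<open>Suppose a curtain misses \<open>A n\<close>, \<open>A (-n)\<close> and \<open>E\<close>.
  Then the translates of \<open>x\<close> and \<open>y\<close> by the two powers all lie on one side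
  of it, and \<open>x\<close> or \<open>y\<close> lies on the other; so it cuts both arms of the
  axis through that point and belongs to \<open>B x\<close> or \<open>B y\<close>.\<close>

lemma card_L_separated_M:
  assumes c: "pairwise (L_separated L) c" and x: "x \<in> M" and y: "y \<in> M"
    and far: "\<And>Q. \<exists>p. \<forall>n. Q < dist p (ax n x)"
    and sep: "\<And>h. h \<in> c \<Longrightarrow> separates h {x} {y}"
  shows "finite c \<and> real (card c) \<le> 4 * T + 8 * real L + 27"
proof -
  \<comment> \<open>So large that the translated segments are as far away as
    \<open>card_meeting_far_segment\<close> requires.\<close>
  define n where "n = \<lceil>(2 * dist x y + 2 * real L + 4) / T\<rceil>"
  have "(2 * dist x y + 2 * real L + 4) / T \<le> of_int n" by (simp add: n_def)
  then have nT: "2 * dist x y + 2 * real L + 4 \<le> of_int n * T" using tlen_pos by (simp add: pos_divide_le_eq)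
  have "0 < (2 * dist x y + 2 * real L + 4) / T" using tlen_pos by (intro divide_pos_pos) (auto intro: add_nonneg_pos)
  then have n: "0 < n" by (simp add: n_def)
  have dn: "dist z (ax n z) = of_int n * T" "dist z (ax (- n) z) = of_int n * T" "dist (ax (-n) z) z + dist z (ax n z) = dist (ax (-n) z) (ax n z)" if "z \<in> M" for z
    using dist_ax_ax[OF that, of 0 n] dist_ax_ax[OF that, of 0 "-n"] dist_ax_ax[OF that, of "-n" n] n
    by (auto simp: dist_commute algebra_simps)
  define A where "A k = {h \<in> c. separates h {ax k x} {ax k y} \<or> ax k x \<in> h \<or> ax k y \<in> h}" for k
  define B where "B z = {h \<in> c. separates h {z} {ax n z} \<and> separates h {z} {ax (-n) z}}" for z
  define E where "E = {h \<in> c. separates h {ax (-n) x} {ax n x}}"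
  let ?U = "A n \<union> A (-n) \<union> B x \<union> B y \<union> E"
  have "c \<subseteq> ?U"
  proof
    fix h assume h: "h \<in> c"
    show "h \<in> ?U"
    proof (rule ccontr)
      assume not: "\<not> ?thesis"
      then have nA: "ax n x \<notin> h" "ax n y \<notin> h" "ax (-n) x \<notin> h" "ax (-n) y \<notin> h"
        "\<not> separates h {ax n x} {ax n y}" "\<not> separates h {ax (-n) x} {ax (-n) y}" and
        nE: "\<not> separates h {ax (-n) x} {ax n x}" and
        nB: "\<not> (separates h {x} {ax n x} \<and> separates h {x} {ax (-n) x})" "\<not> (separates h {y} {ax n y} \<and> separates h {y} {ax (-n) y})"
        using h by (auto simp: A_def B_def E_def)
      have nE': "\<not> separates h {ax (-n) y} {ax n y}"
        using separates_cases[of h "ax (-n) y" "ax n y" "ax (-n) x"] separates_cases[of h "ax (-n) x" "ax n y" "ax n x"] nA nE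
          separates_commute[of h "{ax (-n) x}" "{ax (-n) y}"] by blast
      from separates_cases[OF sep[OF h] nA(1)] show False
      proof
        assume 1: "separates h {x} {ax n x}"
        then have "separates h {x} {ax (-n) x}" using separates_cases[OF 1 nA(3)] nE by blast
        with 1 nB show False by blast
      next
        assume "separates h {ax n x} {y}"
        then have 1: "separates h {ax n y} {y}" using separates_cases[of h "ax n x" y "ax n y"] nA by blast
        then have "separates h {ax (-n) y} {y}" using separates_cases[OF 1 nA(4)] nE' separates_commute[of h "{ax n y}"] by blast
        with 1 nB show False using separates_commute[of h "{y}"] by blast
      qed
    qed
  qed
  moreover have "finite (?U) \<and> real (card (?U)) \<le>
      1 + 1 + (2 * real L + 7) + (2 * real L + 7) + (4 * T + 4 * real L + 11)"
  proof (intro card_Un_real)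
    show "finite (A n) \<and> real (card (A n)) \<le> 1" "finite (A (-n)) \<and> real (card (A (-n))) \<le> 1"
      unfolding A_def by (rule card_meeting_far_segment[OF c sep]; use dn(1,2)[OF x] nT in simp)+
    show "finite (B x) \<and> real (card (B x)) \<le> 2 * real L + 7" "finite (B y) \<and> real (card (B y)) \<le> 2 * real L + 7"
      unfolding B_def by (rule card_separating_both_sides[OF c dn(3)[OF x]], rule card_separating_both_sides[OF c dn(3)[OF y]])
    show "finite E \<and> real (card E) \<le> 4 * T + 4 * real L + 11"
      unfolding E_def by (rule card_transverse[OF c x _ far]) (use n in simp)
  qed
  ultimately have "finite c \<and> real (card c) \<le> 1 + 1 + (2 * real L + 7) + (2 * real L + 7) + (4 * T + 4 * real L + 11)"
    by (rule card_subset_real[rotated])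
  then show ?thesis by simp
qed

text \<open>Replacing the end points by points of \<open>M\<close> at distance at most
  \<open>R\<close> costs at most \<open>2 * R + 2\<close> curtains.\<close>

lemma card_L_separated:
  assumes far: "\<And>x Q. x \<in> M \<Longrightarrow> \<exists>p. \<forall>n. Q < dist p (ax n x)"
  shows "\<exists>B\<ge>0. \<forall>L c x y. pairwise (L_separated L) c \<and> (\<forall>h\<in>c. separates h {x} {y :: 'a}) \<longrightarrow> real (card c) \<le> B + 8 * real L"
proof -
  obtain R where R: "R \<ge> 0" "\<And>p. \<exists>x\<in>M. dist p x \<le> R" using M_coarsely_dense by blast
  have "real (card c) \<le> (4 * T + 2 * R + 29) + 8 * real L"
    if c: "pairwise (L_separated L) c" and sep: "\<forall>h\<in>c. separates h {x0} {y0 :: 'a}" for L c x0 y0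
  proof -
    have dis: "pairwise disjnt c" by (rule pairwise_L_separated_disjnt[OF c])
    obtain x y where xy: "x \<in> M" "dist x0 x \<le> R" "y \<in> M" "dist y0 y \<le> R" using R(2) by metis
    define E where "E = {h \<in> c. separates h {x} {y}}"
    have E: "finite E \<and> real (card E) \<le> 4 * T + 8 * real L + 27"
      by (rule card_L_separated_M[OF _ xy(1,3) far]) (use pairwise_subset[OF c] xy in \<open>auto simp: E_def\<close>)
    let ?U = "{h\<in>c. x \<in> h} \<union> {h\<in>c. y \<in> h} \<union> {h\<in>c. separates h {x0} {x}} \<union> {h\<in>c. separates h {y0} {y}} \<union> E"
    have "c \<subseteq> ?U"
    proof
      fix h assume "h \<in> c"
      with sep have h: "h \<in> c" "separates h {x0} {y0}" by auto
      then show "h \<in> ?U"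
        using separates_cases[of h x0 y0 x] separates_cases[of h x y0 y] separates_commute[of h "{y}" "{y0}"] by (auto simp: E_def)
    qed
    moreover have "finite (?U) \<and>
       real (card (?U)) \<le> 1 + 1 + dist x0 x + dist y0 y + (4 * T + 8 * real L + 27)"
      by (intro card_Un_real card_containing card_separating dis E)
    ultimately have "finite c \<and> real (card c) \<le> 1 + 1 + dist x0 x + dist y0 y + (4 * T + 8 * real L + 27)" by (rule card_subset_real[rotated])
    then show ?thesis using xy by simp
  qed
  moreover have "4 * T + 2 * R + 29 \<ge> 0" using R tlen_pos by simp
  ultimately show ?thesis by blast
qed

end

context CAT0
begin

subsection \<open>Curtain chains meeting a bounded curtain\<close>

lemma connected_side:
  assumes U: "connected U" "U \<inter> {x. gcoord I \<alpha> x \<in> {r - 1/2..r + 1/2}} = {}" and g: "geodesic I \<alpha>" and m: "p \<in> U" "q \<in> U"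
  shows "gcoord I \<alpha> p > r + 1/2 \<Longrightarrow> gcoord I \<alpha> q > r + 1/2" "gcoord I \<alpha> p < r - 1/2 \<Longrightarrow> gcoord I \<alpha> q < r - 1/2"
proof -
  note c = continuous_gcoord[OF g, of U]
  have no: "z \<notin> U" if "gcoord I \<alpha> z = r + 1/2 \<or> gcoord I \<alpha> z = r - 1/2" for z using U(2) that by auto
  show "gcoord I \<alpha> q > r + 1/2" if "gcoord I \<alpha> p > r + 1/2"
  proof (rule ccontr)
    assume "\<not> ?thesis"
    then have "\<exists>z\<in>U. gcoord I \<alpha> z = r + 1/2" using that by (intro connected_real_image[OF U(1) c m(2,1)]) auto
    then show False using no by blast
  qed
  show "gcoord I \<alpha> q < r - 1/2" if "gcoord I \<alpha> p < r - 1/2"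
  proof (rule ccontr)
    assume "\<not> ?thesis"
    then have "\<exists>z\<in>U. gcoord I \<alpha> z = r - 1/2" using that by (intro connected_real_image[OF U(1) c m]) auto
    then show False using no by blast
  qed
qed

text \<open>The curtain \<open>k\<close> together with the side of it that contains \<open>E\<close>
  is connected. Connectedness makes the side of another curtain independent of the geodesic chosen
  for \<open>k\<close>.\<close>

lemma separates_connected_hull:
  assumes "separates k h E"
  shows "\<exists>U. connected U \<and> k \<subseteq> U \<and> E \<subseteq> U \<and> U \<inter> (h :: 'a set) = {}"
proof -
  obtain I \<alpha> r where d: "curtain_datum I \<alpha> r" and k: "k = {x. gcoord I \<alpha> x \<in> {r - 1/2..r + 1/2}}"
    and *: "(\<forall>x\<in>h. gcoord I \<alpha> x < r - 1/2) \<and> (\<forall>x\<in>E. gcoord I \<alpha> x > r + 1/2) \<or>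
      (\<forall>x\<in>E. gcoord I \<alpha> x < r - 1/2) \<and> (\<forall>x\<in>h. gcoord I \<alpha> x > r + 1/2)"
    using assms unfolding separates_iff by blast
  have g: "geodesic I \<alpha>" using d by (simp add: curtain_datum_def)
  have I: "is_interval I" using g by (simp add: geodesic_def)
  have up: "connected {x. gcoord I \<alpha> x \<in> I \<inter> {r - 1/2..}}"
    by (rule connected_gcoord_vimage[OF g]) (auto intro: is_interval_Int I simp: is_interval_ci)
  have dn: "connected {x. gcoord I \<alpha> x \<in> I \<inter> {..r + 1/2}}"
    by (rule connected_gcoord_vimage[OF g]) (auto intro: is_interval_Int I simp: is_interval_ic)
  from * show ?thesis
  proof
    assume "(\<forall>x\<in>h. gcoord I \<alpha> x < r - 1/2) \<and> (\<forall>x\<in>E. gcoord I \<alpha> x > r + 1/2)"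
    then show ?thesis using up gcoord_mem[OF g] k
      by (intro exI[of _ "{x. gcoord I \<alpha> x \<in> I \<inter> {r - 1/2..}}"]) force
  next
    assume "(\<forall>x\<in>E. gcoord I \<alpha> x < r - 1/2) \<and> (\<forall>x\<in>h. gcoord I \<alpha> x > r + 1/2)"
    then show ?thesis using dn gcoord_mem[OF g] k
      by (intro exI[of _ "{x. gcoord I \<alpha> x \<in> I \<inter> {..r + 1/2}}"]) force
  qed
qed

text \<open>The connected hull of \<open>k\<close> and \<open>E\<close> avoids \<open>h\<close>, so
  \<open>E\<close> lies on the same side of \<open>h\<close> as \<open>k\<close>.\<close>

lemma separates_trans:
  assumes "separates h A k" "separates k h E" "k \<noteq> ({} :: 'a set)"
  shows "separates h A E"
proof -
  obtain I \<alpha> r where d: "curtain_datum I \<alpha> r" and h: "h = {x. gcoord I \<alpha> x \<in> {r - 1/2..r + 1/2}}"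
    and *: "(\<forall>x\<in>A. gcoord I \<alpha> x < r - 1/2) \<and> (\<forall>x\<in>k. gcoord I \<alpha> x > r + 1/2) \<or>
      (\<forall>x\<in>k. gcoord I \<alpha> x < r - 1/2) \<and> (\<forall>x\<in>A. gcoord I \<alpha> x > r + 1/2)"
    using assms(1) unfolding separates_iff by blast
  have g: "geodesic I \<alpha>" using d by (simp add: curtain_datum_def)
  obtain U where U: "connected U" "k \<subseteq> U" "E \<subseteq> U" "U \<inter> h = {}"
    using separates_connected_hull[OF assms(2)] by blast
  obtain p where p: "p \<in> k" using assms(3) by blast
  have "q \<in> E \<Longrightarrow> (gcoord I \<alpha> p > r + 1/2 \<longrightarrow> gcoord I \<alpha> q > r + 1/2) \<and> (gcoord I \<alpha> p < r - 1/2 \<longrightarrow> gcoord I \<alpha> q < r - 1/2)" for q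
    using connected_side[OF U(1) _ g, of r p q] U p h by blast
  then have "(\<forall>x\<in>A. gcoord I \<alpha> x < r - 1/2) \<and> (\<forall>x\<in>E. gcoord I \<alpha> x > r + 1/2) \<or>
      (\<forall>x\<in>E. gcoord I \<alpha> x < r - 1/2) \<and> (\<forall>x\<in>A. gcoord I \<alpha> x > r + 1/2)"
    using * p by blast
  then show ?thesis unfolding separates_iff using d h by blast
qed

text \<open>A chain only promises separation of neighbours. The induction on the gap carries two
  forms at once, with the separating curtain next to the lower or to the upper end; each is extended
  by \<open>separates_trans\<close> with the help of the other.\<close>

lemma chain_separates_far:
  assumes J: "\<And>i j. i \<in> J \<Longrightarrow> j \<in> J \<Longrightarrow> {i..j} \<subseteq> (J :: int set)"
    and cur: "\<And>i. i \<in> J \<Longrightarrow> curtain (k i :: 'a set)"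
    and sep: "\<And>i. i - 1 \<in> J \<Longrightarrow> i \<in> J \<Longrightarrow> i + 1 \<in> J \<Longrightarrow> separates (k i) (k (i - 1)) (k (i + 1))"
    and m: "i \<in> J" "j \<in> J" "i < m" "m < j"
  shows "separates (k m) (k i) (k j)"
proof -
  have mem: "l \<in> J" if "i \<in> J" "j \<in> J" "i \<le> l" "l \<le> j" for i j l using J[of i j] that by auto
  have *: "(i - 1 \<in> J \<longrightarrow> i + 1 + int n \<in> J \<longrightarrow> separates (k i) (k (i - 1)) (k (i + 1 + int n))) \<and>
      (i \<in> J \<longrightarrow> i + 2 + int n \<in> J \<longrightarrow> separates (k (i + 1 + int n)) (k i) (k (i + 2 + int n)))" for i n
  proof (induction n arbitrary: i)
    case 0
    then show ?case using sep[of i] sep[of "i + 1"] mem[of "i - 1" "i + 1" i] mem[of i "i + 2" "i + 1"]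
      by (auto simp: algebra_simps)
  next
    case (Suc n)
    define j where "j = i + 1 + int n"
    have j: "i + 1 + int (Suc n) = j + 1" "i + 2 + int n = j + 1" "i + 2 + int (Suc n) = j + 2"
      "(i + 1) + 1 + int n = j + 1" "(i + 1) + 2 + int n = j + 2"
      by (simp_all add: j_def)
    have P: "separates (k i) (k (i - 1)) (k (j + 1))" if "i - 1 \<in> J" "j + 1 \<in> J"
    proof (rule separates_trans)
      have "j \<in> J" "i \<in> J" using mem[OF that] by (auto simp: j_def)
      then show "separates (k i) (k (i - 1)) (k j)" "separates (k j) (k i) (k (j + 1))" "k j \<noteq> {}"
        using Suc[of i] that j curtain_nonempty[OF cur] by (auto simp flip: j_def)
    qed
    have Q: "separates (k (j + 1)) (k (j + 2)) (k i)" if "i \<in> J" "j + 2 \<in> J"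
    proof (rule separates_trans)
      have "j + 1 \<in> J" "i + 1 \<in> J" using mem[OF that] by (auto simp: j_def)
      then show "separates (k (j + 1)) (k (j + 2)) (k (i + 1))" "separates (k (i + 1)) (k (j + 1)) (k i)" "k (i + 1) \<noteq> {}"
        using Suc[of "i + 1", unfolded j] that curtain_nonempty[OF cur] separates_commute[of "k (j + 1)" "k (j + 2)"]
          separates_commute[of "k (i + 1)" "k (j + 1)"] by auto
    qed
    show ?case unfolding j using P Q separates_commute[of "k (j + 1)" "k i"] by blast
  qed
  have "m - 1 \<in> J" "m \<in> J" "m + 1 \<in> J" using mem[of i j] m by auto
  have Q: "separates (k m) (k i) (k (m + 1))"
    using *[of i "nat (m - i - 1)"] m \<open>m + 1 \<in> J\<close> by (auto simp: algebra_simps)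
  show ?thesis
  proof (cases "j = m + 1")
    case False
    have "separates (k (m + 1)) (k m) (k j)"
      using *[of "m + 1" "nat (j - m - 2)"] m \<open>m \<in> J\<close> False by (auto simp: algebra_simps)
    then show ?thesis using separates_trans[OF Q] curtain_nonempty[OF cur[OF \<open>m + 1 \<in> J\<close>]] by blast
  qed (use Q in simp)
qed

lemma card_int_diff_le:
  assumes "\<And>i j. i \<in> J \<Longrightarrow> j \<in> J \<Longrightarrow> i < j \<Longrightarrow> j - i \<le> (N::int)" "0 \<le> N"
  shows "finite J \<and> int (card J) \<le> N + 1"
proof (cases "J = {}")
  case False
  then obtain j0 where j0: "j0 \<in> J" by blast
  have "j \<in> {j0 - N..j0 + N}" if "j \<in> J" for j
    using assms(1)[OF j0 that] assms(1)[OF that j0] assms(2) by force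
  then have fin: "finite J" by (meson finite_atLeastAtMost_int finite_subset subsetI)
  have "J \<subseteq> {Min J..Max J}" using fin by auto
  then have "card J \<le> card {Min J..Max J}" by (intro card_mono) auto
  moreover have "Max J - Min J \<le> N"
    using assms(1)[of "Min J" "Max J"] assms(2) fin False Min_in[OF fin False] Max_in[OF fin False] by force
  ultimately show ?thesis using fin assms(2) by auto
qed (use assms in simp)

text \<open>The members strictly between two members of the chain are disjoint and separate a point
  of \<open>h\<close> from another, so there are at most \<open>W\<close> of them. Hence indices
  differ by at most \<open>W + 1\<close>, and there are at most \<open>W + 2\<close>.\<close>

lemma card_chain_meeting_bounded:
  assumes c: "curtain_chain c" and meet: "\<And>k. k \<in> c \<Longrightarrow> k \<inter> h \<noteq> {}" and W: "\<And>p q. p \<in> h \<Longrightarrow> q \<in> h \<Longrightarrow> dist p q \<le> W" "0 \<le> W"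
  shows "finite c \<and> real (card (c :: 'a set set)) \<le> W + 2"
proof -
  from c obtain J :: "int set" and k where "(\<forall>i\<in>J. \<forall>j\<in>J. {i..j} \<subseteq> J) \<and> bij_betw k J c \<and> (\<forall>i\<in>J. curtain (k i)) \<and>
      (\<forall>i. i - 1 \<in> J \<and> i \<in> J \<and> i + 1 \<in> J \<longrightarrow> separates (k i) (k (i - 1)) (k (i + 1)))"
    unfolding curtain_chain_def by (elim exE)
  then have J: "\<And>i j. i \<in> J \<Longrightarrow> j \<in> J \<Longrightarrow> {i..j} \<subseteq> J" and b: "bij_betw k J c"
    and cur: "\<And>i. i \<in> J \<Longrightarrow> curtain (k i)"
    and sep: "\<And>i. i - 1 \<in> J \<Longrightarrow> i \<in> J \<Longrightarrow> i + 1 \<in> J \<Longrightarrow> separates (k i) (k (i - 1)) (k (i + 1))"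
    by simp_all
  have far: "separates (k m) (k i) (k j)" if "i \<in> J" "j \<in> J" "i < m" "m < j" for i j m
    by (rule chain_separates_far[where J = J and k = k and i = i and j = j, OF _ _ _ that]) (fact J cur sep)+
  have diff: "j - i \<le> \<lfloor>W + 1\<rfloor>" if ij: "i \<in> J" "j \<in> J" "i < j" for i j
  proof -
    have "k i \<in> c" "k j \<in> c" using b ij by (auto simp: bij_betw_def)
    then obtain p q where p: "p \<in> k i" "p \<in> h" and q: "q \<in> k j" "q \<in> h" using meet by blast
    have sub: "{i<..<j} \<subseteq> J" using J[OF ij(1,2)] by auto
    have dis: "disjnt (k m) (k m')" if "m \<in> {i<..<j}" "m' \<in> {i<..<j}" "m < m'" for m m'
    proof -
      have sep: "separates (k m') (k m) (k j)" using far[OF subsetD[OF sub that(1)] ij(2), of m'] that by auto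
      have "y \<notin> k m'" if "y \<in> k m" for y
        using separates_point[OF sep that q(1)] separates_not_mem(1) by blast
      then show ?thesis unfolding disjnt_def by blast
    qed
    have "pairwise disjnt (k ` {i<..<j})"
    proof (rule pairwiseI)
      fix y z assume "y \<in> k ` {i<..<j}" "z \<in> k ` {i<..<j}" "y \<noteq> z"
      then obtain m m' where m: "m \<in> {i<..<j}" "m' \<in> {i<..<j}" "y = k m" "z = k m'" "m \<noteq> m'" by blast
      then show "disjnt y z" using dis[of m m'] dis[of m' m] disjnt_sym by (cases "m < m'") auto
    qed
    moreover have "separates h' {p} {q}" if h': "h' \<in> k ` {i<..<j}" for h'
    proof -
      obtain m where "m \<in> {i<..<j}" "h' = k m" using h' by blast
      then show ?thesis using separates_point[OF far[of i j m] p(1) q(1)] ij by simp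
    qed
    ultimately have "real (card (k ` {i<..<j})) \<le> dist p q" using card_disjoint_separating by blast
    also have "\<dots> \<le> W" using W p q by blast
    also have "card (k ` {i<..<j}) = nat (j - i - 1)"
      using b sub by (subst card_image) (auto simp: bij_betw_def intro: inj_on_subset)
    finally have "real_of_int (j - i) \<le> W + 1" using ij by simp
    then show ?thesis by (simp only: le_floor_iff)
  qed
  have "finite J \<and> int (card J) \<le> \<lfloor>W + 1\<rfloor> + 1" by (rule card_int_diff_le) (use diff W in auto)
  moreover have "card c = card J" "finite c \<longleftrightarrow> finite J" using bij_betw_same_card[OF b] bij_betw_finite[OF b] by auto
  ultimately show ?thesis by (auto simp: le_floor_iff) linarith
qed

subsection \<open>Bounds for the curtain model\<close>

lemma summable_weights:
  assumes "curtain_weights lam"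
  shows "summable (\<lambda>L. lam (Suc L))" "summable (\<lambda>L. real (Suc L) * lam (Suc L))"
proof -
  have pos: "0 \<le> lam (Suc L)" for L using assms unfolding curtain_weights_def by (simp add: less_imp_le)
  have s: "summable (\<lambda>L. real (Suc L) ^ 2 * lam (Suc L))" using assms by (simp add: curtain_weights_def)
  have "1 * lam (Suc L) \<le> real (Suc L)^2 * lam (Suc L)" for L
    by (intro mult_right_mono pos one_le_power) simp
  then show "summable (\<lambda>L. lam (Suc L))" using pos
    by (intro summable_comparison_test'[OF s, of 0]) auto
  have "real (Suc L) * lam (Suc L) \<le> real (Suc L)^2 * lam (Suc L)" for L
    by (intro mult_right_mono pos self_le_power) auto
  then show "summable (\<lambda>L. real (Suc L) * lam (Suc L))" using pos
    by (intro summable_comparison_test'[OF s, of 0]) auto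
qed

lemma
  assumes w: "curtain_weights lam"
  shows summable_curtain_model_dist: "summable (\<lambda>L. lam (Suc L) * real (curtain_dist (Suc L) x (y :: 'a)))"
    and curtain_model_dist_le: "curtain_model_dist lam x y \<le> (\<Sum>L. lam (Suc L)) * (1 + dist x y)"
proof -
  have pos: "0 \<le> lam (Suc L)" for L using w unfolding curtain_weights_def by (simp add: less_imp_le)
  have le: "lam (Suc L) * real (curtain_dist (Suc L) x y) \<le> lam (Suc L) * (1 + dist x y)" for L
    by (intro mult_left_mono curtain_dist_le_dist pos)
  have s: "summable (\<lambda>L. lam (Suc L) * (1 + dist x y))"
    by (rule summable_mult2) (rule summable_weights[OF w])
  show s': "summable (\<lambda>L. lam (Suc L) * real (curtain_dist (Suc L) x y))"
    by (rule summable_comparison_test'[OF s, of 0]) (use le pos in auto)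
  show "curtain_model_dist lam x y \<le> (\<Sum>L. lam (Suc L)) * (1 + dist x y)"
    unfolding curtain_model_dist_def suminf_mult2[OF summable_weights(1)[OF w]] by (rule suminf_le[OF le s' s])
qed

lemma curtain_model_dist_ge:
  assumes w: "curtain_weights lam"
  shows "lam (Suc L) * real (curtain_dist (Suc L) x (y :: 'a)) \<le> curtain_model_dist lam x y"
proof -
  have pos: "0 \<le> lam (Suc L)" for L using w unfolding curtain_weights_def by (simp add: less_imp_le)
  have "sum (\<lambda>L. lam (Suc L) * real (curtain_dist (Suc L) x y)) {L} \<le> (\<Sum>L. lam (Suc L) * real (curtain_dist (Suc L) x y))"
    by (rule sum_le_suminf[OF summable_curtain_model_dist[OF w]]) (use pos in auto)
  then show ?thesis by (simp add: curtain_model_dist_def)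
qed

lemma curtain_dist_commute: "curtain_dist L x y = curtain_dist L y (x :: 'a)"
  using separates_commute[of _ "{x}" "{y}"] by (simp add: curtain_dist_def)

lemma curtain_model_dist_commute: "curtain_model_dist lam x y = curtain_model_dist lam y (x :: 'a)"
  by (simp add: curtain_model_dist_def curtain_dist_commute[of _ x y])

end

section \<open>The curtain model beside an axis: bounded or a quasi-line\<close>

context axial
begin

text \<open>Each \<open>curtain_dist L\<close> is bounded by a linear function of \<open>L\<close>,
  and the weights are summable against such functions.\<close>

lemma bounded_curtain_model:
  assumes w: "curtain_weights lam" and far: "\<And>x Q. x \<in> M \<Longrightarrow> \<exists>p. \<forall>n. Q < dist p (ax n x)"
  shows "\<not> unbounded_metric (curtain_model_dist lam :: 'a \<Rightarrow> 'a \<Rightarrow> real)"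
proof -
  have pos: "0 \<le> lam (Suc L)" for L using w unfolding curtain_weights_def by (simp add: less_imp_le)
  obtain B where B: "B \<ge> 0" "\<And>L c x y. pairwise (L_separated L) c \<Longrightarrow> (\<forall>h\<in>c. separates h {x} {y :: 'a}) \<Longrightarrow> real (card c) \<le> B + 8 * real L"
    using card_L_separated[OF far] by blast
  have cd: "real (curtain_dist L x y) \<le> (1 + B) + 8 * real L" for L and x y :: 'a
  proof -
    have "curtain_dist L x y \<le> 1 + nat \<lfloor>B + 8 * real L\<rfloor>"
    proof (rule curtain_dist_le)
      fix c :: "'a set set" assume "L_chain L c" and s: "\<forall>h\<in>c. separates h {x} {y}"
      then have "pairwise (L_separated L) c" by (auto simp: L_chain_def pairwise_def)
      from B(2)[OF this s] show "card c \<le> nat \<lfloor>B + 8 * real L\<rfloor>" by (rule le_nat_floor)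
    qed
    then have "real (curtain_dist L x y) \<le> 1 + real (nat \<lfloor>B + 8 * real L\<rfloor>)" by linarith
    also have "\<dots> \<le> 1 + (B + 8 * real L)" using of_nat_floor[of "B + 8 * real L"] B(1) by simp
    finally show ?thesis by simp
  qed
  have s: "summable (\<lambda>L. (1 + B) * lam (Suc L) + 8 * (real (Suc L) * lam (Suc L)))"
    by (intro summable_add summable_mult summable_weights[OF w])
  have "curtain_model_dist lam x y \<le> (\<Sum>L. (1 + B) * lam (Suc L) + 8 * (real (Suc L) * lam (Suc L)))" for x y :: 'a
    unfolding curtain_model_dist_def
  proof (rule suminf_le[OF _ summable_curtain_model_dist[OF w] s])
    fix L
    have "lam (Suc L) * real (curtain_dist (Suc L) x y) \<le> lam (Suc L) * ((1 + B) + 8 * real (Suc L))"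
      by (intro mult_left_mono cd pos)
    then show "lam (Suc L) * real (curtain_dist (Suc L) x y) \<le> (1 + B) * lam (Suc L) + 8 * (real (Suc L) * lam (Suc L))"
      by (simp add: algebra_simps)
  qed
  then show ?thesis unfolding unbounded_metric_def by blast
qed

text \<open>Conversely, an orbit point with coordinate strictly inside the segment is one of the
  points from \<open>n\<close> to \<open>m\<close>.\<close>

lemma coord_beyond_axis:
  assumes x: "x \<in> M" and nm: "n \<le> m"
  defines "u \<equiv> ax n x" and "v \<equiv> ax m x"
  shows "k \<le> n \<Longrightarrow> coord u v (ax k x) = 0" "m \<le> k \<Longrightarrow> coord u v (ax k x) = dist u v"
proof -
  have d: "dist u v = real_of_int (m - n) * T" unfolding u_def v_def by (rule dist_axis[OF x nm])
  show "coord u v (ax k x) = 0" if k: "k \<le> n"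
  proof (rule gcoord_unique[OF geodesic_gseg])
    fix s assume s: "s \<in> {0..dist u v}"
    have "dist (ax k x) v = dist (ax k x) u + dist u v"
      using dist_axis[OF x, of k m] dist_axis[OF x, of k n] k nm d by (simp add: u_def v_def algebra_simps)
    moreover have "dist (gseg u v s) v = dist u v - s" using dist_gseg[of s u v "dist u v"] s by auto
    ultimately show "dist (ax k x) (gseg u v 0) \<le> dist (ax k x) (gseg u v s)"
      using dist_triangle[of "ax k x" v "gseg u v s"] s by simp
  qed simp
  show "coord u v (ax k x) = dist u v" if k: "m \<le> k"
  proof (rule gcoord_unique[OF geodesic_gseg])
    fix s assume s: "s \<in> {0..dist u v}"
    have "dist u (ax k x) = dist u v + dist v (ax k x)"
      using dist_axis[OF x, of n k] dist_axis[OF x, of m k] k nm d by (simp add: u_def v_def algebra_simps)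
    moreover have "dist u (gseg u v s) = s" using dist_gseg[of 0 u v s] s by auto
    ultimately show "dist (ax k x) (gseg u v (dist u v)) \<le> dist (ax k x) (gseg u v s)"
      using dist_triangle[of u "ax k x" "gseg u v s"] s by (simp add: dist_commute)
  qed simp
qed

text \<open>Away from the ends, a point is within \<open>Q\<close> of an orbit point on the segment
  itself, whose coordinate differs by at most \<open>Q\<close>; so it is within \<open>2 * Q\<close>
  of its own foot. The two feet are at most 1 apart.\<close>

lemma dist_same_curtain_le:
  assumes x: "x \<in> M" and nm: "n \<le> m" and near: "\<And>p. \<exists>k. dist p (ax k x) \<le> Q"
  defines "u \<equiv> ax n x" and "v \<equiv> ax m x"
  assumes p: "Q < coord u v p" "coord u v p < dist u v - Q" and q: "Q < coord u v q" "coord u v q < dist u v - Q"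
    and pq: "\<bar>coord u v p - coord u v q\<bar> \<le> 1"
  shows "dist p q \<le> 4 * Q + 1"
proof -
  have close: "dist y (gseg u v (coord u v y)) \<le> 2 * Q" if y: "Q < coord u v y" "coord u v y < dist u v - Q" for y
  proof -
    obtain k where k: "dist y (ax k x) \<le> Q" using near by blast
    then have lip: "\<bar>coord u v y - coord u v (ax k x)\<bar> \<le> Q" using coord_Lipschitz[of u v y "ax k x"] by linarith
    then have nk: "n \<le> k" "k \<le> m"
      using coord_beyond_axis[OF x nm, of k] y unfolding u_def v_def by fastforce+
    define s where "s = real_of_int (k - n) * T"
    have g: "gseg u v s = ax k x" unfolding u_def v_def s_def by (rule gseg_axis[OF x nk])
    have s: "0 \<le> s" "s \<le> dist u v" using nk tlen_pos dist_axis[OF x nm] by (auto simp: s_def u_def v_def)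
    have "coord u v (ax k x) = s" using coord_gseg[OF s] g by simp
    moreover have "0 \<le> coord u v y" "coord u v y \<le> dist u v" using gcoord_mem[OF geodesic_gseg, of u v y] by auto
    ultimately have "dist (gseg u v s) (gseg u v (coord u v y)) \<le> Q" using dist_gseg[of s u v "coord u v y"] s lip by auto
    then show ?thesis using dist_triangle[of y "gseg u v (coord u v y)" "ax k x"] k g by simp
  qed
  have "coord u v p \<in> {0..dist u v}" "coord u v q \<in> {0..dist u v}" using gcoord_mem[OF geodesic_gseg, of u v] by auto
  then have "dist (gseg u v (coord u v p)) (gseg u v (coord u v q)) \<le> 1" using pq by (simp add: dist_gseg)
  then show ?thesis
    using close[OF p] close[OF q] dist_triangle[of p q "gseg u v (coord u v p)"]
      dist_triangle[of "gseg u v (coord u v p)" q "gseg u v (coord u v q)"] by (simp add: dist_commute)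
qed

text \<open>The curtains dual to the axis have diameter at most \<open>4 * Q + 1\<close>, so a chain
  that meets one of them has at most \<open>4 * Q + 3\<close> members, and the dual chain is an
  \<open>L\<close>-chain.\<close>

lemma curtain_dist_axis_ge:
  assumes x: "x \<in> M" and near: "\<And>p. \<exists>k. dist p (ax k x) \<le> Q" and Q: "0 \<le> Q"
    and L: "4 * Q + 3 \<le> real L"
    and nm: "n < m" and p: "dist p (ax n x) \<le> Q" and q: "dist q (ax m x) \<le> Q" and pq: "p \<noteq> q"
  shows "(real_of_int (m - n) * T - 2 * Q) / 2 - 1 \<le> real (curtain_dist L p q)"
proof -
  define u v where "u = ax n x" and "v = ax m x"
  have d: "dist u v = real_of_int (m - n) * T" unfolding u_def v_def using nm by (intro dist_axis[OF x]) simp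
  define k where "k = nat \<lfloor>(dist u v - 2 * Q) / 2\<rfloor>"
  have k1: "(dist u v - 2 * Q) / 2 - 1 \<le> real k" unfolding k_def by linarith
  show ?thesis
  proof (cases "k = 0")
    case True
    then show ?thesis using k1 d by (simp add: field_simps)
  next
    case False
    then have "real k = of_int \<lfloor>(dist u v - 2 * Q) / 2\<rfloor>" by (simp add: k_def)
    then have k2: "2 * real k \<le> dist u v - 2 * Q" using of_int_floor_le[of "(dist u v - 2 * Q) / 2"] by simp
    \<comment> \<open>Starting at \<open>Q + 1\<close> with spacing 2, the \<open>k\<close> curtains
      keep all their coordinates more than \<open>Q\<close> away from both ends, where
      \<open>dist_same_curtain_le\<close> applies.\<close>
    let ?I = "{0..dist u v}" and ?g = "gseg u v" and ?r = "Q + 1"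
    have rng: "Q + 1 \<le> ?r + 2 * real j" "?r + 2 * real j \<le> dist u v - Q - 1" if "j < k" for j
    proof -
      have "real j \<le> real k - 1" using that by linarith
      then show "Q + 1 \<le> ?r + 2 * real j" "?r + 2 * real j \<le> dist u v - Q - 1" using k2 by auto
    qed
    have dat: "curtain_datum ?I ?g (?r + 2 * real j)" if "j < k" for j
      using rng[OF that] Q by (intro curtain_datum_gseg) auto
    let ?c = "dual_chain ?I ?g ?r k"
    have chain: "?c = (\<lambda>j. dual_curtain ?I ?g (?r + 2 * real j)) ` {..<k}"
      by (rule dual_chain_def) (rule dat)
    have bounded: "dist y z \<le> 4 * Q + 1" if h: "h \<in> ?c" "y \<in> h" "z \<in> h" for h y z
    proof -
      obtain j where j: "j < k" "h = dual_curtain ?I ?g (?r + 2 * real j)" using h(1) unfolding chain by auto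
      have "coord u v y \<in> {?r + 2 * real j - 1/2..?r + 2 * real j + 1/2}" "coord u v z \<in> {?r + 2 * real j - 1/2..?r + 2 * real j + 1/2}"
        using h j(2) dual_curtain_eq[OF dat[OF j(1)]] by auto
      then show ?thesis using rng[OF j(1)] nm near
        by (intro dist_same_curtain_le[OF x, of n m Q y z]) (auto simp flip: u_def v_def)
    qed
    have "L_chain L ?c" unfolding L_chain_def
    proof (intro conjI ballI impI)
      show "curtain_chain ?c" by (rule curtain_chain_dual_chain[OF dat])
      fix h h' assume h: "h \<in> ?c" "h' \<in> ?c" "h \<noteq> h'"
      obtain i j where ij: "i < k" "h = dual_curtain ?I ?g (?r + 2 * real i)" "j < k" "h' = dual_curtain ?I ?g (?r + 2 * real j)"
        using h unfolding chain by auto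
      show "L_separated L h h'" unfolding L_separated_def
      proof (intro conjI allI impI)
        show "curtain h" "curtain h'" using ij dat unfolding curtain_def by blast+
        show "h \<inter> h' = {}" using dual_curtain_disjoint[OF dat ij(1,3)] ij h(3) by auto
        fix c assume c: "curtain_chain c \<and> (\<forall>k\<in>c. k \<inter> h \<noteq> {} \<and> k \<inter> h' \<noteq> {})"
        have "finite c \<and> real (card c) \<le> (4 * Q + 1) + 2"
          by (rule card_chain_meeting_bounded[of c h]) (use c bounded[OF h(1)] Q in auto)
        then show "finite c" "card c \<le> L" using L by auto
      qed
    qed
    moreover have "\<forall>h\<in>?c. separates h {p} {q}"
    proof
      fix h assume h: "h \<in> ?c"
      show "separates h {p} {q}"
      proof (rule dual_chain_separates[OF _ h])
        show "curtain_datum ?I ?g (?r + 2 * real j)" if "j < k" for j by (rule dat[OF that])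
        show "coord u v p < ?r - 1/2" using coord_Lipschitz[of u v p u] p by (simp add: u_def)
        show "?r + 2 * real k - 3/2 < coord u v q" using coord_Lipschitz[of u v q v] q k2 by (simp add: v_def)
      qed
    qed
    ultimately have "card ?c \<le> curtain_dist L p q" using pq by (rule curtain_dist_ge)
    then show ?thesis using card_dual_chain[OF dat] k1 d by simp
  qed
qed

text \<open>The map to the line is the position of a nearby orbit point. The upper bound on the
  model comes from \<open>curtain_model_dist_le\<close>, the lower one from a single
  summand.\<close>

lemma quasi_line_curtain_model:
  assumes w: "curtain_weights lam" and x: "x \<in> M" and near: "\<And>p. \<exists>k. dist p (ax k x) \<le> Q"
  shows "quasi_line (curtain_model_dist lam :: 'a \<Rightarrow> 'a \<Rightarrow> real)"
proof -
  obtain n where n: "\<And>p. dist p (ax (n p) x) \<le> Q" using near by metis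
  have Q: "0 \<le> Q" using n[of x] zero_le_dist order_trans by blast
  define f where "f p = real_of_int (n p) * T" for p
  let ?D = "curtain_model_dist lam"
  define S where "S = (\<Sum>L. lam (Suc L))"
  \<comment> \<open>The summands of the model are indexed by \<open>Suc L\<close>, so it is
    \<open>Suc L\<close> that has to reach \<open>4 * Q + 3\<close>.\<close>
  define L where "L = nat \<lceil>4 * Q + 3\<rceil>"
  have L: "4 * Q + 3 \<le> real (Suc L)" unfolding L_def by linarith
  define l where "l = lam (Suc L)"
  have l: "0 < l" using w by (simp add: l_def curtain_weights_def)
  have pos: "0 \<le> lam (Suc L)" for L using w unfolding curtain_weights_def by (simp add: less_imp_le)
  have S: "0 \<le> S" unfolding S_def by (rule suminf_nonneg[OF summable_weights(1)[OF w]]) (rule pos)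
  have df: "dist (f p) (f q) = dist (ax (n p) x) (ax (n q) x)" for p q
    using dist_ax_ax[OF x, of "n p" "n q"] tlen_pos by (simp add: f_def dist_real_def abs_mult flip: left_diff_distrib)
  have up: "?D p q \<le> S * (1 + 2 * Q) + S * dist (f p) (f q)" for p q
  proof -
    have "dist p q \<le> dist p (ax (n p) x) + dist (ax (n p) x) (ax (n q) x) + dist (ax (n q) x) q"
      using dist_triangle[of p q "ax (n p) x"] dist_triangle[of "ax (n p) x" q "ax (n q) x"] by linarith
    then have "dist p q \<le> 2 * Q + dist (f p) (f q)" unfolding df using n[of p] n[of q] by (simp add: dist_commute)
    then have "S * (1 + dist p q) \<le> S * (1 + 2 * Q + dist (f p) (f q))" using S by (intro mult_left_mono) auto
    moreover have "?D p q \<le> S * (1 + dist p q)" unfolding S_def by (rule curtain_model_dist_le[OF w])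
    ultimately show ?thesis by (simp add: algebra_simps)
  qed
  have D0: "0 \<le> ?D p q" for p q :: 'a
    using curtain_model_dist_ge[OF w, of 0 p q] pos[of 0] by (meson mult_nonneg_nonneg of_nat_0_le_iff order_trans)
  have lt: "dist (f p) (f q) \<le> 2 / l * ?D p q + (2 * Q + 2)" if "n p < n q" for p q
  proof (cases "p = q")
    case False
    have "(dist (f p) (f q) - 2 * Q) / 2 - 1 \<le> real (curtain_dist (Suc L) p q)"
      unfolding df using curtain_dist_axis_ge[OF x near Q L that n n False] dist_axis[OF x, of "n p" "n q"] that by simp
    then have "l * ((dist (f p) (f q) - 2 * Q) / 2 - 1) \<le> l * real (curtain_dist (Suc L) p q)" using l by simp
    also have "\<dots> \<le> ?D p q" unfolding l_def by (rule curtain_model_dist_ge[OF w])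
    finally show ?thesis using l by (simp add: field_simps)
  qed (use that in simp)
  have lo: "dist (f p) (f q) \<le> 2 / l * ?D p q + (2 * Q + 2)" for p q
  proof (cases "n p" "n q" rule: linorder_cases)
    case less then show ?thesis by (rule lt)
  next
    case equal
    then show ?thesis using l Q D0[of p q] by (simp add: f_def)
  next
    case greater
    then show ?thesis using lt[of q p] curtain_model_dist_commute[of lam p q] by (simp add: dist_commute)
  qed
  have sur: "\<exists>p. dist z (f p) \<le> T + 2 * Q" for z
  proof -
    define k where "k = \<lfloor>z / T\<rfloor>"
    let ?p = "ax k x"
    have k: "real_of_int k \<le> z / T" "z / T < real_of_int k + 1" by (simp_all add: k_def)
    then have "real_of_int k * T \<le> z" "z < (real_of_int k + 1) * T"
      using tlen_pos by (simp_all add: pos_le_divide_eq pos_divide_less_eq)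
    then have "\<bar>z - real_of_int k * T\<bar> \<le> T" by (simp add: algebra_simps)
    moreover have "\<bar>real_of_int k * T - f ?p\<bar> = dist (ax k x) (ax (n ?p) x)"
      using dist_ax_ax[OF x, of k "n ?p"] tlen_pos by (simp add: f_def abs_mult flip: left_diff_distrib)
    ultimately have "dist z (f ?p) \<le> T + 2 * Q" using n[of ?p] Q by (simp add: dist_real_def)
    then show ?thesis by blast
  qed
  define K where "K = max 1 (max S (2 / l))"
  define C where "C = max (S * (1 + 2 * Q)) (max (2 * Q + 2) (T + 2 * Q))"
  have K: "1 \<le> K" "S \<le> K" "2 / l \<le> K" by (auto simp: K_def)
  have C: "S * (1 + 2 * Q) \<le> C" "2 * Q + 2 \<le> C" "T + 2 * Q \<le> C" "0 \<le> C" using Q by (auto simp: C_def)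
  have "quasi_isometry ?D dist f"
    unfolding quasi_isometry_def
  proof (rule exI[of _ K], rule conjI[OF K(1)], rule exI[of _ C], rule conjI[OF C(4)], intro conjI allI)
    fix p q
    have "S * dist (f p) (f q) \<le> K * dist (f p) (f q)" using K by (intro mult_right_mono) auto
    then have "?D p q \<le> C + K * dist (f p) (f q)" using up[of p q] C by linarith
    \<comment> \<open>\<open>quasi_isometry\<close> subtracts \<open>C\<close> after the division by
      \<open>K\<close>, so the additive constant is enlarged before dividing.\<close>
    also have "C \<le> K * C" using K C mult_right_mono[of 1 K C] by simp
    finally have "?D p q \<le> K * C + K * dist (f p) (f q)" by simp
    then show "?D p q / K - C \<le> dist (f p) (f q)" using K by (simp add: field_simps)
    have "2 / l * ?D p q \<le> K * ?D p q" using K D0 by (intro mult_right_mono) auto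
    then show "dist (f p) (f q) \<le> K * ?D p q + C" using lo[of p q] C by linarith
  next
    fix z show "\<exists>p. dist z (f p) \<le> C" using sur[of z] C by (meson order_trans)
  qed
  then show ?thesis unfolding quasi_line_def by blast
qed

end

section \<open>Consequences for the rank of the coarse kernel\<close>

context axial
begin

lemma near_axis_or_bounded:
  assumes "curtain_weights lam" "unbounded_metric (curtain_model_dist lam :: 'a \<Rightarrow> 'a \<Rightarrow> real)"
  shows "\<exists>x\<in>M. \<exists>Q. \<forall>p. \<exists>n. dist p (ax n x) \<le> Q"
proof (rule ccontr)
  assume "\<not> ?thesis"
  then have "\<And>x Q. x \<in> M \<Longrightarrow> \<exists>p. \<forall>n. Q < dist p (ax n x)" by (simp add: not_le)
  then show False using bounded_curtain_model[OF assms(1)] assms(2) by blast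
qed

lemma quasi_line_if_unbounded:
  assumes "curtain_weights lam" "unbounded_metric (curtain_model_dist lam :: 'a \<Rightarrow> 'a \<Rightarrow> real)"
  shows "quasi_line (curtain_model_dist lam :: 'a \<Rightarrow> 'a \<Rightarrow> real)"
proof -
  obtain x Q where "x \<in> M" "\<forall>p. \<exists>n. dist p (ax n x) \<le> Q" using near_axis_or_bounded[OF assms] by blast
  then show ?thesis by (intro quasi_line_curtain_model[OF assms(1), of x Q]) simp_all
qed

text \<open>Each power of \<open>b\<close>, corrected by a suitable power of \<open>a\<close>, moves
  \<open>x\<close> by at most \<open>Q\<close>. Only finitely many elements do so; two equal
  corrected powers give the claim.\<close>

lemma power_in_axis_subgroup:
  assumes near: "\<And>p. \<exists>n. dist p (ax n x) \<le> Q" and b: "b \<in> carrier G"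
  shows "\<exists>k\<ge>1. \<exists>m::int. b [^] (k::nat) = a [^] m"
proof -
  have "\<forall>k::nat. \<exists>n. dist (\<phi> (b [^] k) x) (ax n x) \<le> Q" using near by blast
  then obtain m where m: "\<And>k::nat. dist (\<phi> (b [^] k) x) (ax (m k) x) \<le> Q" by metis
  define u where "u k = inv (a [^] m k) \<otimes> b [^] k" for k
  have "u k \<in> {g \<in> carrier G. dist x (\<phi> g x) \<le> Q}" for k
    using m[of k] dist_act_inv[of "a [^] m k" "\<phi> (b [^] k) x" x] a_carrier b
    by (simp add: u_def act_mult ax_def dist_commute)
  then have "range u \<subseteq> {g \<in> carrier G. dist x (\<phi> g x) \<le> Q}" by (rule image_subsetI)
  then have "finite (range u)" by (rule finite_subset) (rule finite_displacement)
  then have "\<not> inj u" using finite_imageD[of u UNIV] infinite_UNIV_nat by blast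
  then obtain k0 l0 where "u k0 = u l0" "k0 \<noteq> l0" unfolding inj_def by blast
  then obtain k l where kl: "u k = u l" "k < l" by (metis nat_neq_iff)
  have c: "a [^] m k \<in> carrier G" "a [^] m l \<in> carrier G" "b [^] k \<in> carrier G" "b [^] l \<in> carrier G" "b [^] (l - k) \<in> carrier G"
    using a_carrier b by auto
  have "b [^] (l - k) \<otimes> b [^] k = b [^] l" using kl b by (simp add: nat_pow_mult)
  also have "\<dots> = a [^] m l \<otimes> u l" using c by (simp add: u_def flip: m_assoc)
  also have "\<dots> = a [^] m l \<otimes> inv (a [^] m k) \<otimes> b [^] k"
    using c unfolding kl(1)[symmetric] by (simp add: u_def m_assoc)
  finally have "b [^] (l - k) = a [^] m l \<otimes> inv (a [^] m k)" using c by simp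
  also have "\<dots> = a [^] (m l - m k)" using a_carrier by (simp add: int_pow_diff)
  finally show ?thesis using kl by (intro exI[of _ "l - k"]) auto
qed

end

context geometric_CAT0
begin

lemma greedy_axial: "greedy a n \<Longrightarrow> i < n \<Longrightarrow> axial X G \<phi> (a i)"
  using greedy_coarse_kernel greedy_tlen_pos by (simp add: axial_def axial_axioms_def geometric_CAT0_axioms)

lemma virtually_Zn_coarse_kernel:
  assumes gr: "greedy a n" and mx: "cand a n = {}"
  shows "virtually_Zn n (G\<lparr>carrier := GX\<rparr>)"
proof -
  have "G\<lparr>carrier := range (zprod a n)\<rparr> \<cong> free_abelian_of_rank n"
    by (rule free_abelian_iso[OF greedy_commuting[OF gr]]) (use greedy_cand[OF gr] in \<open>auto simp: cand_def\<close>)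
  then show ?thesis unfolding virtually_Zn_def
    using maximal_greedy_finite_index[OF assms] by (intro exI[of _ "range (zprod a n)"]) simp
qed

lemma virtually_cyclic_coarse_kernel:
  assumes gr: "greedy a n" and mx: "cand a n = {}" and n: "n \<le> 1"
  shows "virtually_cyclic (G\<lparr>carrier := GX\<rparr>)"
proof -
  let ?H = "range (zprod a n)"
  note c = greedy_commuting[OF gr]
  \<comment> \<open>For \<open>n = 0\<close> the subgroup is trivial and generated by the
    identity.\<close>
  define g where "g = (if n = 0 then \<one> else a 0)"
  have gc: "g \<in> carrier G" using c n by (auto simp: g_def commuting_def)
  have z: "zprod a n f = g [^] f 0" for f
    using n c by (cases "n = 0") (auto simp: g_def commuting_def le_Suc_eq)
  have H: "subgroup ?H G" by (rule subgroup_range_zprod[OF c])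
  have HG: "Group.group (G\<lparr>carrier := ?H\<rparr>)" using subgroup.subgroup_is_group[OF H] is_group by blast
  have pow: "g [^] k \<in> ?H" for k :: int using z[of "\<lambda>_. k"] by (metis rangeI)
  have gH: "g \<in> ?H" using pow[of 1] gc by simp
  have "?H = range (\<lambda>k::int. g [^] k)" using z pow by auto
  also have "\<dots> = range (\<lambda>k::int. g [^]\<^bsub>G\<lparr>carrier := ?H\<rparr>\<^esub> k)"
    using int_pow_consistent[OF H gH] by simp
  finally have r: "?H = range (\<lambda>k::int. g [^]\<^bsub>G\<lparr>carrier := ?H\<rparr>\<^esub> k)" .
  have "carrier (G\<lparr>carrier := ?H\<rparr>) = range (\<lambda>k::int. g [^]\<^bsub>G\<lparr>carrier := ?H\<rparr>\<^esub> k)"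
    by (rule trans[OF _ r]) simp
  moreover have "g \<in> carrier (G\<lparr>carrier := ?H\<rparr>)" using gH by simp
  ultimately have "cyclic_group (G\<lparr>carrier := ?H\<rparr>)"
    unfolding group.cyclic_group[OF HG] by (rule bexI)
  then show ?thesis unfolding virtually_cyclic_def
    using maximal_greedy_finite_index[OF gr mx] by (intro exI[of _ ?H]) simp
qed

text \<open>Unboundedness places the whole space near an axis of \<open>a 0\<close>, so a second
  element would have a power in the subgroup generated by \<open>a 0\<close>.\<close>

lemma rank_le_1_if_unbounded:
  assumes gr: "greedy a n" and "curtain_weights lam" "unbounded_metric (curtain_model_dist lam :: 'a \<Rightarrow> 'a \<Rightarrow> real)"
  shows "n \<le> 1"
proof (rule ccontr)
  assume n: "\<not> n \<le> 1"
  interpret axial X G \<phi> "a 0" using n by (intro greedy_axial[OF gr]) simp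
  have b: "a 1 \<in> cand a 1" using greedy_cand[OF gr, of 1] n by simp
  then have "a 1 \<in> carrier G" using coarse_kernel_carrier by (auto simp: cand_def)
  moreover obtain x Q where "\<forall>p. \<exists>n. dist p (ax n x) \<le> Q" using near_axis_or_bounded[OF assms(2,3)] by blast
  ultimately have "\<exists>k\<ge>1. \<exists>m::int. a 1 [^] (k::nat) = a 0 [^] m" by (intro power_in_axis_subgroup[of x Q]) simp_all
  then obtain k :: nat and m :: int where k: "k \<ge> 1" "a 1 [^] k = a 0 [^] m" by blast
  have "zprod a 1 (\<lambda>_. m) = a 0 [^] m" using a_carrier by simp
  then have "a 1 [^] k \<in> range (zprod a 1)" using k(2) by (metis rangeI)
  then show False using b k(1) by (auto simp: cand_def)
qed

text \<open>A first element \<open>a 0\<close> would make the model a quasi-line. So the maximal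
  sequence is empty, its subgroup is trivial, and the finitely many coset representatives exhaust
  the kernel.\<close>

lemma finite_coarse_kernel:
  assumes "curtain_weights lam" "unbounded_metric (curtain_model_dist lam :: 'a \<Rightarrow> 'a \<Rightarrow> real)"
    "\<not> quasi_line (curtain_model_dist lam :: 'a \<Rightarrow> 'a \<Rightarrow> real)"
  shows "finite GX"
proof -
  obtain a n where gr: "greedy a n" and mx: "cand a n = {}" using greedy_maximal by blast
  have "n = 0"
  proof (rule ccontr)
    assume "n \<noteq> 0"
    then interpret axial X G \<phi> "a 0" by (intro greedy_axial[OF gr]) simp
    show False using quasi_line_if_unbounded[OF assms(1,2)] assms(3) by blast
  qed
  obtain R where R: "finite R" "R \<subseteq> GX" "\<forall>g\<in>GX. \<exists>r\<in>R. \<exists>u\<in>range (zprod a n). g = u \<otimes> r"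
    using maximal_greedy_finite_cosets[OF gr mx] by blast
  have "GX \<subseteq> R"
  proof
    fix g assume "g \<in> GX"
    then obtain r where "r \<in> R" "g = \<one> \<otimes> r" using R(3) \<open>n = 0\<close> by auto
    then show "g \<in> R" using R(2) coarse_kernel_carrier by auto
  qed
  then show ?thesis using R(1) finite_subset by blast
qed

end

theorem theorem1p4:
  fixes G :: "'g monoid"
    and \<phi> :: "'g \<Rightarrow> 'a::metric_space \<Rightarrow> 'a"
    and lam :: "nat \<Rightarrow> real"
  assumes "CAT0_space TYPE('a)"
    and "geometric_action G \<phi>"
    and "curtain_weights lam"
  shows "(\<exists>n. virtually_Zn n (G\<lparr>carrier := coarse_kernel G \<phi>\<rparr>))
    \<and> (unbounded_metric (curtain_model_dist lam :: 'a \<Rightarrow> 'a \<Rightarrow> real) \<longrightarrow>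
         virtually_cyclic (G\<lparr>carrier := coarse_kernel G \<phi>\<rparr>))
    \<and> (unbounded_metric (curtain_model_dist lam :: 'a \<Rightarrow> 'a \<Rightarrow> real) \<and>
         \<not> quasi_line (curtain_model_dist lam :: 'a \<Rightarrow> 'a \<Rightarrow> real) \<longrightarrow>
         largest_finite_normal_subgroup (coarse_kernel G \<phi>) G)"
proof -
  interpret geometric_CAT0 "TYPE('a)" G \<phi>
    using assms by (simp add: geometric_CAT0_def CAT0_def geometric_CAT0_axioms_def)
  obtain a n where gr: "greedy a n" and mx: "cand a n = {}" using greedy_maximal by blast
  show ?thesis
  proof (intro conjI impI)
    show "\<exists>n. virtually_Zn n (G\<lparr>carrier := coarse_kernel G \<phi>\<rparr>)"
      using virtually_Zn_coarse_kernel[OF gr mx] by blast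
    assume "unbounded_metric (curtain_model_dist lam :: 'a \<Rightarrow> 'a \<Rightarrow> real)"
    then show "virtually_cyclic (G\<lparr>carrier := coarse_kernel G \<phi>\<rparr>)"
      using virtually_cyclic_coarse_kernel[OF gr mx] rank_le_1_if_unbounded[OF gr assms(3)] by blast
  next
    assume "unbounded_metric (curtain_model_dist lam :: 'a \<Rightarrow> 'a \<Rightarrow> real) \<and>
         \<not> quasi_line (curtain_model_dist lam :: 'a \<Rightarrow> 'a \<Rightarrow> real)"
    then show "largest_finite_normal_subgroup (coarse_kernel G \<phi>) G"
      unfolding largest_finite_normal_subgroup_def
      using normal_coarse_kernel finite_coarse_kernel[OF assms(3)] finite_normal_subset_coarse_kernel by blast
  qed
qed

end
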